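(* Let $F$ be a probability distribution on $\mathbb{R}\cup\{-\infty\}$ such that $F([1-\epsilon,1])>0$ for all $\epsilon>0$ and $F((1,\infty))=0$. Let $\ell\in[0,1)$ be such that $p:=F([1-\ell,1])\in(0,1]$. Let $w=(w_i,\, i\ge 1)$ be a sequence of i.i.d. random variables with law $F$ and let $(w(t),\, t\in\mathbb{Z})$ be i.i.d. copies of $w$, with $w(t)=(w_1(t),w_2(t),\ldots)$. Given a nonzero $\nu(0)\in\mathcal{N}$, define $(\nu(t),\,t\ge 0)$ by $$\nu(t+1)=\Psi_{w(t+1)}\,\nu(t)\quad\text{for all } t\ge 0.$$ Then there exists a stationary process $(\overline{\mathfrak m}(t),\,t\in\mathbb{Z})$ (on the same probability space) such that, almost surely, $$\mathfrak m(\sigma\nu(t-1),w(t))=\overline{\mathfrak m}(t)\quad\text{for all } t \text{ large enough}.$$ In particular, $\mathbb{E}\big(\overline{\mathfrak m}(0)^+\big)=C(F)$, where $C(F)$ is the last passage percolation constant of $F$.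
   Context: Convention: $-\infty+x=-\infty$ for all $x\in\mathbb{R}\cup\{-\infty\}$; $x^+=\max(x,0)$. Point measures. $\mathcal{N}$ is the set of locally finite point measures $\nu$ on $\mathbb{R}\cup\{-\infty\}$ with a finite maximal element, i.e. measures with nonnegative integer values that are finite on every interval $[x,\infty)$, $x\in\mathbb{R}$, and whose largest atom, if $\nu\ne0$, is a real number; the zero measure belongs to $\mathcal{N}$. Such a $\nu$ is identified with the (finite or infinite) nonincreasing sequence $\nu_1\ge\nu_2\ge\cdots\ge-\infty$ of the locations of its atoms, counted with multiplicity: $\nu=\sum_{k}\delta_{\nu_k}$. Its number of atoms is $\|\nu\|$. Charges and dynamics. $\mathcal{W}$ is the set of sequences $w=(w_1,w_2,\ldots)$ in $\mathbb{R}\cup\{-\infty\}$ with $\sup_k w_k\le 1$. For $\nu\in\mathcal{N}$, $\nu\neq0$, and $w\in\mathcal{W}$, set $\mathfrak m(\nu,w):=\sup_k(\nu_k+w_k)$, the supremum being over all $k\ge1$ if $\|\nu\|=\infty$ and over $1\le k\le\|\nu\|$ otherwise, and $\Psi_w\nu:=\nu+\delta_{\mathfrak m(\nu,w)}$. For nonzero $\nu\in\mathcal{N}$, $\sigma\nu$ is the translate of $\nu$ by $-\nu_1$ (so its atoms are $\nu_k-\nu_1$, and its largest atom is at $0$). Last passage percolation constant. Let $(w_{i,j},\,0\le i<j)$ be i.i.d. with law $F$ (edge charges of the complete directed acyclic graph on the nonnegative integers). A path from $0$ to $n$ is an increasing sequence of integers $0=i_0<i_1<\cdots<i_k=n$,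 with charge $w_{i_0,i_1}+\cdots+w_{i_{k-1},i_k}$ (the charge of a single-vertex path is $0$). Let $W_n$ be the maximal charge over all paths from $0$ to $n$. Then $C(F)$ is the deterministic constant such that $W_n/n\to C(F)$ almost surely as $n\to\infty$. *)

theory Defs
  imports "HOL-Probability.Probability"
begin

text \<open>Measures on \<open>\<real> \<union> {-\<infinity>}\<close> are represented by measures on the Borel sets of
  \<^typ>\<open>ereal\<close> that do not charge the point \<open>\<infinity>\<close>; for the nonzero elements of the
  following set this is a consequence of the existence of a real largest atom.\<close>

definition point_measures :: "ereal measure set" where
  "point_measures =
    {\<nu>. sets \<nu> = sets borel
       \<and> (\<forall>A\<in>sets borel. emeasure \<nu> A = \<infinity> \<or> (\<exists>n::nat. emeasure \<nu> A = of_nat n))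
       \<and> (\<forall>x::real. emeasure \<nu> {ereal x..} < \<infinity>)
       \<and> (\<nu> \<noteq> null_measure borel \<longrightarrow>
            (\<exists>x::real. emeasure \<nu> {ereal x} > 0 \<and> emeasure \<nu> {ereal x<..} = 0))}"

definition num_atoms :: "ereal measure \<Rightarrow> ennreal" where
  "num_atoms \<nu> = emeasure \<nu> UNIV"

text \<open>The \<open>k\<close>-th largest atom with multiplicity, \<open>k \<ge> 1\<close>, is the largest \<open>x\<close> such that
  \<open>[x, \<infinity>)\<close> has mass at least \<open>k\<close>. It is meaningful only for \<open>1 \<le> k \<le> num_atoms \<nu>\<close>; see
  \<open>emeasure_eq_card_atoms\<close> below.\<close>

definition atom :: "ereal measure \<Rightarrow> nat \<Rightarrow> ereal" where
  "atom \<nu> k = Sup {x. of_nat k \<le> emeasure \<nu> {x..}}"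

lemma of_nat_le_emeasure_iff_atom:
  assumes "\<nu> \<in> point_measures"
  shows "of_nat k \<le> emeasure \<nu> {ereal x..} \<longleftrightarrow> of_nat k \<le> num_atoms \<nu> \<and> ereal x \<le> atom \<nu> k"
proof
  have s: "sets \<nu> = sets borel" using assms by (simp add: point_measures_def)
  assume *: "of_nat k \<le> emeasure \<nu> {ereal x..}"
  also have "\<dots> \<le> emeasure \<nu> UNIV" by (rule emeasure_mono) (auto simp: s)
  finally show "of_nat k \<le> num_atoms \<nu> \<and> ereal x \<le> atom \<nu> k"
    using * by (auto simp: num_atoms_def atom_def intro: Sup_upper)
next
  have s: "sets \<nu> = sets borel" using assms by (simp add: point_measures_def)
  assume *: "of_nat k \<le> num_atoms \<nu> \<and> ereal x \<le> atom \<nu> k"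
  let ?A = "\<lambda>n::nat. {ereal (x - 1 / real (Suc n))..}"
  have ge: "of_nat k \<le> emeasure \<nu> (?A n)" for n
  proof -
    have "ereal (x - 1 / real (Suc n)) < ereal x" by simp
    also have "\<dots> \<le> atom \<nu> k" using * by simp
    finally obtain z where z: "of_nat k \<le> emeasure \<nu> {z..}" "ereal (x - 1 / real (Suc n)) < z"
      unfolding atom_def less_Sup_iff by blast
    have "emeasure \<nu> {z..} \<le> emeasure \<nu> (?A n)"
      using z by (intro emeasure_mono) (auto simp: s)
    with z show ?thesis by simp
  qed
  have fin: "emeasure \<nu> {ereal y..} \<noteq> \<infinity>" for y
    using assms by (auto simp: point_measures_def less_top)
  have "(\<lambda>n. emeasure \<nu> (?A n)) \<longlonglongrightarrow> emeasure \<nu> (\<Inter>n. ?A n)"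
  proof (rule Lim_emeasure_decseq)
    show "decseq ?A"
    proof (rule decseq_SucI)
      fix n
      have "1 / real (Suc (Suc n)) \<le> 1 / real (Suc n)" by (simp add: field_simps)
      then have "ereal (x - 1 / real (Suc n)) \<le> ereal (x - 1 / real (Suc (Suc n)))"
        unfolding ereal_less_eq by linarith
      then show "?A (Suc n) \<subseteq> ?A n" by (simp only: atLeast_subset_iff)
    qed
    show "range ?A \<subseteq> sets \<nu>" unfolding s by (rule image_subsetI) simp
  qed (rule fin)
  moreover have "(\<Inter>n. ?A n) = {ereal x..}"
  proof (intro equalityI subsetI)
    fix y assume y: "y \<in> (\<Inter>n. ?A n)"
    have "(\<lambda>n. ereal (x - 1 / real (Suc n))) \<longlonglongrightarrow> ereal (x - 0)"
      by (intro tendsto_intros tendsto_ereal LIMSEQ_Suc[OF lim_1_over_n])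
    then have "ereal (x - 0) \<le> y"
      by (rule LIMSEQ_le_const2) (use y in auto)
    then show "y \<in> {ereal x..}" by simp
  next
    fix y assume "y \<in> {ereal x..}"
    then have "ereal x \<le> y" by simp
    moreover have "ereal (x - 1 / real (Suc n)) \<le> ereal x" for n by simp
    ultimately have "ereal (x - 1 / real (Suc n)) \<le> y" for n by (rule order_trans[rotated])
    then show "y \<in> (\<Inter>n. ?A n)" by blast
  qed
  ultimately show "of_nat k \<le> emeasure \<nu> {ereal x..}"
    using ge by (intro LIMSEQ_le_const[where X = "\<lambda>n. emeasure \<nu> (?A n)"]) simp_all
qed

lemma emeasure_eq_card_atoms:
  assumes "\<nu> \<in> point_measures"
  shows "finite {k. 1 \<le> k \<and> of_nat k \<le> num_atoms \<nu> \<and> ereal x \<le> atom \<nu> k}" (is "finite ?S")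
    and "emeasure \<nu> {ereal x..} =
           of_nat (card {k. 1 \<le> k \<and> of_nat k \<le> num_atoms \<nu> \<and> ereal x \<le> atom \<nu> k})"
proof -
  obtain n :: nat where n: "emeasure \<nu> {ereal x..} = of_nat n"
  proof -
    have "{ereal x..} \<in> sets borel" by simp
    moreover have "emeasure \<nu> {ereal x..} \<noteq> \<infinity>"
      using assms by (simp add: point_measures_def less_top)
    ultimately show ?thesis
      using assms that unfolding point_measures_def mem_Collect_eq by meson
  qed
  have "?S = {1..n}"
    unfolding of_nat_le_emeasure_iff_atom[OF assms, symmetric] n of_nat_le_iff by auto
  then show "finite ?S" and "emeasure \<nu> {ereal x..} = of_nat (card ?S)"
    by (simp_all add: n)
qed

text \<open>Charge sequences are indexed by \<open>k \<ge> 1\<close>; the value at \<open>0\<close> is not used. As charges are at most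
  \<open>1\<close>, addition on \<^typ>\<open>ereal\<close> obeys the convention \<open>-\<infinity> + x = -\<infinity>\<close>.\<close>

definition max_charge :: "ereal measure \<Rightarrow> (nat \<Rightarrow> ereal) \<Rightarrow> ereal" where
  "max_charge \<nu> w = (SUP k\<in>{k. 1 \<le> k \<and> of_nat k \<le> num_atoms \<nu>}. atom \<nu> k + w k)"

definition add_measure :: "'a measure \<Rightarrow> 'a measure \<Rightarrow> 'a measure" where
  "add_measure \<mu> \<nu> = measure_of (space \<mu>) (sets \<mu>) (\<lambda>A. emeasure \<mu> A + emeasure \<nu> A)"

lemma sets_add_measure: "sets (add_measure \<mu> \<nu>) = sets \<mu>"
  by (simp add: add_measure_def)

lemma emeasure_add_measure:
  assumes "sets \<mu> = sets \<nu>" "A \<in> sets \<mu>"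
  shows "emeasure (add_measure \<mu> \<nu>) A = emeasure \<mu> A + emeasure \<nu> A"
proof (rule emeasure_measure_of[OF add_measure_def])
  show "countably_additive (sets (add_measure \<mu> \<nu>)) (\<lambda>A. emeasure \<mu> A + emeasure \<nu> A)"
    unfolding countably_additive_def sets_add_measure
  proof (intro allI impI)
    fix A :: "nat \<Rightarrow> 'a set"
    assume "range A \<subseteq> sets \<mu>" "disjoint_family A"
    then show "(\<Sum>i. emeasure \<mu> (A i) + emeasure \<nu> (A i)) =
        emeasure \<mu> (\<Union>i. A i) + emeasure \<nu> (\<Union>i. A i)"
      by (simp add: suminf_add[symmetric] suminf_emeasure assms(1)[symmetric])
  qed
qed (use assms sets.space_closed[of \<mu>] in \<open>auto simp: positive_def sets_add_measure\<close>)

definition Psi :: "(nat \<Rightarrow> ereal) \<Rightarrow> ereal measure \<Rightarrow> ereal measure" where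
  "Psi w \<nu> = add_measure \<nu> (return borel (max_charge \<nu> w))"

definition recenter :: "ereal measure \<Rightarrow> ereal measure" where
  "recenter \<nu> = distr \<nu> borel (\<lambda>x. x - atom \<nu> 1)"

definition stationary_process :: "'a measure \<Rightarrow> (int \<Rightarrow> 'a \<Rightarrow> ereal) \<Rightarrow> bool" where
  "stationary_process M X \<longleftrightarrow>
     (\<forall>t. X t \<in> borel_measurable M) \<and>
     (\<forall>s. distr M (PiM UNIV (\<lambda>_. borel)) (\<lambda>\<omega> t. X (t + s) \<omega>) =
          distr M (PiM UNIV (\<lambda>_. borel)) (\<lambda>\<omega> t. X t \<omega>))"

definition lpp_paths :: "nat \<Rightarrow> nat list set" where
  "lpp_paths n = {p. p \<noteq> [] \<and> sorted_wrt (<) p \<and> hd p = 0 \<and> last p = n}"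

definition path_charge :: "(nat \<times> nat \<Rightarrow> ereal) \<Rightarrow> nat list \<Rightarrow> ereal" where
  "path_charge e p = (\<Sum>ij\<leftarrow>zip p (tl p). e ij)"

text \<open>There are finitely many paths from \<open>0\<close> to \<open>n\<close>, so the supremum is a maximum.\<close>

definition lpp_max :: "(nat \<times> nat \<Rightarrow> ereal) \<Rightarrow> nat \<Rightarrow> ereal" where
  "lpp_max e n = (SUP p\<in>lpp_paths n. path_charge e p)"

definition lpp_space :: "ereal measure \<Rightarrow> (nat \<times> nat \<Rightarrow> ereal) measure" where
  "lpp_space F = PiM {(i, j). i < j} (\<lambda>_. F)"

definition lpp_constant :: "ereal measure \<Rightarrow> real" where
  "lpp_constant F =
     (THE c. AE e in lpp_space F. (\<lambda>n. lpp_max e n / ereal (real n)) \<longlonglongrightarrow> ereal c)"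

lemma lpp_constant_eqI:
  assumes "prob_space F"
    and "AE e in lpp_space F. (\<lambda>n. lpp_max e n / ereal (real n)) \<longlonglongrightarrow> ereal c"
  shows "lpp_constant F = c"
  unfolding lpp_constant_def
proof (rule the_equality)
  interpret P: prob_space "lpp_space F"
    unfolding lpp_space_def by (rule prob_space_PiM) (rule assms(1))
  fix d assume "AE e in lpp_space F. (\<lambda>n. lpp_max e n / ereal (real n)) \<longlonglongrightarrow> ereal d"
  with assms(2) have "AE e in lpp_space F. d = c"
    by eventually_elim (use LIMSEQ_unique in force)
  then show "d = c" by simp
qed (rule assms(2))

end

theory Submission
  imports Defs
begin

text \<open>
  A regeneration argument. Suppose that the first two steps after time \<open>s\<close> have first charge
  \<open>\<ge> 1/2\<close>, and that for \<open>n \<ge> 2\<close> the \<open>(n + 1)\<close>-st step has a charge \<open>\<ge> 1/2\<close> among its first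
  \<open>n - 1\<close> ones. The first step opens a gap \<open>\<ge> 1/2\<close> at the top, and from then on the top \<open>n\<close> atoms
  relative to the largest one do not depend on the configuration at time \<open>s\<close>: charges being at
  most \<open>1\<close>, the lower atoms never attain the maximum. The probability that no time in a window of
  length \<open>K\<close> starts such a stretch is \<open>O(K\<^sup>-\<^sup>2)\<close>, as one sees by cutting it into \<open>\<surd>K\<close> blocks of
  length \<open>\<surd>K\<close>. So \<open>mbar t\<close>, the limit over \<open>s \<rightarrow> -\<infinity>\<close> of the charge at time \<open>t\<close> of the system
  started at time \<open>s\<close> from one atom, exists, is stationary, and is reached from every start.

  The same estimate bounds the variance of the front at time \<open>k\<^sup>3\<close>, a sum of bounded increments. In
  last passage percolation the weights of the vertices have the law of the successive atoms of the
  system started from one atom, because attaching i.i.d. charges to ranks instead of vertices only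
  permutes them. Borel--Cantelli along cubes and monotonicity then give the law of large numbers.\<close>

section \<open>Coupling by regeneration\<close>

text \<open>The threshold 1/2 is half of the largest possible charge: a gap of 1/2 plus a charge of
  1/2 makes up for the charge 1 that a lower atom might receive. Cubes come from the quadratic bound
  on the failure probabilities: with covariances cut off at distance k, the relative variance at
  time k^3 is O(k/k^3) from near pairs plus O(k^-2) from far ones, and both are summable.

  The passage to percolation meets two obstacles. Weights and atoms agree only in law, for the
  vector of the first n weights; so a second moment and a probability are carried over, and the
  almost sure statements are derived afresh on the percolation side. Moreover only the running
  maximum of W_0, ..., W_n is monotone, while W_n itself may fall below it, even to -\<infinity>.
  Regeneration controls this as well: a stretch within the last K rows keeps the new atom at most K
  below the front, so W_{n+1} is at least the running maximum minus K outside an event of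
  probability O(K^-2). With K a small proportion of n, Borel-Cantelli shows that both have the same
  linear growth.\<close>

definition insert_desc :: "(nat \<Rightarrow> ereal) \<Rightarrow> ereal \<Rightarrow> nat \<Rightarrow> ereal" where
  "insert_desc a m k = max (a k) (min m (case k of 0 \<Rightarrow> \<infinity> | Suc j \<Rightarrow> a j))"

text \<open>Missing atoms are encoded as -\<infinity>, so the supremum can run over all indices. A
  missing atom and an atom at -\<infinity> need not be told apart: neither contributes as long as
  charges are at most 1.\<close>

definition top_charge :: "(nat \<Rightarrow> ereal) \<Rightarrow> (nat \<Rightarrow> ereal) \<Rightarrow> ereal" where
  "top_charge a v = (SUP k. a k + v k)"

primrec atoms_after :: "(nat \<Rightarrow> ereal) \<Rightarrow> (nat \<Rightarrow> nat \<Rightarrow> ereal) \<Rightarrow> nat \<Rightarrow> nat \<Rightarrow> ereal" where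
  "atoms_after a \<eta> 0 = a"
| "atoms_after a \<eta> (Suc n) = insert_desc (atoms_after a \<eta> n) (top_charge (atoms_after a \<eta> n) (\<eta> n))"

text \<open>For atom sequences of point measures this is the charge of the recentred configuration,
  the quantity compared with the stationary process. Row \<open>\<eta> n\<close> drives step
  \<open>n + 1\<close>.\<close>

definition rel_charge :: "(nat \<Rightarrow> ereal) \<Rightarrow> (nat \<Rightarrow> nat \<Rightarrow> ereal) \<Rightarrow> nat \<Rightarrow> ereal" where
  "rel_charge a \<eta> n = top_charge (atoms_after a \<eta> n) (\<eta> n) - atoms_after a \<eta> n 0"

definition proper :: "(nat \<Rightarrow> ereal) \<Rightarrow> bool" where
  "proper a \<longleftrightarrow> decseq a \<and> \<bar>a 0\<bar> \<noteq> \<infinity>"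

text \<open>Truncated subtraction makes rows 0, 1 and 2 all ask for the first charge. From row 2 on,
  row \<open>i\<close> may use only \<open>i - 1\<close> of the \<open>i\<close> atoms controlled by
  then, because the lowest of them is the reference atom below the gap.\<close>

definition regen :: "(nat \<Rightarrow> nat \<Rightarrow> ereal) \<Rightarrow> nat \<Rightarrow> bool" where
  "regen \<eta> n \<longleftrightarrow> (\<forall>i<n. \<exists>k<max 1 (i - 1). ereal (1/2) \<le> \<eta> i k)"

lemma insert_desc_0: "insert_desc a m 0 = max (a 0) m"
  by (simp add: insert_desc_def)

lemma insert_desc_Suc: "insert_desc a m (Suc k) = max (a (Suc k)) (min m (a k))"
  by (simp add: insert_desc_def)

lemma decseq_insert_desc:
  assumes "decseq a" shows "decseq (insert_desc a m)"
proof (rule decseq_SucI)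
  fix k
  have d: "a (Suc i) \<le> a i" for i using assms by (simp add: decseq_Suc_iff)
  show "insert_desc a m (Suc k) \<le> insert_desc a m k"
  proof (cases k)
    case 0 with d[of 0] show ?thesis
      by (simp add: insert_desc_0 insert_desc_Suc max.coboundedI1 max.coboundedI2 min.coboundedI1)
  next
    case (Suc j)
    have "min m (a (Suc j)) \<le> min m (a j)" using d[of j] by (auto simp: min_def)
    then show ?thesis unfolding Suc insert_desc_Suc using d[of "Suc j"] d[of j]
      by (auto intro: max.coboundedI1 max.coboundedI2 simp: le_max_iff_disj)
  qed
qed

lemma top_charge_le:
  assumes "proper a" "\<And>k. v k \<le> 1"
  shows "top_charge a v \<le> a 0 + 1"
  unfolding top_charge_def
proof (rule SUP_least)
  fix k
  have "a k \<le> a 0" using assms(1) by (auto simp: proper_def decseq_def)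
  then show "a k + v k \<le> a 0 + 1" using assms(2) by (intro add_mono) auto
qed

lemma proper_insert_desc:
  assumes "proper a" "m \<noteq> \<infinity>" shows "proper (insert_desc a m)"
  using assms decseq_insert_desc[of a m] by (cases "a 0"; cases m) (auto simp: proper_def insert_desc_0 max_def)

lemma proper_step:
  assumes "proper a" "\<And>k. v k \<le> 1"
  shows "proper (insert_desc a (top_charge a v))"
  using assms(1)
proof (rule proper_insert_desc)
  have "top_charge a v \<le> a 0 + 1" by (rule top_charge_le[OF assms])
  then show "top_charge a v \<noteq> \<infinity>" using assms(1) by (cases "a 0") (auto simp: proper_def)
qed

lemma proper_atoms_after:
  assumes "proper a" "\<And>i k. \<eta> i k \<le> 1"
  shows "proper (atoms_after a \<eta> n)"
  by (induction n) (use assms in \<open>auto intro: proper_step\<close>)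

lemma atoms_after_add:
  "atoms_after a \<eta> (s + n) = atoms_after (atoms_after a \<eta> s) (\<lambda>i. \<eta> (s + i)) n"
  by (induction n) auto

lemma rel_charge_add:
  "rel_charge a \<eta> (s + n) = rel_charge (atoms_after a \<eta> s) (\<lambda>i. \<eta> (s + i)) n"
  by (simp add: rel_charge_def atoms_after_add)

lemma atoms_after_cong:
  "(\<And>i k. i < n \<Longrightarrow> \<eta> i k = \<theta> i k) \<Longrightarrow> atoms_after a \<eta> n = atoms_after a \<theta> n"
proof (induction n)
  case (Suc n)
  then have "atoms_after a \<eta> n = atoms_after a \<theta> n" "\<eta> n = \<theta> n" by auto
  then show ?case by simp
qed simp

lemma rel_charge_le:
  assumes "proper a" "\<And>i k. \<eta> i k \<le> 1"
  shows "rel_charge a \<eta> n \<le> 1"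
proof -
  have p: "proper (atoms_after a \<eta> n)" by (rule proper_atoms_after[OF assms])
  from top_charge_le[OF p, of "\<eta> n"] assms(2) p show ?thesis
    unfolding rel_charge_def
    by (cases "atoms_after a \<eta> n 0"; cases "top_charge (atoms_after a \<eta> n) (\<eta> n)")
       (auto simp: proper_def one_ereal_def)
qed

text \<open>Here the positive part enters: a new atom below the front leaves the front in
  place.\<close>

lemma front_Suc:
  assumes "proper a" "\<And>i k. \<eta> i k \<le> 1"
  shows "atoms_after a \<eta> (Suc n) 0 = atoms_after a \<eta> n 0 + max 0 (rel_charge a \<eta> n)"
proof -
  have p: "proper (atoms_after a \<eta> n)" by (rule proper_atoms_after[OF assms])
  then show ?thesis
    unfolding rel_charge_def atoms_after.simps insert_desc_0
    by (cases "atoms_after a \<eta> n 0"; cases "top_charge (atoms_after a \<eta> n) (\<eta> n)")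
       (auto simp: proper_def max_def)
qed

text \<open>Atoms from index \<open>j\<close> on lie at or below \<open>a (j - 1)\<close> and gain
  at most 1, so a single candidate reaching \<open>a (j - 1) + 1\<close> hides all of them.\<close>

lemma top_charge_eq_SUP_lessThan:
  assumes "decseq a" "\<And>k. v k \<le> 1" "k < j" "a (j - 1) + 1 \<le> a k + v k"
  shows "top_charge a v = (SUP k\<in>{..<j}. a k + v k)"
  unfolding top_charge_def
proof (rule antisym)
  show "(SUP k. a k + v k) \<le> (SUP k\<in>{..<j}. a k + v k)"
  proof (rule SUP_least)
    fix i show "a i + v i \<le> (SUP k\<in>{..<j}. a k + v k)"
    proof (cases "i < j")
      case True then show ?thesis by (intro SUP_upper) auto
    next
      case False
      then have "a i \<le> a (j - 1)" using assms(1) by (auto simp: decseq_def)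
      then have "a i + v i \<le> a (j - 1) + 1" using assms(2) by (intro add_mono) auto
      also note assms(4)
      also have "a k + v k \<le> (SUP k\<in>{..<j}. a k + v k)" using assms(3) by (intro SUP_upper) auto
      finally show ?thesis .
    qed
  qed
qed (auto intro!: SUP_mono)

text \<open>The state after a regeneration stretch of length \<open>n \<ge> 2\<close>: the \<open>n\<close>-th atom was the
  largest one just before the second step, and everything below it can no longer
  produce the maximum, because each later step has a charge \<open>\<ge> 1/2\<close> at an atom at least \<open>1/2\<close>
  above it.\<close>

definition coupled :: "nat \<Rightarrow> (nat \<Rightarrow> ereal) \<Rightarrow> (nat \<Rightarrow> ereal) \<Rightarrow> bool" where
  "coupled n a b \<longleftrightarrow> proper a \<and> proper b \<and> (\<exists>c::real. \<forall>k<n. b k = a k + ereal c)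
     \<and> a (n - 1) \<noteq> -\<infinity> \<and> a (n - 1) + ereal (1/2) \<le> a (n - 2) \<and> a 0 \<le> a (n - 1) + ereal n"

text \<open>The chosen atom lies at least 1/2 above the reference atom \<open>a (n - 1)\<close> and
  gains at least 1/2, so it reaches the reference plus 1. This hides everything below the top
  \<open>n\<close> atoms in both configurations, and on those the two differ by the constant
  \<open>c\<close>.\<close>

lemma coupled_top_charge:
  assumes c: "coupled n a b" "\<And>k. v k \<le> 1" "k < n - 1" "ereal (1/2) \<le> v k"
    and c': "\<And>k. k < n \<Longrightarrow> b k = a k + ereal c"
  shows "top_charge b v = top_charge a v + ereal c" "a (n - 1) + 1 \<le> top_charge a v"
proof -
  have pr: "decseq a" "decseq b" using c by (auto simp: coupled_def proper_def)
  have n: "n \<ge> 2" using c(3) by auto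
  have "a (n - 2) \<le> a k" using pr(1) c(3) by (auto simp: decseq_def)
  then have "a (n - 1) + ereal (1/2) \<le> a k" using c by (auto simp: coupled_def)
  then have "a (n - 1) + ereal (1/2) + ereal (1/2) \<le> a k + v k" using c(4) by (intro add_mono) auto
  then have *: "a (n - 1) + 1 \<le> a k + v k"
    by (simp add: add.assoc one_ereal_def)
  have t: "top_charge a v = (SUP k\<in>{..<n}. a k + v k)"
    by (rule top_charge_eq_SUP_lessThan[where k = k]) (use pr(1) c(2,3) * in auto)
  have "b (n - 1) + 1 = a (n - 1) + 1 + ereal c" using c'[of "n - 1"] n by (simp add: ac_simps)
  also have "\<dots> \<le> a k + v k + ereal c" by (rule add_right_mono[OF *])
  also have "\<dots> = b k + v k" using c'[of k] c(3) by (simp add: ac_simps)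
  finally have "b (n - 1) + 1 \<le> b k + v k" .
  then have "top_charge b v = (SUP k\<in>{..<n}. b k + v k)"
    by (intro top_charge_eq_SUP_lessThan[where k = k]) (use pr(2) c(2,3) in auto)
  also have "\<dots> = (SUP k\<in>{..<n}. (a k + v k) + ereal c)"
    by (rule SUP_cong) (auto simp: c' ac_simps)
  also have "\<dots> = (SUP k\<in>{..<n}. a k + v k) + ereal c"
    by (rule SUP_ereal_add_left) (use n in \<open>auto simp: lessThan_empty_iff\<close>)
  finally show "top_charge b v = top_charge a v + ereal c" by (simp add: t)
  have "a k + v k \<le> top_charge a v" unfolding top_charge_def by (intro SUP_upper) auto
  with * show "a (n - 1) + 1 \<le> top_charge a v" by simp
qed

text \<open>The new atom lands at least 1 above the reference, hence shifts the reference from index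
  \<open>n - 1\<close> to index \<open>n\<close>: the controlled part grows by one entry and keeps
  the same reference and the same translation constant.\<close>

lemma coupled_step:
  assumes c: "coupled n a b" "\<And>k. v k \<le> 1" "k < n - 1" "ereal (1/2) \<le> v k"
  shows "coupled (Suc n) (insert_desc a (top_charge a v)) (insert_desc b (top_charge b v))"
proof -
  from c obtain c' where c': "\<And>k. k < n \<Longrightarrow> b k = a k + ereal c'" by (auto simp: coupled_def)
  have n: "n \<ge> 2" using c(3) by auto
  have pr: "proper a" "proper b" using c by (auto simp: coupled_def)
  then have d: "decseq a" "decseq b" by (auto simp: proper_def)
  have t: "top_charge b v = top_charge a v + ereal c'" "a (n - 1) + 1 \<le> top_charge a v"
    using coupled_top_charge[where a = a and b = b and n = n and v = v and k = k and c = c'] c c' by auto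
  define m where "m = top_charge a v"
  obtain j where j: "n = Suc (Suc j)" using n by (cases n; cases "n - 1") auto
  have am: "a (Suc j) + 1 \<le> m" using t(2) by (simp add: j m_def)
  then have "a (Suc j) \<le> m"
    by (rule order_trans[rotated]) (cases "a (Suc j)"; simp add: one_ereal_def)
  moreover have "a n \<le> a (Suc j)" using d by (simp add: decseq_def j)
  ultimately have an: "insert_desc a m n = a (Suc j)" unfolding j insert_desc_Suc
    by (simp add: min_def max_def)
  have "b (Suc j) \<le> m + ereal c'" using \<open>a (Suc j) \<le> m\<close> c'[of "Suc j"] j by (auto intro: add_right_mono)
  moreover have "b n \<le> b (Suc j)" using d by (simp add: decseq_def j)
  ultimately have bn: "insert_desc b (m + ereal c') n = b (Suc j)" unfolding j insert_desc_Suc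
    by (simp add: min_def max_def)
  have cc: "insert_desc b (m + ereal c') k = insert_desc a m k + ereal c'" if "k < Suc n" for k
  proof (cases "k = n")
    case True then show ?thesis using an bn c'[of "Suc j"] j by simp
  next
    case False
    with that have k: "k < n" by simp
    have ad: "max x y + ereal c' = max (x + ereal c') (y + ereal c')"
             "min x y + ereal c' = min (x + ereal c') (y + ereal c')" for x y
      by (auto simp: max_def min_def ereal_add_le_add_iff2)
    show ?thesis using k by (cases k) (auto simp: insert_desc_0 insert_desc_Suc ad c')
  qed
  have g: "a (Suc j) + ereal (1/2) \<le> a j" "a (Suc j) \<noteq> -\<infinity>" "a 0 \<le> a (Suc j) + ereal n" using c by (auto simp: coupled_def j)
  \<comment> \<open>The entry just above the reference becomes the smaller of the new atom and the
    former upper neighbour; both are at least 1/2 above the reference, so the gap survives.\<close>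
  have "a (Suc j) + ereal (1/2) \<le> m" using am
    by (rule order_trans[rotated]) (cases "a (Suc j)"; simp add: one_ereal_def)
  with g have "a (Suc j) + ereal (1/2) \<le> insert_desc a m (Suc j)"
    by (simp add: insert_desc_Suc le_max_iff_disj)
  \<comment> \<open>The front rises by at most 1 per step. This clause of \<open>coupled\<close>
    serves the lower bound on the relative charge.\<close>
  moreover have "insert_desc a m 0 \<le> a (Suc j) + ereal (Suc n)"
  proof -
    have "m \<le> a 0 + 1" unfolding m_def by (rule top_charge_le[OF pr(1) c(2)])
    also have "\<dots> \<le> a (Suc j) + ereal n + 1" by (rule add_right_mono) (rule g)
    also have "\<dots> = a (Suc j) + ereal (Suc n)" by (cases "a (Suc j)") (auto simp: one_ereal_def)
    finally have "m \<le> a (Suc j) + ereal (Suc n)" .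
    moreover have "a 0 \<le> a (Suc j) + ereal (Suc n)"
      by (rule order_trans[OF g(3)]) (auto intro!: add_left_mono)
    ultimately show ?thesis by (simp add: insert_desc_0)
  qed
  ultimately have "coupled (Suc n) (insert_desc a m) (insert_desc b (m + ereal c'))"
    using proper_step[where a = a and v = v] proper_step[where a = b and v = v] pr c(2) cc g an t(1)
    unfolding coupled_def by (auto simp: m_def j)
  then show ?thesis using t(1) by (simp add: m_def)
qed

lemma gap_step:
  assumes "proper a" "\<And>k. v k \<le> 1" "ereal (1/2) \<le> v 0"
  shows "insert_desc a (top_charge a v) 1 + ereal (1/2) \<le> insert_desc a (top_charge a v) 0"
proof -
  have "a 0 + ereal (1/2) \<le> a 0 + v 0" using assms by (intro add_left_mono)
  also have "\<dots> \<le> top_charge a v" unfolding top_charge_def by (intro SUP_upper) auto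
  finally have t: "a 0 + ereal (1/2) \<le> top_charge a v" .
  have "a 1 \<le> a 0" using assms by (auto simp: proper_def decseq_def)
  with t show ?thesis using assms(1)
    by (cases "a 0"; cases "a 1"; cases "top_charge a v")
       (auto simp: insert_desc_0 insert_desc_Suc proper_def max_def min_def)
qed

text \<open>With the gap open the first atom decides alone: it gains at least 1/2, while the others
  start at least 1/2 lower and gain at most 1.\<close>

lemma gap_top_charge:
  assumes "proper a" "\<And>k. v k \<le> 1" "ereal (1/2) \<le> v 0" "a 1 + ereal (1/2) \<le> a 0"
  shows "top_charge a v = a 0 + v 0"
  unfolding top_charge_def
proof (rule antisym)
  show "(SUP k. a k + v k) \<le> a 0 + v 0"
  proof (rule SUP_least)
    fix k show "a k + v k \<le> a 0 + v 0"
    proof (cases "k = 0")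
      case False
      then have "a k \<le> a 1" using assms by (auto simp: proper_def decseq_def)
      then have "a k + v k \<le> a 1 + 1" using assms(2) by (intro add_mono) auto
      also have "\<dots> = a 1 + ereal (1/2) + ereal (1/2)" by (simp add: add.assoc one_ereal_def)
      also have "\<dots> \<le> a 0 + v 0" using assms by (intro add_mono)
      finally show ?thesis .
    qed simp
  qed
qed (auto intro: SUP_upper)

text \<open>This is where the past is forgotten: in either configuration the new atom sits exactly
  \<open>v 0\<close> above the old front. The translation constant is the difference of the two old
  fronts.\<close>

lemma coupled_second_step:
  assumes "proper a" "proper b" "\<And>k. v k \<le> 1" "ereal (1/2) \<le> v 0"
    and "a 1 + ereal (1/2) \<le> a 0" "b 1 + ereal (1/2) \<le> b 0"
  shows "coupled 2 (insert_desc a (top_charge a v)) (insert_desc b (top_charge b v))"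
proof -
  have t: "top_charge a v = a 0 + v 0" "top_charge b v = b 0 + v 0"
    using gap_top_charge assms by auto
  obtain x y z where r: "a 0 = ereal x" "b 0 = ereal y" "v 0 = ereal z"
    using assms(1,2,4) assms(3)[of 0] by (cases "a 0"; cases "b 0"; cases "v 0") (auto simp: proper_def)
  have z: "1/2 \<le> z" "z \<le> 1" using assms(4) assms(3)[of 0] by (auto simp: r)
  have "a 1 \<le> a 0" "b 1 \<le> b 0" using assms by (auto simp: proper_def decseq_def)
  then have i: "insert_desc a (a 0 + v 0) 1 = ereal x" "insert_desc b (b 0 + v 0) 1 = ereal y"
      "insert_desc a (a 0 + v 0) 0 = ereal (x + z)" "insert_desc b (b 0 + v 0) 0 = ereal (y + z)"
    using z by (auto simp: insert_desc_0 insert_desc_Suc r max_def min_def)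
  have "\<exists>c::real. \<forall>k<2. insert_desc b (b 0 + v 0) k = insert_desc a (a 0 + v 0) k + ereal c"
    using i by (intro exI[of _ "y - x"]) (auto simp: less_2_cases_iff)
  moreover have "proper (insert_desc a (a 0 + v 0))" "proper (insert_desc b (b 0 + v 0))"
    using proper_step[of a v] proper_step[of b v] assms t by auto
  ultimately show ?thesis
    unfolding coupled_def t using i z by simp
qed

lemma regen_coupled:
  assumes "proper a" "proper b" "\<And>i k. \<eta> i k \<le> 1" "regen \<eta> (n + 2)"
  shows "coupled (n + 2) (atoms_after a \<eta> (n + 2)) (atoms_after b \<eta> (n + 2))"
  using assms(4)
proof (induction n)
  case 0
  have "ereal (1/2) \<le> \<eta> 0 0" "ereal (1/2) \<le> \<eta> 1 0"
    using 0 by (auto simp: regen_def numeral_2_eq_2 less_Suc_eq)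
  with assms have "coupled 2
      (insert_desc (insert_desc a (top_charge a (\<eta> 0)))
        (top_charge (insert_desc a (top_charge a (\<eta> 0))) (\<eta> 1)))
      (insert_desc (insert_desc b (top_charge b (\<eta> 0)))
        (top_charge (insert_desc b (top_charge b (\<eta> 0))) (\<eta> 1)))"
    by (intro coupled_second_step gap_step proper_step) auto
  then show ?case by (simp add: numeral_2_eq_2)
next
  case (Suc n)
  from Suc.prems obtain k where k: "k < max 1 (n + 2 - 1)" "ereal (1/2) \<le> \<eta> (n + 2) k"
    unfolding regen_def by auto
  have "regen \<eta> (n + 2)" using Suc.prems by (auto simp: regen_def)
  from coupled_step[OF Suc.IH[OF this] assms(3), where k = k] k show ?case by auto
qed

text \<open>The stretch has \<open>Suc n\<close> rows for \<open>n\<close> steps because the charge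
  read off at the end uses row \<open>n\<close> too. For \<open>n = 1\<close> there is no coupled
  block yet, but the open gap makes the charge equal to \<open>\<eta> 1 0\<close>. For larger
  \<open>n\<close> the maximum is at least the reference plus 1, and the front is at most
  \<open>n\<close> above the reference.\<close>

lemma rel_charge_coupling:
  assumes "proper a" "proper b" "\<And>i k. \<eta> i k \<le> 1" "regen \<eta> (Suc n)" "1 \<le> n"
  shows "rel_charge a \<eta> n = rel_charge b \<eta> n" "ereal (- real n) \<le> rel_charge a \<eta> n"
proof -
  have "rel_charge a \<eta> n = rel_charge b \<eta> n \<and> ereal (- real n) \<le> rel_charge a \<eta> n"
  proof (cases "n = 1")
    case True
    have g: "ereal (1/2) \<le> \<eta> 0 0" "ereal (1/2) \<le> \<eta> 1 0"
      using assms(4) True by (auto simp: regen_def less_Suc_eq)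
    have h: "top_charge (atoms_after c \<eta> 1) (\<eta> 1) - atoms_after c \<eta> 1 0 = \<eta> 1 0" if "proper c" for c
    proof -
      have p: "proper (atoms_after c \<eta> 1)" using that assms by (intro proper_atoms_after)
      have "top_charge (atoms_after c \<eta> 1) (\<eta> 1) = atoms_after c \<eta> 1 0 + \<eta> 1 0"
        by (rule gap_top_charge) (use p assms g gap_step[OF that, of "\<eta> 0"] in auto)
      then show ?thesis using p
        by (cases "atoms_after c \<eta> 1 0"; cases "\<eta> 1 0") (auto simp: proper_def)
    qed
    have "ereal (-1) \<le> \<eta> 1 0" using g(2) by (rule order_trans[rotated]) simp
    then show ?thesis using h assms True by (simp add: rel_charge_def)
  next
    case False
    with assms(5) have "n = n - 2 + 2" by simp
    then obtain j where j: "n = j + 2" ..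
    have "regen \<eta> (j + 2)" using assms(4) by (auto simp: regen_def j)
    from regen_coupled[OF assms(1-3) this]
    have c: "coupled n (atoms_after a \<eta> n) (atoms_after b \<eta> n)" by (simp add: j)
    from assms(4) obtain k where k: "k < max 1 (n - 1)" "ereal (1/2) \<le> \<eta> n k"
      unfolding regen_def by auto
    have k': "k < n - 1" using k(1) j by auto
    from c obtain c' where c': "\<And>k. k < n \<Longrightarrow> atoms_after b \<eta> n k = atoms_after a \<eta> n k + ereal c'"
      by (auto simp: coupled_def)
    let ?a = "atoms_after a \<eta> n" and ?b = "atoms_after b \<eta> n"
    have t: "top_charge ?b (\<eta> n) = top_charge ?a (\<eta> n) + ereal c'" "?a (n - 1) + 1 \<le> top_charge ?a (\<eta> n)"
      using coupled_top_charge[where a = ?a and b = ?b and n = n and v = "\<eta> n" and k = k and c = c'] c assms(3) k' k(2) c' by auto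
    have b0: "?b 0 = ?a 0 + ereal c'" using c'[of 0] j by simp
    have p: "proper ?a" "?a (n - 1) \<noteq> -\<infinity>" "?a 0 \<le> ?a (n - 1) + ereal n" using c by (auto simp: coupled_def)
    have le: "?a (n - 1) \<le> ?a 0" using p(1) by (auto simp: proper_def decseq_def)
    have "top_charge ?a (\<eta> n) \<le> ?a 0 + 1" by (rule top_charge_le[OF p(1) assms(3)])
    with t b0 p le show ?thesis unfolding rel_charge_def
      by (cases "?a 0"; cases "top_charge ?a (\<eta> n)"; cases "?a (n - 1)") (auto simp: proper_def one_ereal_def)
  qed
  then show "rel_charge a \<eta> n = rel_charge b \<eta> n" "ereal (- real n) \<le> rel_charge a \<eta> n" by auto
qed

section \<open>Point measures as sequences of atoms\<close>

lemma atom_0: "atom \<nu> 0 = \<infinity>"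
  by (simp add: atom_def top_ereal_def)

lemma atom_eq_bot:
  assumes "sets \<nu> = sets borel" "num_atoms \<nu> < of_nat k"
  shows "atom \<nu> k = -\<infinity>"
proof -
  have "emeasure \<nu> {x..} \<le> num_atoms \<nu>" for x
    unfolding num_atoms_def by (rule emeasure_mono) (auto simp: assms)
  then have "{x. of_nat k \<le> emeasure \<nu> {x..}} = {}"
    using assms(2) by (auto dest: order_trans simp: not_le[symmetric])
  then show ?thesis by (simp add: atom_def bot_ereal_def)
qed

lemma decseq_atom: "decseq (atom \<nu>)"
  unfolding atom_def decseq_def
proof (intro allI impI Sup_subset_mono Collect_mono)
  fix m n x assume "m \<le> n" "of_nat n \<le> emeasure \<nu> {x..}"
  moreover have "(of_nat m :: ennreal) \<le> of_nat n" using \<open>m \<le> n\<close> by simp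
  ultimately show "of_nat m \<le> emeasure \<nu> {x..}" using order_trans by blast
qed

lemma Sup_lower_set_Int_atMost:
  fixes D :: "ereal set"
  assumes "\<And>x y. x \<in> D \<Longrightarrow> y \<le> x \<Longrightarrow> y \<in> D"
  shows "Sup (D \<inter> {..m}) = min m (Sup D)"
proof (cases "m \<in> D")
  case True
  then have "Sup (D \<inter> {..m}) = m" by (intro Sup_eqI) auto
  with True show ?thesis by (simp add: min_def Sup_upper)
next
  case False
  then have lt: "x < m" if "x \<in> D" for x using assms that by (meson leI)
  then have "D \<inter> {..m} = D" by force
  moreover have "Sup D \<le> m" by (rule Sup_least) (rule less_imp_le[OF lt])
  ultimately show ?thesis by (simp add: min_def)
qed

lemma sets_Psi: "sets (Psi w \<nu>) = sets \<nu>"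
  by (simp add: Psi_def sets_add_measure)

text \<open>The set whose supremum is the new atom \<open>Suc k\<close> consists of the points where
  the old mass already reaches \<open>Suc k\<close> and of those up to the added atom where it
  reaches \<open>k\<close>; taking suprema yields the insertion formula. The value \<infinity> that
  \<open>insert_desc\<close> puts before the first entry is \<open>atom \<nu> 0\<close>.\<close>

lemma atom_Psi:
  assumes "sets \<nu> = sets borel"
  shows "atom (Psi w \<nu>) (Suc k) = insert_desc (\<lambda>k. atom \<nu> (Suc k)) (max_charge \<nu> w) k"
proof -
  let ?m = "max_charge \<nu> w" and ?D = "\<lambda>k. {x. of_nat k \<le> emeasure \<nu> {x..}}"
  have e: "emeasure (Psi w \<nu>) {x..} = emeasure \<nu> {x..} + (if x \<le> ?m then 1 else 0)" for x
    unfolding Psi_def by (subst emeasure_add_measure) (auto simp: assms indicator_def)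
  have "{x. of_nat (Suc k) \<le> emeasure (Psi w \<nu>) {x..}} = ?D (Suc k) \<union> (?D k \<inter> {..?m})"
  proof (intro set_eqI)
    fix x
    have "of_nat (Suc k) \<le> emeasure \<nu> {x..} + 1 \<longleftrightarrow> of_nat k \<le> emeasure \<nu> {x..}"
      by (simp add: add.commute)
    moreover have "of_nat k \<le> emeasure \<nu> {x..}" if "of_nat (Suc k) \<le> emeasure \<nu> {x..}"
      using that by (rule order_trans[rotated]) simp
    ultimately show "x \<in> {x. of_nat (Suc k) \<le> emeasure (Psi w \<nu>) {x..}} \<longleftrightarrow> x \<in> ?D (Suc k) \<union> (?D k \<inter> {..?m})"
      unfolding e by (cases "x \<le> ?m") auto
  qed
  then have "atom (Psi w \<nu>) (Suc k) = max (atom \<nu> (Suc k)) (Sup (?D k \<inter> {..?m}))"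
    by (simp add: atom_def Sup_union_distrib sup_ereal_def)
  also have "Sup (?D k \<inter> {..?m}) = min ?m (atom \<nu> k)"
    unfolding atom_def
  proof (rule Sup_lower_set_Int_atMost)
    fix x y assume "x \<in> ?D k" "y \<le> x"
    moreover have "emeasure \<nu> {x..} \<le> emeasure \<nu> {y..}"
      using \<open>y \<le> x\<close> by (intro emeasure_mono) (auto simp: assms)
    ultimately show "y \<in> ?D k" by auto
  qed
  finally show ?thesis by (cases k) (simp_all add: insert_desc_0 insert_desc_Suc atom_0)
qed

lemma max_charge_eq_top_charge:
  assumes "sets \<nu> = sets borel" "\<And>k. 1 \<le> k \<Longrightarrow> w k \<le> 1"
  shows "max_charge \<nu> w = top_charge (\<lambda>k. atom \<nu> (Suc k)) (\<lambda>k. w (Suc k))"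
  unfolding max_charge_def top_charge_def
proof (rule antisym)
  show "(SUP k\<in>{k. 1 \<le> k \<and> of_nat k \<le> num_atoms \<nu>}. atom \<nu> k + w k) \<le> (SUP k. atom \<nu> (Suc k) + w (Suc k))"
  proof (rule SUP_mono)
    fix k assume "k \<in> {k. 1 \<le> k \<and> of_nat k \<le> num_atoms \<nu>}"
    then show "\<exists>j\<in>UNIV. atom \<nu> k + w k \<le> atom \<nu> (Suc j) + w (Suc j)"
      by (intro bexI[of _ "k - 1"]) auto
  qed
  show "(SUP k. atom \<nu> (Suc k) + w (Suc k)) \<le> (SUP k\<in>{k. 1 \<le> k \<and> of_nat k \<le> num_atoms \<nu>}. atom \<nu> k + w k)"
  proof (rule SUP_least)
    fix k
    show "atom \<nu> (Suc k) + w (Suc k) \<le> (SUP k\<in>{k. 1 \<le> k \<and> of_nat k \<le> num_atoms \<nu>}. atom \<nu> k + w k)"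
    proof (cases "of_nat (Suc k) \<le> num_atoms \<nu>")
      case True then show ?thesis by (intro SUP_upper) auto
    next
      case False
      then have "atom \<nu> (Suc k) = -\<infinity>" by (intro atom_eq_bot assms(1)) (simp add: not_le)
      moreover have "w (Suc k) \<noteq> \<infinity>" using assms(2)[of "Suc k"] by auto
      ultimately have bot: "atom \<nu> (Suc k) + w (Suc k) = -\<infinity>" by simp
      show ?thesis unfolding bot by simp
    qed
  qed
qed

text \<open>Masses are integers or infinite, so positive mass at the largest atom means mass at
  least 1, and \<open>atom \<nu> 1\<close> is that atom.\<close>

lemma proper_atom:
  assumes "\<nu> \<in> point_measures" "\<nu> \<noteq> null_measure borel"
  shows "proper (\<lambda>k. atom \<nu> (Suc k))"
proof -
  from assms obtain x :: real where x: "emeasure \<nu> {ereal x} > 0" "emeasure \<nu> {ereal x<..} = 0"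
    by (auto simp: point_measures_def)
  have s: "sets \<nu> = sets borel" using assms by (auto simp: point_measures_def)
  have "1 \<le> emeasure \<nu> {ereal x..}"
  proof -
    have "emeasure \<nu> {ereal x} \<le> emeasure \<nu> {ereal x..}" by (intro emeasure_mono) (auto simp: s)
    with x have pos: "emeasure \<nu> {ereal x..} > 0" by simp
    have "{ereal x..} \<in> sets borel" by simp
    then have "emeasure \<nu> {ereal x..} = \<infinity> \<or> (\<exists>n::nat. emeasure \<nu> {ereal x..} = of_nat n)"
      using assms(1) unfolding point_measures_def by blast
    then show ?thesis
    proof
      assume "\<exists>n::nat. emeasure \<nu> {ereal x..} = of_nat n"
      then obtain n :: nat where n: "emeasure \<nu> {ereal x..} = of_nat n" ..
      with pos have "1 \<le> n" by (cases n) auto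
      then have "of_nat 1 \<le> (of_nat n :: ennreal)" unfolding of_nat_le_iff .
      then show ?thesis by (simp add: n)
    qed simp
  qed
  moreover have "y \<le> ereal x" if "1 \<le> emeasure \<nu> {y..}" for y
  proof (rule ccontr)
    assume "\<not> y \<le> ereal x"
    then have "emeasure \<nu> {y..} \<le> emeasure \<nu> {ereal x<..}" by (intro emeasure_mono) (auto simp: s)
    with that x show False by simp
  qed
  ultimately have "atom \<nu> (Suc 0) = ereal x"
    unfolding atom_def by (intro Sup_eqI) auto
  moreover have "decseq (\<lambda>k. atom \<nu> (Suc k))" using decseq_atom[of \<nu>] by (auto simp: decseq_def)
  ultimately show ?thesis by (simp add: proper_def)
qed

lemma atom_recenter:
  assumes s: "sets \<nu> = sets borel" and a: "atom \<nu> 1 = ereal c"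
  shows "atom (recenter \<nu>) k = atom \<nu> k - ereal c"
proof -
  have [measurable]: "(\<lambda>x. x - ereal c) \<in> borel_measurable \<nu>"
    unfolding measurable_cong_sets[OF s refl] by measurable
  have e: "emeasure (recenter \<nu>) {x..} = emeasure \<nu> {x + ereal c..}" for x
  proof -
    have "emeasure (recenter \<nu>) {x..} = emeasure \<nu> ((\<lambda>x. x - ereal c) -` {x..} \<inter> space \<nu>)"
      unfolding recenter_def a by (rule emeasure_distr) auto
    also have "(\<lambda>x. x - ereal c) -` {x..} \<inter> space \<nu> = {x + ereal c..}"
      using sets_eq_imp_space_eq[OF s] by (auto simp: ereal_le_minus_iff ereal_le_minus)
    finally show ?thesis .
  qed
  have "{x. of_nat k \<le> emeasure (recenter \<nu>) {x..}} = (\<lambda>x. x + ereal (- c)) ` {x. of_nat k \<le> emeasure \<nu> {x..}}" (is "?L = ?R")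
  proof (intro equalityI subsetI)
    fix x assume "x \<in> ?L"
    then show "x \<in> ?R" unfolding e by (intro image_eqI[of _ _ "x + ereal c"]) (auto, cases x, auto)
  next
    fix x assume "x \<in> ?R"
    then obtain y where "x = y + ereal (- c)" "of_nat k \<le> emeasure \<nu> {y..}" by auto
    moreover have "y + ereal (- c) + ereal c = y" by (cases y) auto
    ultimately show "x \<in> ?L" by (simp add: e)
  qed
  then have "atom (recenter \<nu>) k = (SUP x\<in>{x. of_nat k \<le> emeasure \<nu> {x..}}. x + ereal (- c))"
    by (simp add: atom_def)
  also have "\<dots> = atom \<nu> k + ereal (- c)"
  proof (cases "{x. of_nat k \<le> emeasure \<nu> {x..}} = {}")
    case False then show ?thesis by (subst SUP_ereal_add_left) (auto simp: atom_def)
  next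
    case True then show ?thesis unfolding atom_def True by (simp add: bot_ereal_def)
  qed
  finally show ?thesis by (simp add: minus_ereal_def)
qed

lemma max_charge_recenter:
  assumes "sets \<nu> = sets borel" "\<And>k. 1 \<le> k \<Longrightarrow> w k \<le> 1" "\<bar>atom \<nu> 1\<bar> \<noteq> \<infinity>"
  shows "max_charge (recenter \<nu>) w = top_charge (\<lambda>k. atom \<nu> (Suc k)) (\<lambda>k. w (Suc k)) - atom \<nu> 1"
proof -
  obtain c where c: "atom \<nu> 1 = ereal c" using assms(3) by auto
  have "max_charge (recenter \<nu>) w = top_charge (\<lambda>k. atom (recenter \<nu>) (Suc k)) (\<lambda>k. w (Suc k))"
    by (rule max_charge_eq_top_charge) (use assms in \<open>auto simp: recenter_def\<close>)
  also have "\<dots> = (SUP k. (atom \<nu> (Suc k) + w (Suc k)) + ereal (- c))"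
    unfolding top_charge_def atom_recenter[OF assms(1) c]
    by (simp add: minus_ereal_def ac_simps)
  also have "\<dots> = (SUP k. atom \<nu> (Suc k) + w (Suc k)) + ereal (- c)"
    by (rule SUP_ereal_add_left) auto
  finally show ?thesis unfolding top_charge_def c by (simp add: minus_ereal_def)
qed

text \<open>The bridge from the measure-valued dynamics of the theorem to the sequence recursion on
  which all estimates are made.\<close>

lemma max_charge_recenter_iterate:
  assumes "\<nu> 0 = \<nu>0" "\<nu>0 \<in> point_measures" "\<nu>0 \<noteq> null_measure borel"
    and "\<And>t. \<nu> (Suc t) = Psi (w t) (\<nu> t)" "\<And>t k. w t (Suc k) = \<eta> t k" "\<And>t k. \<eta> t k \<le> 1"
  shows "max_charge (recenter (\<nu> t)) (w t) = rel_charge (\<lambda>k. atom \<nu>0 (Suc k)) \<eta> t"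
proof -
  have w1: "w t k \<le> 1" if "1 \<le> k" for t k using assms(5)[of t "k - 1"] assms(6)[of t "k - 1"] that by simp
  have s: "sets (\<nu> t) = sets borel" for t
    by (induction t) (use assms in \<open>auto simp: point_measures_def sets_Psi\<close>)
  have a: "(\<lambda>k. atom (\<nu> t) (Suc k)) = atoms_after (\<lambda>k. atom \<nu>0 (Suc k)) \<eta> t" for t
  proof (induction t)
    case 0 show ?case by (simp add: assms)
  next
    case (Suc t)
    have "(\<lambda>k. atom (\<nu> (Suc t)) (Suc k)) = insert_desc (\<lambda>k. atom (\<nu> t) (Suc k)) (max_charge (\<nu> t) (w t))"
      unfolding assms(4) by (rule ext) (rule atom_Psi[OF s])
    also have "max_charge (\<nu> t) (w t) = top_charge (\<lambda>k. atom (\<nu> t) (Suc k)) (\<eta> t)"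
      using max_charge_eq_top_charge[OF s w1] by (simp add: assms(5))
    finally show ?case by (simp add: Suc)
  qed
  have "proper (atoms_after (\<lambda>k. atom \<nu>0 (Suc k)) \<eta> t)"
    by (intro proper_atoms_after proper_atom assms)
  then have "\<bar>atom (\<nu> t) 1\<bar> \<noteq> \<infinity>" using fun_cong[OF a[of t], of 0] by (simp add: proper_def)
  then have "max_charge (recenter (\<nu> t)) (w t) = top_charge (\<lambda>k. atom (\<nu> t) (Suc k)) (\<lambda>k. w t (Suc k)) - atom (\<nu> t) 1"
    by (intro max_charge_recenter s w1)
  then show ?thesis unfolding rel_charge_def a by (simp add: assms(5) flip: a)
qed

section \<open>Frequency of regenerations\<close>

text \<open>The common reference start: the stationary process is built from it, and in percolation
  it is the weight 0 of vertex 0.\<close>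

definition single_atom :: "nat \<Rightarrow> ereal" where
  "single_atom k = (if k = 0 then 0 else -\<infinity>)"

lemma proper_single_atom: "proper single_atom"
  unfolding proper_def by (auto simp: single_atom_def decseq_def)

lemma measurable_atoms_after [measurable (raw)]:
  assumes [measurable]: "\<And>i k. U i k \<in> borel_measurable N"
  shows "(\<lambda>\<omega>. atoms_after a (\<lambda>i k. U i k \<omega>) n k) \<in> borel_measurable N"
proof (induction n arbitrary: k)
  case (Suc n)
  note [measurable] = Suc
  show ?case by (cases k) (simp_all add: insert_desc_0 insert_desc_Suc top_charge_def)
qed simp

lemma measurable_rel_charge [measurable (raw)]:
  assumes [measurable]: "\<And>i k. U i k \<in> borel_measurable N"
  shows "(\<lambda>\<omega>. rel_charge a (\<lambda>i k. U i k \<omega>) n) \<in> borel_measurable N"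
  unfolding rel_charge_def top_charge_def by measurable

lemma polynomial_times_power_bounded:
  fixes x :: real
  assumes "0 \<le> x" "x < 1"
  obtains C where "\<And>k::nat. real (Suc k) ^ 5 * x ^ k \<le> C"
proof -
  \<comment> \<open>With the fifth root of \<open>x\<close> the claim reduces to the boundedness of
    \<open>(k + 1) * y ^ k\<close>.\<close>
  define y where "y = root 5 x"
  have y: "0 \<le> y" "y < 1" "y ^ 5 = x" using assms by (auto simp: y_def)
  have "(\<lambda>n. of_nat n * y ^ n) \<longlonglongrightarrow> 0" by (rule powser_times_n_limit_0) (use y in auto)
  moreover have "(\<lambda>n. y ^ n) \<longlonglongrightarrow> 0" by (rule LIMSEQ_power_zero) (use y in auto)
  ultimately have "(\<lambda>n. of_nat n * y ^ n + y ^ n) \<longlonglongrightarrow> 0 + 0" by (rule tendsto_add)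
  then have "Bseq (\<lambda>n. of_nat n * y ^ n + y ^ n)" by (intro convergent_imp_Bseq convergentI)
  then obtain B where B: "\<And>n. norm (of_nat n * y ^ n + y ^ n) \<le> B" by (auto simp: Bseq_def)
  have "real (Suc k) ^ 5 * x ^ k \<le> B ^ 5" for k
  proof -
    have "of_nat k * y ^ k + y ^ k = real (Suc k) * y ^ k" by (simp add: algebra_simps)
    moreover have "x ^ k = (y ^ k) ^ 5" unfolding y(3)[symmetric] by (simp add: mult.commute flip: power_mult)
    ultimately have "real (Suc k) ^ 5 * x ^ k = (of_nat k * y ^ k + y ^ k) ^ 5"
      by (simp add: power_mult_distrib)
    also have "\<dots> \<le> B ^ 5" using B[of k] y by (intro power_mono) auto
    finally show ?thesis .
  qed
  then show thesis by (rule that)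
qed

lemma geometric_sum_le:
  fixes r :: real
  assumes "0 \<le> r" "r < 1"
  shows "(\<Sum>i<n. r ^ i) \<le> 1 / (1 - r)"
proof -
  have "(\<Sum>i<n. r ^ i) = (1 - r ^ n) / (1 - r)" using assms by (simp add: sum_gp_strict)
  also have "\<dots> \<le> 1 / (1 - r)" using assms by (intro divide_right_mono) auto
  finally show ?thesis .
qed

text \<open>Charges are numbered from 0 and bounded by 1 at every point rather than almost surely,
  so that the deterministic coupling applies to every \<omega>.\<close>

locale charge_field = prob_space M for M :: "'a measure" +
  fixes F :: "ereal measure" and U :: "int \<Rightarrow> nat \<Rightarrow> 'a \<Rightarrow> ereal"
  assumes law: "distr M borel (U t k) = F"
    and indep: "indep_vars (\<lambda>_. borel) (\<lambda>(t, k). U t k) UNIV"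
    and le_1: "U t k \<omega> \<le> 1"
    and half_pos: "measure F {ereal (1/2)..} > 0"
begin

definition r :: real where "r = 1 - measure F {ereal (1/2)..}"

definition low :: "int \<Rightarrow> nat \<Rightarrow> 'a set" where
  "low t j = {\<omega>\<in>space M. \<forall>k<j. U t k \<omega> < ereal (1/2)}"

text \<open>A stretch starting \<open>d\<close> rows before \<open>t\<close> must include row
  \<open>t\<close>, hence \<open>Suc d\<close> rows; \<open>d \<ge> 1\<close> because one step is
  needed to open the gap.\<close>

definition no_regen :: "int \<Rightarrow> nat \<Rightarrow> 'a set" where
  "no_regen t K = {\<omega>\<in>space M. \<not> (\<exists>d\<in>{1..K}. regen (\<lambda>i k. U (t - int d + int i) k \<omega>) (Suc d))}"

lemma U_measurable [measurable]: "U t k \<in> borel_measurable M"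
  using indep by (auto simp: indep_vars_def2)

lemma regen_measurable [measurable]:
  "Measurable.pred M (\<lambda>\<omega>. regen (\<lambda>i k. U (f i) k \<omega>) n)"
  unfolding regen_def by measurable

lemma low_measurable [measurable]: "low t j \<in> sets M"
  unfolding low_def by measurable

lemma no_regen_measurable [measurable]: "no_regen t K \<in> sets M"
  unfolding no_regen_def by measurable

lemma F_props: "prob_space F" "sets F = sets borel" "space F = UNIV"
proof -
  show "prob_space F" unfolding law[of 0 0, symmetric] by (rule prob_space_distr) simp
  show "sets F = sets borel" unfolding law[of 0 0, symmetric] by simp
  then show "space F = UNIV" by (auto dest: sets_eq_imp_space_eq)
qed

lemma r_bounds: "0 \<le> r" "r < 1"
  using half_pos prob_space.prob_le_1[OF F_props(1)] by (auto simp: r_def)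

lemma prob_below_half: "prob {\<omega>\<in>space M. U t k \<omega> < ereal (1/2)} = r"
proof -
  interpret F: prob_space F by (rule F_props)
  have "measure F {..<ereal (1/2)} = prob {\<omega>\<in>space M. U t k \<omega> < ereal (1/2)}"
    unfolding law[of t k, symmetric] by (subst measure_distr) (auto intro!: arg_cong[of _ _ prob])
  moreover have "{..<ereal (1/2)} = space F - {ereal (1/2)..}" by (auto simp: F_props)
  moreover have "measure F (space F - {ereal (1/2)..}) = r"
    unfolding r_def by (subst F.prob_compl) (auto simp: F_props)
  ultimately show ?thesis by simp
qed

lemma prob_low: "prob (low t j) = r ^ j"
proof (cases "j = 0")
  case True then show ?thesis by (simp add: low_def prob_space)
next
  case False
  let ?J = "{t} \<times> {..<j}"
  have "low t j = (\<Inter>p\<in>?J. (case p of (t, k) \<Rightarrow> U t k) -` {..<ereal (1/2)} \<inter> space M)"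
    using False by (auto simp: low_def)
  also have "prob \<dots> = (\<Prod>p\<in>?J. prob ((case p of (t, k) \<Rightarrow> U t k) -` {..<ereal (1/2)} \<inter> space M))"
    by (rule indep_varsD[OF indep]) (use False in auto)
  also have "\<dots> = (\<Prod>p\<in>?J. r)"
  proof (rule prod.cong)
    fix p assume "p \<in> ?J"
    obtain t k where p: "p = (t, k)" by (cases p)
    have "U t k -` {..<ereal (1/2)} \<inter> space M = {\<omega>\<in>space M. U t k \<omega> < ereal (1/2)}" by auto
    then show "prob ((case p of (t, k) \<Rightarrow> U t k) -` {..<ereal (1/2)} \<inter> space M) = r"
      using prob_below_half by (simp add: p)
  qed simp
  finally show ?thesis by (simp add: card_cartesian_product)
qed

lemma indep_rows:
  "indep_events (\<lambda>t. {\<omega>\<in>space M. \<exists>k<j t. ereal (1/2) \<le> U t k \<omega>}) UNIV"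
proof -
  have "indep_vars (\<lambda>t. PiM ({t} \<times> UNIV) (\<lambda>_. borel))
     (\<lambda>t \<omega>. restrict (\<lambda>p. (case p of (t, k) \<Rightarrow> U t k) \<omega>) ({t} \<times> UNIV)) UNIV"
    by (rule indep_vars_restrict[OF indep]) (auto simp: disjoint_family_on_def)
  from indep_eventsI_indep_vars[OF this, where P = "\<lambda>t y. \<exists>k<j t. ereal (1/2) \<le> y (t, k)"]
  show ?thesis by simp
qed

lemma prob_good_stretch:
  "prob {\<omega>\<in>space M. \<forall>i<L. \<exists>k<max 1 (i - 1). ereal (1/2) \<le> U (s + int i) k \<omega>}
    = (\<Prod>i<L. 1 - r ^ max 1 (i - 1))"
proof (cases "L = 0")
  case True then show ?thesis by (simp add: prob_space)
next
  case False
  define j where "j t = max 1 (nat (t - s) - 1)" for t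
  let ?E = "\<lambda>t. {\<omega>\<in>space M. \<exists>k<j t. ereal (1/2) \<le> U t k \<omega>}"
  let ?T = "(\<lambda>i. s + int i) ` {..<L}"
  have "{\<omega>\<in>space M. \<forall>i<L. \<exists>k<max 1 (i - 1). ereal (1/2) \<le> U (s + int i) k \<omega>} = (\<Inter>t\<in>?T. ?E t)"
    using False by (auto simp: j_def)
  also have "prob \<dots> = (\<Prod>t\<in>?T. prob (?E t))"
    by (rule indep_rows[of j, unfolded indep_events_def, THEN conjunct2, rule_format]) (use False in auto)
  also have "\<dots> = (\<Prod>i<L. prob (?E (s + int i)))"
    by (subst prod.reindex) (auto simp: inj_on_def)
  also have "\<dots> = (\<Prod>i<L. 1 - r ^ max 1 (i - 1))"
  proof (rule prod.cong)
    fix i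
    have "?E (s + int i) = space M - low (s + int i) (max 1 (i - 1))"
      by (auto simp: low_def j_def not_less)
    then show "prob (?E (s + int i)) = 1 - r ^ max 1 (i - 1)"
      by (simp add: prob_compl prob_low)
  qed simp
  finally show ?thesis .
qed

text \<open>The defects \<open>r ^ (i - 1)\<close> are summable, so the infinite product stays
  positive: the first factors are at least \<open>1 - r\<close> each, and the tail is handled by the
  Weierstrass inequality.\<close>

lemma good_stretch_lower_bound:
  obtains a where "0 < a" "a \<le> 1" "\<And>L. a \<le> (\<Prod>i<L. 1 - r ^ max 1 (i - 1))"
proof -
  have "(\<lambda>m. r ^ m / (1 - r)) \<longlonglongrightarrow> 0 / (1 - r)"
    by (intro tendsto_divide LIMSEQ_power_zero tendsto_const) (use r_bounds in auto)
  then have "\<forall>\<^sub>F m in sequentially. r ^ m / (1 - r) < 1/2"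
    by (rule order_tendstoD) simp
  \<comment> \<open>This \<open>m\<close> makes the defects beyond the first \<open>Suc m\<close>
    factors sum to at most 1/2; that is the factor 1/2 in \<open>a\<close>.\<close>
  then obtain m where m: "r ^ m / (1 - r) < 1/2" by (auto simp: eventually_sequentially)
  define a where "a = (1 - r) ^ Suc m * (1/2)"
  have pw: "r ^ n \<le> r" if "1 \<le> n" for n
    using power_decreasing[of 1 n r] that r_bounds by simp
  have fac: "1 - r \<le> 1 - r ^ max 1 (i - 1)" "1 - r ^ max 1 (i - 1) \<le> 1" "0 \<le> r ^ max 1 (i - 1)" for i
    using pw[of "max 1 (i - 1)"] r_bounds by auto
  have a: "a \<le> (\<Prod>i<L. 1 - r ^ max 1 (i - 1))" for L
  proof -
    \<comment> \<open>Short products are extended to at least \<open>Suc m\<close> factors, which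
      can only make them smaller.\<close>
    have "(\<Prod>i<L. 1 - r ^ max 1 (i - 1)) \<ge> (\<Prod>i<max L (Suc m). 1 - r ^ max 1 (i - 1))"
    proof -
      have "(\<Prod>i<max L (Suc m). 1 - r ^ max 1 (i - 1)) =
          (\<Prod>i<L. 1 - r ^ max 1 (i - 1)) * (\<Prod>i\<in>{..<max L (Suc m)} - {..<L}. 1 - r ^ max 1 (i - 1))"
        by (subst mult.commute, rule prod.subset_diff) auto
      also have "\<dots> \<le> (\<Prod>i<L. 1 - r ^ max 1 (i - 1)) * 1"
        using fac r_bounds by (intro mult_left_mono prod_le_1 prod_nonneg) (simp_all add: power_le_one)
      finally show ?thesis by simp
    qed
    moreover have "(\<Prod>i<max L (Suc m). 1 - r ^ max 1 (i - 1)) =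
        (\<Prod>i<Suc m. 1 - r ^ max 1 (i - 1)) * (\<Prod>i\<in>{Suc m..<max L (Suc m)}. 1 - r ^ max 1 (i - 1))"
      unfolding lessThan_atLeast0 by (rule prod.atLeastLessThan_concat[symmetric]) auto
    moreover have "(\<Prod>i<Suc m. 1 - r ^ max 1 (i - 1)) \<ge> (1 - r) ^ Suc m"
      using prod_mono[of "{..<Suc m}" "\<lambda>_. 1 - r" "\<lambda>i. 1 - r ^ max 1 (i - 1)"] fac r_bounds by simp
    moreover have "(\<Prod>i\<in>{Suc m..<max L (Suc m)}. 1 - r ^ max 1 (i - 1)) \<ge> 1/2"
    proof -
      have "(\<Sum>i\<in>{Suc m..<max L (Suc m)}. r ^ max 1 (i - 1)) \<le> (\<Sum>i\<in>{Suc m..<max L (Suc m)}. r ^ (i - 1))"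
        using r_bounds by (intro sum_mono power_decreasing) auto
      also have "\<dots> = (\<Sum>i\<in>{m..<max L (Suc m) - 1}. r ^ i)"
        by (rule sum.reindex_bij_witness[of _ Suc "\<lambda>i. i - 1"]) auto
      also have "\<dots> = (\<Sum>i<max L (Suc m) - 1 - m. r ^ (m + i))"
        by (rule sum.reindex_bij_witness[of _ "\<lambda>i. m + i" "\<lambda>i. i - m"]) auto
      also have "\<dots> = r ^ m * (\<Sum>i<max L (Suc m) - 1 - m. r ^ i)"
        by (simp add: power_add sum_distrib_left)
      also have "\<dots> \<le> r ^ m * (1 / (1 - r))"
        using r_bounds by (intro mult_left_mono geometric_sum_le) auto
      finally have "(\<Sum>i\<in>{Suc m..<max L (Suc m)}. r ^ max 1 (i - 1)) \<le> r ^ m / (1 - r)" by simp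
      with m have "(\<Sum>i\<in>{Suc m..<max L (Suc m)}. r ^ max 1 (i - 1)) \<le> 1/2" by linarith
      moreover have "1 - (\<Sum>i\<in>{Suc m..<max L (Suc m)}. r ^ max 1 (i - 1))
          \<le> (\<Prod>i\<in>{Suc m..<max L (Suc m)}. 1 - r ^ max 1 (i - 1))"
        by (rule Weierstrass_prod_ineq) (use fac r_bounds in \<open>auto simp: power_le_one\<close>)
      ultimately show ?thesis by simp
    qed
    ultimately have sp: "(\<Prod>i<max L (Suc m). 1 - r ^ max 1 (i - 1)) \<le> (\<Prod>i<L. 1 - r ^ max 1 (i - 1))"
        "(\<Prod>i<max L (Suc m). 1 - r ^ max 1 (i - 1)) =
          (\<Prod>i<Suc m. 1 - r ^ max 1 (i - 1)) * (\<Prod>i\<in>{Suc m..<max L (Suc m)}. 1 - r ^ max 1 (i - 1))"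
        "(1 - r) ^ Suc m \<le> (\<Prod>i<Suc m. 1 - r ^ max 1 (i - 1))"
        "1/2 \<le> (\<Prod>i\<in>{Suc m..<max L (Suc m)}. 1 - r ^ max 1 (i - 1))"
      by blast+
    have p0: "0 \<le> (1 - r) ^ Suc m" using r_bounds by (intro zero_le_power) simp
    have "a \<le> (\<Prod>i<max L (Suc m). 1 - r ^ max 1 (i - 1))"
      unfolding a_def sp(2) by (rule mult_mono[OF sp(3,4)]) (use p0 sp(3) in linarith, simp)
    with sp(1) show ?thesis by simp
  qed
  have "0 < a" using r_bounds by (simp add: a_def)
  moreover have "a \<le> 1" using a[of 0] by simp
  ultimately show thesis using a by (rule that)
qed

text \<open>The blocks of \<open>L\<close> rows going back from row \<open>t - 1\<close> use
  disjoint parts of the field, hence are independent; block \<open>b\<close> ends just before row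
  \<open>t - b * L\<close>.\<close>

lemma prob_no_good_block:
  "prob {\<omega>\<in>space M. \<forall>b<n. \<not> (\<forall>i<L. \<exists>k<max 1 (i - 1). ereal (1/2) \<le> U (t - int (Suc b * L) + int i) k \<omega>)}
    = (1 - (\<Prod>i<L. 1 - r ^ max 1 (i - 1))) ^ n"
proof (cases "n = 0")
  case True then show ?thesis by (simp add: prob_space)
next
  case False
  define g where "g b i = t - int (Suc b * L) + int i" for b i
  define B where "B b = g b ` {..<L} \<times> (UNIV :: nat set)" for b
  have lt: "g b i < g b' i'" if "b' < b" "i < L" for b b' i i' :: nat
  proof -
    have "Suc (Suc b') * L \<le> Suc b * L" using that by (intro mult_le_mono1) auto
    then have "Suc b' * L + i < Suc b * L" using that by simp
    then show ?thesis unfolding g_def by linarith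
  qed
  have disj: "disjoint_family_on B {..<n}"
    unfolding disjoint_family_on_def
  proof (intro ballI impI)
    fix b b' :: nat assume "b \<noteq> b'"
    moreover have "B b \<inter> B b' = {}" if "b' < b" for b b'
    proof -
      have "x \<noteq> y" if "x \<in> B b" "y \<in> B b'" for x y
      proof -
        from that have "fst x \<in> g b ` {..<L}"
          "fst y \<in> g b' ` {..<L}" by (simp_all only: B_def mem_Times_iff)
        then obtain i i' where i: "fst x = g b i" "i < L"
            "fst y = g b' i'" by blast
        have "fst x < fst y" unfolding i using \<open>b' < b\<close> i(2) by (rule lt)
        then show ?thesis by auto
      qed
      then show ?thesis by blast
    qed
    ultimately show "B b \<inter> B b' = {}" by (metis Int_commute linorder_neqE_nat)
  qed
  let ?X = "\<lambda>b \<omega>. restrict (\<lambda>p. (case p of (t, k) \<Rightarrow> U t k) \<omega>) (B b)"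
  have iv: "indep_vars (\<lambda>b. PiM (B b) (\<lambda>_. borel)) ?X {..<n}"
    by (rule indep_vars_restrict[OF indep _ disj]) auto
  define A where "A b = {y\<in>space (PiM (B b) (\<lambda>_. borel)).
      \<not> (\<forall>i<L. \<exists>k<max 1 (i - 1). ereal (1/2) \<le> (y (g b i, k) :: ereal))}" for b
  have mem: "(g b i, k) \<in> B b" if "i < L" for b i k using that by (auto simp: B_def)
  have A: "A b \<in> sets (PiM (B b) (\<lambda>_. borel))" for b
  proof -
    have "{y\<in>space (PiM (B b) (\<lambda>_. borel)).
      \<not> (\<exists>k<max 1 (i - 1). ereal (1/2) \<le> (y (g b i, k) :: ereal))} \<in> sets (PiM (B b) (\<lambda>_. borel))"
      if "i \<in> {..<L}" for i
    proof -
      have [measurable]: "(\<lambda>y. y (g b i, k)) \<in> borel_measurable (PiM (B b) (\<lambda>_. borel :: ereal measure))" for k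
        by (rule measurable_component_singleton) (use mem that in auto)
      show ?thesis by measurable
    qed
    then have "(\<Union>i\<in>{..<L}. {y\<in>space (PiM (B b) (\<lambda>_. borel)).
      \<not> (\<exists>k<max 1 (i - 1). ereal (1/2) \<le> (y (g b i, k) :: ereal))}) \<in> sets (PiM (B b) (\<lambda>_. borel))"
      by (rule sets.finite_UN[OF finite_lessThan])
    moreover have "A b = (\<Union>i\<in>{..<L}. {y\<in>space (PiM (B b) (\<lambda>_. borel)).
      \<not> (\<exists>k<max 1 (i - 1). ereal (1/2) \<le> (y (g b i, k) :: ereal))})" unfolding A_def by blast
    ultimately show ?thesis by (simp only:)
  qed
  have X: "?X b -` A b \<inter> space M =
      space M - {\<omega>\<in>space M. \<forall>i<L. \<exists>k<max 1 (i - 1). ereal (1/2) \<le> U (g b i) k \<omega>}" for b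
    using mem by (auto simp: A_def space_PiM)
  have "{\<omega>\<in>space M. \<forall>b<n. \<not> (\<forall>i<L. \<exists>k<max 1 (i - 1). ereal (1/2) \<le> U (g b i) k \<omega>)}
     = (\<Inter>b\<in>{..<n}. ?X b -` A b \<inter> space M)"
    unfolding X using False by blast
  also have "prob \<dots> = (\<Prod>b\<in>{..<n}. prob (?X b -` A b \<inter> space M))"
    by (rule indep_varsD_finite[OF iv]) (use False A in auto)
  also have "\<dots> = (\<Prod>b\<in>{..<n}. 1 - (\<Prod>i<L. 1 - r ^ max 1 (i - 1)))"
    unfolding X by (intro prod.cong refl) (subst prob_compl, measurable, simp only: g_def prob_good_stretch)
  finally show ?thesis by (simp only: g_def prod_constant card_lessThan)
qed

text \<open>If block \<open>b\<close> passes the test on its own \<open>L\<close> rows but does not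
  extend to a stretch up to \<open>t\<close>, then some row \<open>i \<ge> L\<close> after its start
  is low on its first \<open>i - 1\<close> charges, which has probability
  \<open>r ^ (i - 1)\<close>. The geometric tail from \<open>L\<close> on is counted once per
  block.\<close>

lemma prob_no_regen_blocks:
  "prob (no_regen t (n * L)) \<le> (1 - (\<Prod>i<L. 1 - r ^ max 1 (i - 1))) ^ n + n * (r ^ (L - 1) / (1 - r))"
  if "1 \<le> L"
proof -
  let ?N = "{\<omega>\<in>space M. \<forall>b<n. \<not> (\<forall>i<L. \<exists>k<max 1 (i - 1). ereal (1/2) \<le> U (t - int (Suc b * L) + int i) k \<omega>)}"
  let ?R = "\<lambda>b. \<Union>i\<in>{L..Suc b * L}. low (t - int (Suc b * L) + int i) (i - 1)"
  have "no_regen t (n * L) \<subseteq> ?N \<union> (\<Union>b<n. ?R b)"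
  proof
    fix \<omega> assume w: "\<omega> \<in> no_regen t (n * L)"
    show "\<omega> \<in> ?N \<union> (\<Union>b<n. ?R b)"
    proof (rule ccontr)
      assume c: "\<omega> \<notin> ?N \<union> (\<Union>b<n. ?R b)"
      have sp: "\<omega> \<in> space M" using w by (simp add: no_regen_def)
      from c sp obtain b where b: "b < n"
        "\<forall>i<L. \<exists>k<max 1 (i - 1). ereal (1/2) \<le> U (t - int (Suc b * L) + int i) k \<omega>" by auto
      have "regen (\<lambda>i k. U (t - int (Suc b * L) + int i) k \<omega>) (Suc (Suc b * L))"
        unfolding regen_def
      proof (intro allI impI)
        fix i assume i: "i < Suc (Suc b * L)"
        show "\<exists>k<max 1 (i - 1). ereal (1/2) \<le> U (t - int (Suc b * L) + int i) k \<omega>"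
        proof (cases "i < L")
          case False
          with i have "i \<in> {L..Suc b * L}" by auto
          with c b(1) have "\<omega> \<notin> low (t - int (Suc b * L) + int i) (i - 1)" by blast
          with sp obtain k where "k < i - 1" "ereal (1/2) \<le> U (t - int (Suc b * L) + int i) k \<omega>"
            by (auto simp: low_def not_less)
          then show ?thesis by (intro exI[of _ k]) auto
        qed (use b in blast)
      qed
      moreover have "Suc b * L \<le> n * L" using b(1) by (intro mult_le_mono1) auto
      moreover have "1 * 1 \<le> Suc b * L" using that by (intro mult_le_mono) auto
      ultimately show False using w unfolding no_regen_def mem_Collect_eq by (metis atLeastAtMost_iff mult_1)
    qed
  qed
  then have "prob (no_regen t (n * L)) \<le> prob (?N \<union> (\<Union>b<n. ?R b))"
    by (intro finite_measure_mono) auto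
  also have "\<dots> \<le> prob ?N + prob (\<Union>b<n. ?R b)"
    by (intro measure_Un_le) auto
  also have "prob (\<Union>b<n. ?R b) \<le> (\<Sum>b<n. prob (?R b))"
    by (intro finite_measure_subadditive_finite) auto
  also have "\<dots> \<le> (\<Sum>b<n. r ^ (L - 1) / (1 - r))"
  proof (rule sum_mono)
    fix b
    have "prob (?R b) \<le> (\<Sum>i\<in>{L..Suc b * L}. prob (low (t - int (Suc b * L) + int i) (i - 1)))"
      by (intro finite_measure_subadditive_finite) auto
    also have "\<dots> = (\<Sum>i\<in>{L..Suc b * L}. r ^ (i - 1))" by (simp add: prob_low)
    also have "\<dots> = (\<Sum>i<Suc (Suc b * L) - L. r ^ (L - 1) * r ^ i)"
      by (rule sum.reindex_bij_witness[of _ "\<lambda>i. L + i" "\<lambda>i. i - L"])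
         (use that in \<open>auto simp flip: power_add\<close>)
    also have "\<dots> = r ^ (L - 1) * (\<Sum>i<Suc (Suc b * L) - L. r ^ i)" by (rule sum_distrib_left[symmetric])
    also have "\<dots> \<le> r ^ (L - 1) * (1 / (1 - r))"
      using r_bounds by (intro mult_left_mono geometric_sum_le) auto
    finally show "prob (?R b) \<le> r ^ (L - 1) / (1 - r)" by simp
  qed
  finally show ?thesis using prob_no_good_block[of n L t] by simp
qed

lemma no_regen_antimono: "K \<le> K' \<Longrightarrow> no_regen t K' \<subseteq> no_regen t K"
  unfolding no_regen_def by force

text \<open>With \<open>n = L = k\<close>, the integer square root of \<open>K\<close>, the block
  bound is exponentially small in \<open>k\<close>, while (K+1)^2 is at most (k+1)^4. The factor
  \<open>k\<close> that counts the blocks raises the power to be absorbed to the fifth.\<close>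

lemma prob_no_regen:
  obtains C where "0 \<le> C" "\<And>t K. prob (no_regen t K) \<le> C / (real K + 1)\<^sup>2"
proof -
  obtain a where a: "0 < a" "a \<le> 1" "\<And>L. a \<le> (\<Prod>i<L. 1 - r ^ max 1 (i - 1))"
    by (rule good_stretch_lower_bound) blast
  obtain A where A: "\<And>k::nat. real (Suc k) ^ 5 * (1 - a) ^ k \<le> A"
    by (rule polynomial_times_power_bounded[of "1 - a"]) (use a in auto)
  obtain B where B: "\<And>k::nat. real (Suc k) ^ 5 * r ^ k \<le> B"
    by (rule polynomial_times_power_bounded[of r]) (use r_bounds in auto)
  have B0: "0 \<le> B" using B[of 0] by (simp add: order_trans[of 0 1])
  have A0: "0 \<le> A" using A[of 0] by (simp add: order_trans[of 0 1])
  \<comment> \<open>The factor 16 comes from (k+1)^4 \<le> (2k)^4 for \<open>k \<ge> 1\<close>; the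
    summand 16 is ample for \<open>k = 0\<close>, where the probability is simply bounded by
    1.\<close>
  define C where "C = 16 * A + 16 * (B / (1 - r)) + 16"
  have C0: "0 \<le> C" using A0 B0 r_bounds by (simp add: C_def)
  have "prob (no_regen t K) * (real K + 1)\<^sup>2 \<le> C" for t K
  proof -
    define k where "k = floor_sqrt K"
    have k: "k * k \<le> K" "K < Suc k * Suc k"
      using floor_sqrt_power2_le[of K] Suc_floor_sqrt_power2_gt[of K] by (auto simp: k_def power2_eq_square)
    have K: "(real K + 1)\<^sup>2 \<le> real (Suc k) ^ 4"
    proof -
      have "real (K + 1) \<le> real (Suc k * Suc k)" using k(2) by (intro of_nat_mono) simp
      then have "real K + 1 \<le> real (Suc k) * real (Suc k)" by (simp only: of_nat_mult of_nat_add of_nat_1)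
      then have "(real K + 1)\<^sup>2 \<le> (real (Suc k) * real (Suc k))\<^sup>2" by (intro power_mono) auto
      also have "\<dots> = real (Suc k) ^ 4" by (simp only: power2_eq_square power4_eq_xxxx mult.assoc)
      finally show ?thesis .
    qed
    show ?thesis
    proof (cases "k = 0")
      case True
      then have "(real K + 1)\<^sup>2 \<le> 1" using K by simp
      then have "prob (no_regen t K) * (real K + 1)\<^sup>2 \<le> 1 * 1" by (intro mult_mono) auto
      then show ?thesis using A0 B0 r_bounds by (simp add: C_def) (smt (verit) divide_nonneg_pos)
    next
      case False
      then obtain j where j: "k = Suc j" by (cases k) auto
      have "prob (no_regen t K) \<le> prob (no_regen t (k * k))"
        by (intro finite_measure_mono no_regen_antimono k) auto
      also have "\<dots> \<le> (1 - (\<Prod>i<k. 1 - r ^ max 1 (i - 1))) ^ k + k * (r ^ (k - 1) / (1 - r))"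
        by (rule prob_no_regen_blocks) (use False in simp)
      also have "(1 - (\<Prod>i<k. 1 - r ^ max 1 (i - 1))) ^ k \<le> (1 - a) ^ k"
        using a(3)[of k] r_bounds by (intro power_mono) (auto intro!: prod_le_1 simp: power_le_one)
      finally have p: "prob (no_regen t K) \<le> (1 - a) ^ k + k * (r ^ (k - 1) / (1 - r))" by simp
      have "prob (no_regen t K) * (real K + 1)\<^sup>2 \<le> ((1 - a) ^ k + k * (r ^ (k - 1) / (1 - r))) * real (Suc k) ^ 4"
        by (intro mult_mono p K) (use a r_bounds in auto)
      also have "\<dots> = real (Suc k) ^ 4 * (1 - a) ^ k + (real (Suc k) ^ 4 * k * r ^ j) / (1 - r)"
        by (simp add: j field_simps)
      also have "real (Suc k) ^ 4 * (1 - a) ^ k \<le> real (Suc k) ^ 5 * (1 - a) ^ k"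
        using a by (intro mult_right_mono power_increasing) auto
      also have "real (Suc k) ^ 4 * k * r ^ j \<le> 16 * B"
      proof -
        have "real (Suc k) ^ 4 \<le> (2 * real k) ^ 4" using j by (intro power_mono) auto
        then have "real (Suc k) ^ 4 * k * r ^ j \<le> (2 * real k) ^ 4 * k * r ^ j"
          using r_bounds by (intro mult_right_mono) auto
        also have "\<dots> = 16 * (real (Suc j) ^ 5 * r ^ j)" by (simp only: power_mult_distrib j) (simp add: eval_nat_numeral ac_simps)
        also have "\<dots> \<le> 16 * B" using B[of j] by (intro mult_left_mono) auto
        finally show ?thesis .
      qed
      finally have "prob (no_regen t K) * (real K + 1)\<^sup>2 \<le> real (Suc k) ^ 5 * (1 - a) ^ k + 16 * B / (1 - r)"
        using r_bounds by (simp add: divide_right_mono)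
      also have "\<dots> \<le> C" using A[of k] A0 by (simp add: C_def)
      finally show ?thesis .
    qed
  qed
  then have "prob (no_regen t K) \<le> C / (real K + 1)\<^sup>2" for t K
    by (simp add: pos_le_divide_eq)
  with C0 show thesis by (rule that)
qed

end

section \<open>The stationary process\<close>

text \<open>Through joint laws: independence means that the joint law is a product, and an injective
  relabelling of coordinates carries a product measure to a product measure.\<close>

lemma (in prob_space) indep_vars_reindex:
  assumes X: "indep_vars M' X I" and f: "inj_on f J" "f \<in> J \<rightarrow> I" and J: "J \<noteq> {}"
  shows "indep_vars (\<lambda>j. M' (f j)) (\<lambda>j. X (f j)) J"
proof -
  have rv [measurable]: "X i \<in> measurable M (M' i)" if "i \<in> I" for i using X that by (simp add: indep_vars_def2)
  have I: "I \<noteq> {}" using f J by auto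
  let ?N = "\<lambda>i. distr M (M' i) (X i)"
  have "distr M (PiM J (\<lambda>j. M' (f j))) (\<lambda>\<omega>. \<lambda>j\<in>J. X (f j) \<omega>)
      = distr M (PiM J (\<lambda>j. M' (f j))) ((\<lambda>x. \<lambda>j\<in>J. x (f j)) \<circ> (\<lambda>\<omega>. \<lambda>i\<in>I. X i \<omega>))"
    using f by (intro distr_cong refl) (auto simp: restrict_def fun_eq_iff)
  also have "\<dots> = distr (distr M (PiM I M') (\<lambda>\<omega>. \<lambda>i\<in>I. X i \<omega>)) (PiM J (\<lambda>j. M' (f j))) (\<lambda>x. \<lambda>j\<in>J. x (f j))"
    using f by (intro distr_distr[symmetric] measurable_restrict measurable_component_singleton rv) auto
  also have "distr M (PiM I M') (\<lambda>\<omega>. \<lambda>i\<in>I. X i \<omega>) = PiM I ?N"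
    using X rv I by (subst indep_vars_iff_distr_eq_PiM'[symmetric]) auto
  also have "distr (PiM I ?N) (PiM J (\<lambda>j. M' (f j))) (\<lambda>x. \<lambda>j\<in>J. x (f j))
      = distr (PiM I ?N) (PiM J (\<lambda>j. ?N (f j))) (\<lambda>x. \<lambda>j\<in>J. x (f j))"
    by (intro distr_cong refl sets_PiM_cong) simp
  also have "\<dots> = PiM J (\<lambda>j. ?N (f j))"
    by (rule distr_PiM_reindex) (use f rv in \<open>auto intro!: prob_space_distr\<close>)
  finally have eq: "distr M (PiM J (\<lambda>j. M' (f j))) (\<lambda>\<omega>. \<lambda>j\<in>J. X (f j) \<omega>) = PiM J (\<lambda>j. ?N (f j))" .
  have "indep_vars (\<lambda>j. M' (f j)) (\<lambda>j. X (f j)) J \<longleftrightarrow>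
      distr M (PiM J (\<lambda>j. M' (f j))) (\<lambda>\<omega>. \<lambda>j\<in>J. X (f j) \<omega>) = PiM J (\<lambda>j. ?N (f j))"
    by (rule indep_vars_iff_distr_eq_PiM'[OF J]) (rule rv, use f in auto)
  with eq show ?thesis by blast
qed

definition pos_part :: "ereal \<Rightarrow> real" where
  "pos_part x = real_of_ereal (max x 0)"

lemma pos_part_measurable [measurable]: "pos_part \<in> borel_measurable borel"
  unfolding pos_part_def by measurable

lemma pos_part_bounds:
  assumes "x \<le> 1" shows "0 \<le> pos_part x" "pos_part x \<le> 1"
  using assms by (cases x; auto simp: pos_part_def max_def)+

context charge_field
begin

text \<open>Serves time shifts of the field, single rows and the edges of the graph alike, each
  being an injective selection of charges.\<close>

lemma distr_field:
  assumes "inj_on f J" and J: "J \<noteq> {}"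
  shows "distr M (PiM J (\<lambda>_. borel)) (\<lambda>\<omega>. \<lambda>j\<in>J. case f j of (t, k) \<Rightarrow> U t k \<omega>) = PiM J (\<lambda>_. F)"
proof -
  have "indep_vars (\<lambda>_. borel) (\<lambda>j. (case f j of (t, k) \<Rightarrow> U t k)) J"
    using indep_vars_reindex[OF indep assms(1) _ J] by simp
  then have "distr M (PiM J (\<lambda>_. borel)) (\<lambda>\<omega>. \<lambda>j\<in>J. (case f j of (t, k) \<Rightarrow> U t k) \<omega>)
      = PiM J (\<lambda>j. distr M borel (case f j of (t, k) \<Rightarrow> U t k))"
    by (subst (asm) indep_vars_iff_distr_eq_PiM'[OF J]) (auto split: prod.split)
  also have "\<dots> = PiM J (\<lambda>_. F)" by (intro PiM_cong refl) (auto simp: law split: prod.split)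
  also have "(\<lambda>\<omega>. \<lambda>j\<in>J. (case f j of (t, k) \<Rightarrow> U t k) \<omega>) = (\<lambda>\<omega>. \<lambda>j\<in>J. case f j of (t, k) \<Rightarrow> U t k \<omega>)"
    by (auto simp: restrict_def fun_eq_iff split: prod.split)
  finally show ?thesis .
qed

text \<open>The system starts from one atom just before row \<open>t - d\<close>, makes
  \<open>d\<close> steps, and its charge is read with row \<open>t\<close>.\<close>

definition past_charge :: "int \<Rightarrow> nat \<Rightarrow> 'a \<Rightarrow> ereal" where
  "past_charge t d \<omega> = rel_charge single_atom (\<lambda>i k. U (t - int d + int i) k \<omega>) d"

text \<open>Almost surely the sequence is eventually constant. The \<open>liminf\<close> gives it a
  value everywhere, so that measurability, the bound 1 and the compatibility with time shifts
  involve no exceptional set.\<close>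

definition mbar :: "int \<Rightarrow> 'a \<Rightarrow> ereal" where
  "mbar t \<omega> = liminf (\<lambda>d. past_charge t d \<omega>)"

definition c :: real where
  "c = expectation (\<lambda>\<omega>. pos_part (mbar 0 \<omega>))"

lemma past_charge_measurable [measurable]: "past_charge t d \<in> borel_measurable M"
  unfolding past_charge_def by measurable

lemma mbar_measurable [measurable]: "mbar t \<in> borel_measurable M"
  unfolding mbar_def by measurable

lemma past_charge_le: "past_charge t d \<omega> \<le> 1"
  unfolding past_charge_def by (intro rel_charge_le proper_single_atom le_1)

lemma mbar_le: "mbar t \<omega> \<le> 1"
proof -
  have "liminf (\<lambda>d. past_charge t d \<omega>) \<le> liminf (\<lambda>d. 1 :: ereal)"
    by (intro Liminf_mono always_eventually allI past_charge_le)
  then show ?thesis by (simp add: mbar_def Liminf_const)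
qed

text \<open>The stretch of \<open>d\<close> rows found in the window forgets the first
  \<open>N - d\<close> steps, whatever the start. The one-atom start at distance \<open>K\<close> is
  one such start, so it may stand for all of them.\<close>

lemma regen_coupling:
  assumes "\<omega> \<in> space M - no_regen t K" "proper a" "K \<le> N"
  shows "rel_charge a (\<lambda>i k. U (t - int N + int i) k \<omega>) N = past_charge t K \<omega>"
    and "ereal (- real K) \<le> past_charge t K \<omega>"
proof -
  from assms(1) obtain d where d: "1 \<le> d" "d \<le> K"
    "regen (\<lambda>i k. U (t - int d + int i) k \<omega>) (Suc d)" by (auto simp: no_regen_def)
  have *: "rel_charge b (\<lambda>i k. U (t - int N + int i) k \<omega>) N = past_charge t d \<omega>"
    if "proper b" "d \<le> N" for b N
  proof -
    have "rel_charge b (\<lambda>i k. U (t - int N + int i) k \<omega>) N =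
      rel_charge b (\<lambda>i k. U (t - int N + int i) k \<omega>) ((N - d) + d)" using that by simp
    also have "\<dots> = rel_charge (atoms_after b (\<lambda>i k. U (t - int N + int i) k \<omega>) (N - d))
        (\<lambda>i k. U (t - int N + int (N - d + i)) k \<omega>) d"
      by (rule rel_charge_add)
    also have "(\<lambda>i k. U (t - int N + int (N - d + i)) k \<omega>) = (\<lambda>i k. U (t - int d + int i) k \<omega>)"
      using that by (simp add: of_nat_diff algebra_simps)
    also have "rel_charge (atoms_after b (\<lambda>i k. U (t - int N + int i) k \<omega>) (N - d)) (\<lambda>i k. U (t - int d + int i) k \<omega>) d
        = past_charge t d \<omega>"
      unfolding past_charge_def
      by (intro rel_charge_coupling(1) proper_atoms_after that proper_single_atom le_1 d)
    finally show ?thesis .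
  qed
  from *[OF proper_single_atom, of K] d have K: "past_charge t K \<omega> = past_charge t d \<omega>"
    by (simp add: past_charge_def[of t K])
  with *[OF assms(2), of N] d assms(3) show "rel_charge a (\<lambda>i k. U (t - int N + int i) k \<omega>) N = past_charge t K \<omega>"
    by simp
  have "ereal (- real K) \<le> ereal (- real d)" using d by simp
  also have "\<dots> \<le> past_charge t d \<omega>" unfolding past_charge_def
    by (rule rel_charge_coupling(2)[OF proper_single_atom proper_single_atom]) (use d le_1 in auto)
  finally show "ereal (- real K) \<le> past_charge t K \<omega>" by (simp add: K)
qed

lemma mbar_eq:
  assumes "\<omega> \<in> space M - no_regen t K"
  shows "mbar t \<omega> = past_charge t K \<omega>"
proof -
  have "\<forall>\<^sub>F d in sequentially. past_charge t d \<omega> = past_charge t K \<omega>"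
    unfolding eventually_sequentially
  proof (intro exI[of _ K] allI impI)
    fix d assume "K \<le> d"
    from regen_coupling(1)[OF assms proper_single_atom this]
    show "past_charge t d \<omega> = past_charge t K \<omega>" by (simp only: past_charge_def[of t d])
  qed
  then have "liminf (\<lambda>d. past_charge t d \<omega>) = liminf (\<lambda>d. past_charge t K \<omega>)"
    by (rule Liminf_eq)
  then show ?thesis by (simp add: mbar_def Liminf_const)
qed

lemma summable_over_square: "summable (\<lambda>n. C / (real n + 1)\<^sup>2)"
proof -
  have "summable (\<lambda>n. inverse (real (Suc n) ^ 2))"
    by (subst summable_Suc_iff) (rule inverse_power_summable, simp)
  then have "summable (\<lambda>n. C * inverse (real (Suc n) ^ 2))" by (rule summable_mult)
  then show ?thesis by (simp add: divide_inverse add.commute)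
qed

text \<open>All rows since the start serve as the window: at time \<open>n + 1\<close> it has length
  \<open>n\<close>, and the failure probabilities are summable in \<open>n\<close>.\<close>

lemma AE_eventually_mbar:
  assumes "proper a"
  shows "AE \<omega> in M. \<forall>\<^sub>F n in sequentially. rel_charge a (\<lambda>i k. U (1 + int i) k \<omega>) n = mbar (int (Suc n)) \<omega>"
proof -
  obtain C where C: "0 \<le> C" "\<And>t K. prob (no_regen t K) \<le> C / (real K + 1)\<^sup>2" by (rule prob_no_regen) blast
  have "AE \<omega> in M. \<forall>\<^sub>F n in sequentially. \<omega> \<in> space M - no_regen (int (Suc n)) n"
  proof (rule borel_cantelli_AE1)
    show "summable (\<lambda>n. prob (no_regen (int (Suc n)) n))"
      by (rule summable_comparison_test'[OF summable_over_square[of C]]) (use C(2) in simp)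
  qed (auto simp: less_top[symmetric])
  then show ?thesis
  proof eventually_elim
    fix \<omega> assume "\<forall>\<^sub>F n in sequentially. \<omega> \<in> space M - no_regen (int (Suc n)) n"
    then show "\<forall>\<^sub>F n in sequentially. rel_charge a (\<lambda>i k. U (1 + int i) k \<omega>) n = mbar (int (Suc n)) \<omega>"
    proof eventually_elim
      fix n assume n: "\<omega> \<in> space M - no_regen (int (Suc n)) n"
      from regen_coupling(1)[OF n assms, of n] mbar_eq[OF n]
      show "rel_charge a (\<lambda>i k. U (1 + int i) k \<omega>) n = mbar (int (Suc n)) \<omega>" by simp
    qed
  qed
qed

text \<open>The shifted process is a fixed functional \<open>\<Phi>\<close> of the shifted field,
  and shifting does not change the law of the field.\<close>

lemma distr_mbar_shift:
  "distr M (PiM UNIV (\<lambda>_. borel)) (\<lambda>\<omega> t. mbar (t + s) \<omega>) = distr M (PiM UNIV (\<lambda>_. borel)) (\<lambda>\<omega> t. mbar t \<omega>)"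
proof -
  let ?P = "PiM UNIV (\<lambda>_. borel) :: (int \<times> nat \<Rightarrow> ereal) measure"
  define \<Phi> where "\<Phi> y t = liminf (\<lambda>d. rel_charge single_atom (\<lambda>i k. y (t - int d + int i, k)) d)" for y :: "int \<times> nat \<Rightarrow> ereal" and t
  have [measurable]: "\<Phi> \<in> measurable ?P (PiM UNIV (\<lambda>_. borel))"
    unfolding \<Phi>_def
    by (rule measurable_PiM_single') (auto intro!: measurable_component_singleton)
  have "distr M (PiM UNIV (\<lambda>_. borel)) (\<lambda>\<omega> t. mbar (t + s) \<omega>)
      = distr (PiM UNIV (\<lambda>_. F)) (PiM UNIV (\<lambda>_. borel)) \<Phi>" for s
  proof -
    have "(\<lambda>\<omega> t. mbar (t + s) \<omega>) = \<Phi> \<circ> (\<lambda>\<omega>. \<lambda>j\<in>UNIV. case (case j of (t, k) \<Rightarrow> (t + s, k)) of (t, k) \<Rightarrow> U t k \<omega>)"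
      by (auto simp: fun_eq_iff mbar_def past_charge_def \<Phi>_def algebra_simps)
    then have "distr M (PiM UNIV (\<lambda>_. borel)) (\<lambda>\<omega> t. mbar (t + s) \<omega>) =
      distr (distr M ?P (\<lambda>\<omega>. \<lambda>j\<in>UNIV. case (case j of (t, k) \<Rightarrow> (t + s, k)) of (t, k) \<Rightarrow> U t k \<omega>)) (PiM UNIV (\<lambda>_. borel)) \<Phi>"
      by (subst distr_distr) (auto split: prod.split intro!: measurable_restrict)
    also have "distr M ?P (\<lambda>\<omega>. \<lambda>j\<in>UNIV. case (case j of (t, k) \<Rightarrow> (t + s, k)) of (t, k) \<Rightarrow> U t k \<omega>) = PiM UNIV (\<lambda>_. F)"
      by (rule distr_field) (auto simp: inj_on_def)
    finally show ?thesis .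
  qed
  from this[of s] this[of 0] show ?thesis by simp
qed

lemma stationary_mbar: "stationary_process M mbar"
  unfolding stationary_process_def using distr_mbar_shift by auto

lemma expectation_mbar: "expectation (\<lambda>\<omega>. pos_part (mbar t \<omega>)) = c"
proof -
  have *: "expectation (\<lambda>\<omega>. pos_part (mbar s \<omega>)) =
      (\<integral>x. pos_part (x 0) \<partial>distr M (PiM UNIV (\<lambda>_. borel)) (\<lambda>\<omega> t. mbar (t + s) \<omega>))" for s
    by (subst integral_distr) (auto intro!: measurable_PiM_single')
  show ?thesis unfolding c_def *[of t] *[of 0] distr_mbar_shift[of t] by simp
qed

lemma integrable_pos_part [simp]:
  assumes [measurable]: "X \<in> borel_measurable M" and "\<And>\<omega>. X \<omega> \<le> 1"
  shows "integrable M (\<lambda>\<omega>. pos_part (X \<omega>))"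
  by (rule integrable_const_bound[where B = 1]) (use pos_part_bounds assms(2) in auto)

lemma c_bounds: "0 \<le> c" "c \<le> 1"
proof -
  show "0 \<le> c" unfolding c_def using pos_part_bounds mbar_le by (intro Bochner_Integration.integral_nonneg) auto
  have "c \<le> expectation (\<lambda>_. 1)" unfolding c_def using pos_part_bounds mbar_le
    by (intro integral_mono integrable_pos_part) auto
  then show "c \<le> 1" by (simp add: prob_space)
qed

section \<open>Decay of correlations\<close>

lemma expectation_diff_le_prob:
  fixes X Y :: "'a \<Rightarrow> real"
  assumes [measurable]: "X \<in> borel_measurable M" "Y \<in> borel_measurable M" "B \<in> sets M"
    and "\<And>\<omega>. \<omega> \<in> space M \<Longrightarrow> \<bar>X \<omega>\<bar> \<le> 1" "\<And>\<omega>. \<omega> \<in> space M \<Longrightarrow> \<bar>Y \<omega>\<bar> \<le> 1"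
    and diff: "\<And>\<omega>. \<omega> \<in> space M - B \<Longrightarrow> X \<omega> = Y \<omega>" "\<And>\<omega>. \<omega> \<in> B \<Longrightarrow> \<bar>X \<omega> - Y \<omega>\<bar> \<le> 1"
  shows "\<bar>expectation X - expectation Y\<bar> \<le> prob B"
proof -
  have i: "integrable M X" "integrable M Y"
    using assms by (auto intro!: integrable_const_bound[where B = 1] AE_I2)
  have "expectation X - expectation Y = expectation (\<lambda>\<omega>. X \<omega> - Y \<omega>)" using i by simp
  also have "\<bar>\<dots>\<bar> \<le> expectation (\<lambda>\<omega>. \<bar>X \<omega> - Y \<omega>\<bar>)" by (rule integral_abs_bound)
  also have "\<dots> \<le> expectation (indicator B)"
    by (rule integral_mono) (use i diff in \<open>auto simp: indicator_def less_top[symmetric]\<close>)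
  finally show ?thesis by simp
qed

lemma expectation_past_charge:
  "\<bar>expectation (\<lambda>\<omega>. pos_part (past_charge t K \<omega>)) - c\<bar> \<le> prob (no_regen t K)"
  unfolding expectation_mbar[of t, symmetric]
proof (rule expectation_diff_le_prob)
  have b: "0 \<le> pos_part (past_charge t K \<omega>)" "pos_part (past_charge t K \<omega>) \<le> 1"
       "0 \<le> pos_part (mbar t \<omega>)" "pos_part (mbar t \<omega>) \<le> 1" for \<omega>
    using pos_part_bounds past_charge_le mbar_le by auto
  show "\<bar>pos_part (past_charge t K \<omega>)\<bar> \<le> 1" "\<bar>pos_part (mbar t \<omega>)\<bar> \<le> 1"
    "\<bar>pos_part (past_charge t K \<omega>) - pos_part (mbar t \<omega>)\<bar> \<le> 1" for \<omega>
    using b[of \<omega>] by auto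
qed (auto simp: mbar_eq)

lemma indep_past_charge:
  assumes "s < t - int K"
  shows "indep_var borel (past_charge s d) borel (past_charge t K)"
proof -
  let ?A = "{s - int d..s} \<times> (UNIV :: nat set)" and ?B = "{t - int K..t} \<times> (UNIV :: nat set)"
  have iv: "indep_var (PiM ?A (\<lambda>_. borel)) (\<lambda>\<omega>. restrict (\<lambda>p. (case p of (t, k) \<Rightarrow> U t k) \<omega>) ?A)
      (PiM ?B (\<lambda>_. borel)) (\<lambda>\<omega>. restrict (\<lambda>p. (case p of (t, k) \<Rightarrow> U t k) \<omega>) ?B)"
    by (rule indep_var_restrict[OF indep]) (use assms in auto)
  \<comment> \<open>\<open>rel_charge\<close> is formally a function of all rows; replacing
    \<open>i\<close> by \<open>min i d\<close> confines it to the rows from \<open>t - d\<close> to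
    \<open>t\<close> without changing its value.\<close>
  let ?f = "\<lambda>t d y. rel_charge single_atom (\<lambda>i k. y (t - int (d :: nat) + int (min i d), k)) d"
  have m: "?f t d \<in> borel_measurable (PiM ({t - int d..t} \<times> UNIV) (\<lambda>_. borel))" for t d
    by (intro measurable_rel_charge measurable_component_singleton) auto
  have e: "?f t d \<circ> (\<lambda>\<omega>. restrict (\<lambda>p. (case p of (t, k) \<Rightarrow> U t k) \<omega>) ({t - int d..t} \<times> UNIV)) = past_charge t d" for t d
  proof (rule ext)
    fix \<omega>
    have "atoms_after single_atom (\<lambda>i k. U (t - int d + int (min i d)) k \<omega>) d =
       atoms_after single_atom (\<lambda>i k. U (t - int d + int i) k \<omega>) d"
      by (rule atoms_after_cong) simp
    then show "(?f t d \<circ> (\<lambda>\<omega>. restrict (\<lambda>p. (case p of (t, k) \<Rightarrow> U t k) \<omega>) ({t - int d..t} \<times> UNIV))) \<omega> = past_charge t d \<omega>"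
      unfolding past_charge_def rel_charge_def by simp
  qed
  from indep_var_compose[OF iv m m] show ?thesis unfolding e .
qed

text \<open>Restarting the later system only \<open>K\<close> steps back makes its charge
  independent of the earlier one, at the price \<open>prob (no_regen t K)\<close>. The mean of the
  restarted charge misses \<open>c\<close> by at most the same amount, whence the factor 2.\<close>

lemma covariance_past_charge:
  assumes "s < t - int K" "K \<le> d"
  shows "\<bar>expectation (\<lambda>\<omega>. (pos_part (past_charge s e \<omega>) - c) * (pos_part (past_charge t d \<omega>) - c))\<bar>
    \<le> 2 * prob (no_regen t K)"
proof -
  let ?X = "\<lambda>\<omega>. pos_part (past_charge s e \<omega>) - c" and ?Y = "\<lambda>d \<omega>. pos_part (past_charge t d \<omega>) - c"
  have b: "\<bar>pos_part (past_charge t d \<omega>) - c\<bar> \<le> 1" for t d \<omega>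
    using pos_part_bounds[OF past_charge_le[of t d \<omega>]] c_bounds by auto
  have b2: "\<bar>?X \<omega> * ?Y d \<omega>\<bar> \<le> 1" for d \<omega>
    unfolding abs_mult using mult_mono[OF b b] by auto
  have i: "integrable M ?X" "integrable M (?Y K)"
    by (intro Bochner_Integration.integrable_diff integrable_pos_part; simp add: past_charge_le)+
  have "\<bar>expectation (\<lambda>\<omega>. ?X \<omega> * ?Y d \<omega>) - expectation (\<lambda>\<omega>. ?X \<omega> * ?Y K \<omega>)\<bar> \<le> prob (no_regen t K)"
  proof (rule expectation_diff_le_prob)
    show "\<bar>?X \<omega> * ?Y d \<omega>\<bar> \<le> 1" "\<bar>?X \<omega> * ?Y K \<omega>\<bar> \<le> 1" for \<omega> by (rule b2)+
    show "?X \<omega> * ?Y d \<omega> = ?X \<omega> * ?Y K \<omega>" if "\<omega> \<in> space M - no_regen t K" for \<omega>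
      using regen_coupling(1)[OF that proper_single_atom assms(2)] by (simp add: past_charge_def[of t d])
    show "\<bar>?X \<omega> * ?Y d \<omega> - ?X \<omega> * ?Y K \<omega>\<bar> \<le> 1" for \<omega>
    proof -
      have "\<bar>?Y d \<omega> - ?Y K \<omega>\<bar> \<le> 1"
        using pos_part_bounds[OF past_charge_le[of t d \<omega>]] pos_part_bounds[OF past_charge_le[of t K \<omega>]] by auto
      from mult_mono[OF b[of s e \<omega>] this] show ?thesis
        by (simp add: abs_mult[symmetric] right_diff_distrib[symmetric])
    qed
  qed auto
  moreover have "expectation (\<lambda>\<omega>. ?X \<omega> * ?Y K \<omega>) = expectation ?X * expectation (?Y K)"
  proof (rule indep_var_lebesgue_integral[OF _ i])
    show "indep_var borel ?X borel (?Y K)"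
      using indep_var_compose[OF indep_past_charge[OF assms(1), of e], of "\<lambda>x. pos_part x - c" borel "\<lambda>x. pos_part x - c" borel]
      by (simp add: comp_def)
  qed
  moreover have "\<bar>expectation ?X * expectation (?Y K)\<bar> \<le> 1 * prob (no_regen t K)"
    unfolding abs_mult
  proof (rule mult_mono)
    have "\<bar>expectation ?X\<bar> \<le> expectation (\<lambda>\<omega>. \<bar>?X \<omega>\<bar>)" by (rule integral_abs_bound)
    also have "\<dots> \<le> expectation (\<lambda>_. 1)" using b i by (intro integral_mono) auto
    finally show "\<bar>expectation ?X\<bar> \<le> 1" by (simp add: prob_space)
    have "expectation (?Y K) = expectation (\<lambda>\<omega>. pos_part (past_charge t K \<omega>)) - c"
      by (subst Bochner_Integration.integral_diff) (auto simp: past_charge_le prob_space)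
    then show "\<bar>expectation (?Y K)\<bar> \<le> prob (no_regen t K)" using expectation_past_charge by simp
  qed auto
  ultimately show ?thesis by simp
qed

section \<open>Variance of the front\<close>

definition front :: "nat \<Rightarrow> 'a \<Rightarrow> real" where
  "front n \<omega> = real_of_ereal (atoms_after single_atom (\<lambda>i k. U (1 + int i) k \<omega>) n 0)"

lemma front_eq_sum: "front n \<omega> = (\<Sum>m<n. pos_part (past_charge (1 + int m) m \<omega>))"
proof -
  have "atoms_after single_atom (\<lambda>i k. U (1 + int i) k \<omega>) n 0 =
     ereal (\<Sum>m<n. pos_part (past_charge (1 + int m) m \<omega>))"
  proof (induction n)
    case 0 show ?case by (simp add: single_atom_def)
  next
    case (Suc n)
    have "rel_charge single_atom (\<lambda>i k. U (1 + int i) k \<omega>) n = past_charge (1 + int n) n \<omega>"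
      by (simp add: past_charge_def)
    moreover have "max 0 x = ereal (pos_part x)" if "x \<le> 1" for x
      using that by (cases x) (auto simp: pos_part_def max_def)
    ultimately show ?case
      by (subst front_Suc) (simp_all add: proper_single_atom le_1 past_charge_le Suc)
  qed
  then show ?thesis by (simp add: front_def)
qed

text \<open>At most \<open>2 * K + 1\<close> indices lie within \<open>K\<close> of a given one, and
  such pairs contribute at most 1; the far bound \<open>2 * D\<close> is then granted to every
  pair.\<close>

lemma second_moment_front:
  assumes D: "\<And>t. prob (no_regen t K) \<le> D"
  shows "expectation (\<lambda>\<omega>. (front n \<omega> - n * c)\<^sup>2) \<le> real n * (2 * real K + 1) + real n * real n * (2 * D)"
proof -
  let ?Y = "\<lambda>m \<omega>. pos_part (past_charge (1 + int m) m \<omega>) - c"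
  have D0: "0 \<le> D" using D[of 0] by (rule order_trans[rotated]) simp
  have b: "\<bar>?Y m \<omega>\<bar> \<le> 1" for m \<omega>
    using pos_part_bounds[OF past_charge_le[of "1 + int m" m \<omega>]] c_bounds by auto
  have b2: "\<bar>?Y m \<omega> * ?Y m' \<omega>\<bar> \<le> 1" for m m' \<omega>
    unfolding abs_mult using mult_mono[OF b b] by auto
  have i: "integrable M (\<lambda>\<omega>. ?Y m \<omega> * ?Y m' \<omega>)" for m m'
    by (rule integrable_const_bound[where B = 1]) (use b2 in auto)
  have one: "\<bar>expectation (\<lambda>\<omega>. ?Y m \<omega> * ?Y m' \<omega>)\<bar> \<le> 1" for m m'
  proof -
    have "\<bar>expectation (\<lambda>\<omega>. ?Y m \<omega> * ?Y m' \<omega>)\<bar> \<le> expectation (\<lambda>\<omega>. \<bar>?Y m \<omega> * ?Y m' \<omega>\<bar>)" by (rule integral_abs_bound)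
    also have "\<dots> \<le> expectation (\<lambda>_. 1)" using b2 i by (intro integral_mono) auto
    finally show ?thesis by (simp add: prob_space)
  qed
  have far: "\<bar>expectation (\<lambda>\<omega>. ?Y m \<omega> * ?Y m' \<omega>)\<bar> \<le> 2 * D" if "m + K < m'" for m m'
    by (rule order_trans[OF covariance_past_charge[where K = K]]) (use that D in auto)
  have cov: "expectation (\<lambda>\<omega>. ?Y m \<omega> * ?Y m' \<omega>) \<le> (if m \<le> m' + K \<and> m' \<le> m + K then 1 else 0) + 2 * D" for m m'
  proof (cases "m \<le> m' + K \<and> m' \<le> m + K")
    case True then show ?thesis using one[of m m'] D0 by auto
  next
    case False
    then consider "m + K < m'" | "m' + K < m" by linarith
    then show ?thesis
    proof cases
      case 1 then show ?thesis using far[of m m'] by auto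
    next
      case 2 then show ?thesis using far[of m' m] by (auto simp: mult.commute)
    qed
  qed
  have "expectation (\<lambda>\<omega>. (front n \<omega> - n * c)\<^sup>2) = expectation (\<lambda>\<omega>. \<Sum>m<n. \<Sum>m'<n. ?Y m \<omega> * ?Y m' \<omega>)"
    by (simp add: front_eq_sum power2_eq_square sum_product[symmetric] sum_subtractf)
  also have "\<dots> = (\<Sum>m<n. \<Sum>m'<n. expectation (\<lambda>\<omega>. ?Y m \<omega> * ?Y m' \<omega>))"
    using i by simp
  also have "\<dots> \<le> (\<Sum>m<n. \<Sum>m'<n. (if m \<le> m' + K \<and> m' \<le> m + K then 1 else 0) + 2 * D)"
    by (intro sum_mono cov)
  also have "\<dots> = (\<Sum>m<n. real (card {m'\<in>{..<n}. m \<le> m' + K \<and> m' \<le> m + K})) + real n * real n * (2 * D)"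
  proof -
    have "(\<Sum>m'<n. if m \<le> m' + K \<and> m' \<le> m + K then 1 else (0::real))
        = real (card {m'\<in>{..<n}. m \<le> m' + K \<and> m' \<le> m + K})" for m
      by (subst sum.inter_filter[symmetric]) simp_all
    then show ?thesis by (simp only: sum.distrib sum_constant card_lessThan mult.assoc)
  qed
  also have "(\<Sum>m<n. real (card {m'\<in>{..<n}. m \<le> m' + K \<and> m' \<le> m + K})) \<le> (\<Sum>m<n. 2 * real K + 1)"
  proof (rule sum_mono)
    fix m
    have "card {m'\<in>{..<n}. m \<le> m' + K \<and> m' \<le> m + K} \<le> card {m - K..m + K}"
      by (intro card_mono) auto
    also have "\<dots> \<le> 2 * K + 1" by simp
    finally show "real (card {m'\<in>{..<n}. m \<le> m' + K \<and> m' \<le> m + K}) \<le> 2 * real K + 1" by linarith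
  qed
  finally show ?thesis by simp
qed

lemma second_moment_front_cube:
  obtains D where "\<And>k. expectation (\<lambda>\<omega>. (front (Suc k ^ 3) \<omega> / real (Suc k ^ 3) - c)\<^sup>2) \<le> D / (real k + 1)\<^sup>2"
proof -
  obtain C where C: "0 \<le> C" "\<And>t K. prob (no_regen t K) \<le> C / (real K + 1)\<^sup>2" by (rule prob_no_regen) blast
  have "expectation (\<lambda>\<omega>. (front (Suc k ^ 3) \<omega> / real (Suc k ^ 3) - c)\<^sup>2) \<le> (2 + 2 * C) / (real k + 1)\<^sup>2" for k
  proof -
    define x where "x = real k + 1"
    have x: "1 \<le> x" "real (Suc k ^ 3) = x ^ 3" "real (Suc k) = x" by (auto simp: x_def add.commute)
    have "expectation (\<lambda>\<omega>. (front (Suc k ^ 3) \<omega> / real (Suc k ^ 3) - c)\<^sup>2) =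
        expectation (\<lambda>\<omega>. (front (Suc k ^ 3) \<omega> - real (Suc k ^ 3) * c)\<^sup>2 / (x ^ 3)\<^sup>2)"
      using x by (intro arg_cong[where f = expectation] ext) (simp add: power2_eq_square field_simps)
    also have "\<dots> = expectation (\<lambda>\<omega>. (front (Suc k ^ 3) \<omega> - real (Suc k ^ 3) * c)\<^sup>2) / (x ^ 3)\<^sup>2" by simp
    \<comment> \<open>Cut-off distance \<open>k\<close> at time x^3 with \<open>x = k + 1\<close>:
      after division, near pairs give at most 2/x^2 and far pairs 2C/x^2.\<close>
    also have "\<dots> \<le> (x ^ 3 * (2 * real k + 1) + x ^ 3 * x ^ 3 * (2 * (C / x\<^sup>2))) / (x ^ 3)\<^sup>2"
      using second_moment_front[of k "C / x\<^sup>2" "Suc k ^ 3"] C(2)[of _ k]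
      by (intro divide_right_mono) (simp_all only: x x_def zero_le_power2)
    also have "\<dots> \<le> (x ^ 3 * (2 * x) + x ^ 3 * x ^ 3 * (2 * (C / x\<^sup>2))) / (x ^ 3)\<^sup>2"
      using x by (intro divide_right_mono add_right_mono mult_left_mono) (auto simp: x_def)
    also have "\<dots> = (2 + 2 * C) / x\<^sup>2" using x by (simp add: field_simps eval_nat_numeral)
    finally show ?thesis by (simp add: x_def)
  qed
  then show thesis by (rule that)
qed

end

section \<open>Last passage percolation\<close>

lemma lpp_paths_0: "lpp_paths 0 = {[0]}"
proof -
  have "p = [0]" if "p \<noteq> []" "sorted_wrt (<) p" "hd p = 0" "last p = 0" for p :: "nat list"
  proof (cases p)
    case (Cons a q)
    show ?thesis
    proof (cases "q = []")
      case False
      have "last q = 0" "\<forall>x\<in>set q. 0 < x" using that Cons False by auto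
      with last_in_set[OF False] show ?thesis by (metis less_irrefl)
    qed (use that Cons in simp)
  qed (use that in simp)
  then show ?thesis by (auto simp: lpp_paths_def)
qed

lemma lpp_paths_Suc: "lpp_paths (Suc n) = (\<Union>i\<le>n. (\<lambda>p. p @ [Suc n]) ` lpp_paths i)"
proof (intro equalityI subsetI)
  fix p assume "p \<in> lpp_paths (Suc n)"
  then have p: "p \<noteq> []" "sorted_wrt (<) p" "hd p = 0" "last p = Suc n" by (auto simp: lpp_paths_def)
  then have e: "p = butlast p @ [Suc n]" by (metis append_butlast_last_id)
  have ne: "butlast p \<noteq> []" using p e by (metis append_Nil list.sel(1) nat.distinct(1))
  have "sorted_wrt (<) (butlast p @ [Suc n])" using p(2) e by simp
  then have s: "sorted_wrt (<) (butlast p)" "last (butlast p) < Suc n"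
    using ne by (auto simp: sorted_wrt_append)
  have "hd (butlast p) = 0" using p(3) e ne by (metis hd_append2)
  with s ne have "butlast p \<in> lpp_paths (last (butlast p))" by (simp add: lpp_paths_def)
  with e s(2) show "p \<in> (\<Union>i\<le>n. (\<lambda>p. p @ [Suc n]) ` lpp_paths i)"
    by (metis UN_I atMost_iff image_eqI less_Suc_eq_le)
next
  fix p assume "p \<in> (\<Union>i\<le>n. (\<lambda>p. p @ [Suc n]) ` lpp_paths i)"
  then obtain i q where q: "i \<le> n" "q \<in> lpp_paths i" "p = q @ [Suc n]" by auto
  have "x < Suc n" if "x \<in> set q" for x
  proof -
    have qq: "q \<noteq> []" "sorted_wrt (<) q" "last q = i" using q by (auto simp: lpp_paths_def)
    have "x \<le> last q" using that qq(1,2)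
      by (metis append_butlast_last_id in_set_conv_decomp less_imp_le order_refl rotate1.simps(2) set_ConsD set_rotate1 sorted_wrt_append list.set_intros(1))
    with qq q(1) show ?thesis by simp
  qed
  with q show "p \<in> lpp_paths (Suc n)" by (auto simp: lpp_paths_def sorted_wrt_append)
qed

lemma finite_lpp_paths: "finite (lpp_paths n)"
proof (induction n rule: less_induct)
  case (less n)
  then show ?case by (cases n) (auto simp: lpp_paths_0 lpp_paths_Suc)
qed

lemma lpp_paths_nonempty: "lpp_paths n \<noteq> {}"
proof (induction n rule: less_induct)
  case (less n)
  then show ?case by (cases n) (auto simp: lpp_paths_0 lpp_paths_Suc)
qed

lemma path_charge_snoc:
  assumes "p \<noteq> []" shows "path_charge e (p @ [x]) = path_charge e p + e (last p, x)"
  using assms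
proof (induction p rule: induct_list012)
  case (3 a b p)
  then show ?case by (simp add: path_charge_def add.assoc)
qed (simp_all add: path_charge_def)

text \<open>A supremum over a nonempty finite set is a maximum, and adding an extended real,
  -\<infinity> included, is monotone.\<close>

lemma SUP_add_right_finite:
  fixes f :: "'b \<Rightarrow> ereal"
  assumes "finite A" "A \<noteq> {}"
  shows "(SUP p\<in>A. f p + b) = (SUP p\<in>A. f p) + b"
proof -
  have "(SUP p\<in>A. f p) + b = Max (f ` A) + b" using assms by (simp add: Max_Sup)
  also have "\<dots> = Max ((\<lambda>x. x + b) ` f ` A)"
    by (rule mono_Max_commute) (use assms in \<open>auto intro!: monoI add_right_mono\<close>)
  also have "\<dots> = (SUP p\<in>A. f p + b)" using assms by (simp add: Max_Sup image_image)
  finally show ?thesis by simp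
qed

lemma lpp_max_0: "lpp_max e 0 = 0"
  by (simp add: lpp_max_def lpp_paths_0 path_charge_def)

text \<open>Vertex \<open>n + 1\<close> gets its weight from the earlier weights and one fresh row
  of charges, as a new atom does, but with charges attached to vertices instead of ranks.\<close>

lemma lpp_max_Suc: "lpp_max e (Suc n) = (SUP i\<in>{..n}. lpp_max e i + e (i, Suc n))"
proof -
  have "lpp_max e (Suc n) = (SUP i\<in>{..n}. SUP p\<in>lpp_paths i. path_charge e (p @ [Suc n]))"
    unfolding lpp_max_def lpp_paths_Suc by (simp add: SUP_UNION image_image)
  also have "\<dots> = (SUP i\<in>{..n}. SUP p\<in>lpp_paths i. path_charge e p + e (i, Suc n))"
    by (intro SUP_cong refl) (auto simp: path_charge_snoc lpp_paths_def)
  also have "\<dots> = (SUP i\<in>{..n}. lpp_max e i + e (i, Suc n))"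
    unfolding lpp_max_def by (intro SUP_cong refl SUP_add_right_finite finite_lpp_paths lpp_paths_nonempty)
  finally show ?thesis .
qed

section \<open>Insertion sort and the comparison of vertices with ranks\<close>

primrec sorted_desc :: "(nat \<Rightarrow> ereal) \<Rightarrow> nat \<Rightarrow> nat \<Rightarrow> ereal" where
  "sorted_desc y 0 = (\<lambda>_. -\<infinity>)"
| "sorted_desc y (Suc n) = insert_desc (sorted_desc y n) (y n)"

lemma decseq_sorted_desc: "decseq (sorted_desc y n)"
proof (induction n)
  case (Suc n)
  then show ?case unfolding sorted_desc.simps by (rule decseq_insert_desc)
qed (simp add: decseq_def)

lemma sorted_desc_eq_bot: "n \<le> k \<Longrightarrow> sorted_desc y n k = -\<infinity>"
proof (induction n arbitrary: k)
  case (Suc n)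
  then obtain j where "k = Suc j" "n \<le> j" by (cases k) auto
  with Suc.IH[of j] Suc.IH[of "Suc j"] show ?case by (simp add: insert_desc_Suc)
qed simp

lemma sorted_desc_cong: "(\<And>i. i < n \<Longrightarrow> y i = z i) \<Longrightarrow> sorted_desc y n = sorted_desc z n"
  by (induction n) auto

text \<open>The entry -\<infinity> at index \<open>n\<close> is the free slot that receives the
  element displaced from the end.\<close>

lemma mset_insert_desc:
  assumes "decseq a" "a n = -\<infinity>"
  shows "mset (map (insert_desc a m) [0..<Suc n]) = add_mset m (mset (map a [0..<n]))"
  using assms
proof (induction n arbitrary: a)
  case 0 then show ?case by (simp add: insert_desc_0)
next
  case (Suc n)
  have d: "a (Suc k) \<le> a k" "a k \<le> a 0" for k using Suc.prems(1) by (auto simp: decseq_def)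
  have split: "map f [0..<Suc (Suc n)] = f 0 # map (\<lambda>k. f (Suc k)) [0..<Suc n]"
    "map f [0..<Suc n] = f 0 # map (\<lambda>k. f (Suc k)) [0..<n]" for f :: "nat \<Rightarrow> ereal"
    by (simp_all only: map_upt_Suc)
  show ?case
  proof (cases "a 0 \<le> m")
    case True
    have "insert_desc a m (Suc k) = a k" for k
      using d(1)[of k] order_trans[OF d(2)[of k] True] by (simp add: insert_desc_Suc min_absorb2 max_absorb2)
    moreover have "insert_desc a m 0 = m" using True by (simp add: insert_desc_0)
    ultimately show ?thesis by (subst split(1)) simp
  next
    case False
    have "insert_desc a m (Suc k) = insert_desc (\<lambda>k. a (Suc k)) m k" for k
      using False by (cases k) (simp_all add: insert_desc_0 insert_desc_Suc)
    moreover have "insert_desc a m 0 = a 0" using False by (simp add: insert_desc_0)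
    moreover have "mset (map (insert_desc (\<lambda>k. a (Suc k)) m) [0..<Suc n]) = add_mset m (mset (map (\<lambda>k. a (Suc k)) [0..<n]))"
      by (rule Suc.IH) (use Suc.prems in \<open>auto simp: decseq_def\<close>)
    ultimately show ?thesis by (subst split(1), subst split(2)) simp
  qed
qed

lemma sorted_desc_permutation:
  obtains \<pi> where "\<pi> permutes {..<n}" "\<And>k. k < n \<Longrightarrow> sorted_desc y n k = y (\<pi> k)"
proof -
  have "mset (map (sorted_desc y n) [0..<n]) = mset (map y [0..<n])"
  proof (induction n)
    case (Suc n)
    have "mset (map (sorted_desc y (Suc n)) [0..<Suc n]) = add_mset (y n) (mset (map (sorted_desc y n) [0..<n]))"
      unfolding sorted_desc.simps by (rule mset_insert_desc[OF decseq_sorted_desc sorted_desc_eq_bot]) simp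
    then show ?case using Suc by simp
  qed simp
  from mset_eq_permutation[OF this] obtain \<pi> where \<pi>: "\<pi> permutes {..<n}"
    "permute_list \<pi> (map y [0..<n]) = map (sorted_desc y n) [0..<n]" by auto
  have "sorted_desc y n k = y (\<pi> k)" if "k < n" for k
  proof -
    have "sorted_desc y n k = map (sorted_desc y n) [0..<n] ! k" using that by simp
    also have "\<dots> = map y [0..<n] ! \<pi> k" unfolding \<pi>(2)[symmetric]
      by (rule permute_list_nth) (use \<pi>(1) that in auto)
    also have "\<dots> = y (\<pi> k)" using permutes_in_image[OF \<pi>(1), of k] that by simp
    finally show ?thesis .
  qed
  with \<pi>(1) show thesis by (rule that)
qed

text \<open>Here \<open>y\<close> holds the weights of the vertices 0 to \<open>n\<close>, and
  \<open>v i\<close> is the charge of the edge from \<open>i\<close> to \<open>n + 1\<close>; in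
  \<open>rank_charge\<close> the charge \<open>v k\<close> goes to the vertex of rank
  \<open>k\<close>.\<close>

definition edge_charge :: "nat \<Rightarrow> (nat \<Rightarrow> ereal) \<Rightarrow> (nat \<Rightarrow> ereal) \<Rightarrow> ereal" where
  "edge_charge n y v = (SUP i\<in>{..n}. y i + v i)"

definition rank_charge :: "nat \<Rightarrow> (nat \<Rightarrow> ereal) \<Rightarrow> (nat \<Rightarrow> ereal) \<Rightarrow> ereal" where
  "rank_charge n y v = edge_charge n (sorted_desc y (Suc n)) v"

lemma measurable_sorted_desc [measurable (raw)]:
  assumes [measurable]: "\<And>i. (\<lambda>\<omega>. y \<omega> i) \<in> borel_measurable N"
  shows "(\<lambda>\<omega>. sorted_desc (y \<omega>) n k) \<in> borel_measurable N"
proof (induction n arbitrary: k)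
  case (Suc n)
  note [measurable] = Suc
  show ?case by (cases k) (simp_all add: insert_desc_0 insert_desc_Suc)
qed simp

lemma measurable_edge_charge:
  assumes [measurable]: "\<And>i. (\<lambda>\<omega>. y \<omega> i) \<in> borel_measurable N"
    and v: "\<And>i. i \<le> n \<Longrightarrow> (\<lambda>\<omega>. v \<omega> i) \<in> borel_measurable N"
  shows "(\<lambda>\<omega>. edge_charge n (y \<omega>) (v \<omega>)) \<in> borel_measurable N"
  unfolding edge_charge_def
proof (rule borel_measurable_SUP)
  fix i assume "i \<in> {..n}"
  then have [measurable]: "(\<lambda>\<omega>. v \<omega> i) \<in> borel_measurable N" using v by simp
  show "(\<lambda>\<omega>. y \<omega> i + v \<omega> i) \<in> borel_measurable N" by measurable
qed simp

lemma measurable_rank_charge: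
  assumes [measurable]: "\<And>i. (\<lambda>\<omega>. y \<omega> i) \<in> borel_measurable N"
    and v: "\<And>i. i \<le> n \<Longrightarrow> (\<lambda>\<omega>. v \<omega> i) \<in> borel_measurable N"
  shows "(\<lambda>\<omega>. rank_charge n (y \<omega>) (v \<omega>)) \<in> borel_measurable N"
  unfolding rank_charge_def by (rule measurable_edge_charge[OF _ v]) measurable

text \<open>Attaching the i.i.d. charges to ranks instead of vertices permutes them, which does not
  change the law of the new weight.\<close>

lemma distr_rank_charge:
  assumes F: "prob_space F" "sets F = sets borel"
  shows "distr (PiM {..n} (\<lambda>_. F)) borel (rank_charge n y) = distr (PiM {..n} (\<lambda>_. F)) borel (edge_charge n y)"
proof -
  let ?G = "PiM {..n} (\<lambda>_. F)"
  obtain \<pi> where \<pi>: "\<pi> permutes {..<Suc n}" "\<And>k. k < Suc n \<Longrightarrow> sorted_desc y (Suc n) k = y (\<pi> k)"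
    by (rule sorted_desc_permutation[where n = "Suc n" and y = y]) blast
  have \<pi>': "inv \<pi> permutes {..n}" using permutes_inv[OF \<pi>(1)] by (simp add: lessThan_Suc_atMost)
  have r: "rank_charge n y = edge_charge n y \<circ> (\<lambda>v. \<lambda>i\<in>{..n}. v (inv \<pi> i))"
  proof
    fix v
    have "rank_charge n y v = (SUP k\<in>{..n}. y (\<pi> k) + v k)"
      unfolding rank_charge_def edge_charge_def by (rule SUP_cong) (auto simp: \<pi>(2) less_Suc_eq_le simp del: sorted_desc.simps)
    also have "{..n} = inv \<pi> ` {..n}" using permutes_image[OF \<pi>'] by simp
    also have "(SUP k\<in>inv \<pi> ` {..n}. y (\<pi> k) + v k) = (SUP i\<in>{..n}. y i + v (inv \<pi> i))"
      by (simp add: image_image permutes_inverses(1)[OF \<pi>(1)])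
    also have "\<dots> = edge_charge n y (\<lambda>i\<in>{..n}. v (inv \<pi> i))"
      unfolding edge_charge_def by (rule SUP_cong) auto
    finally show "rank_charge n y v = (edge_charge n y \<circ> (\<lambda>v. \<lambda>i\<in>{..n}. v (inv \<pi> i))) v" by simp
  qed
  have comp: "(\<lambda>v. v i) \<in> borel_measurable ?G" if "i \<le> n" for i
    using measurable_component_singleton[of i "{..n}" "\<lambda>_. F"] that F(2) by (simp cong: measurable_cong_sets)
  have "distr ?G borel (rank_charge n y) = distr (distr ?G ?G (\<lambda>v. \<lambda>i\<in>{..n}. v (inv \<pi> i))) borel (edge_charge n y)"
    unfolding r
  proof (rule distr_distr[symmetric])
    show "edge_charge n y \<in> borel_measurable ?G" by (rule measurable_edge_charge) (auto intro: comp)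
    show "(\<lambda>v. \<lambda>i\<in>{..n}. v (inv \<pi> i)) \<in> measurable ?G ?G"
      using permutes_in_image[OF \<pi>'] by (intro measurable_restrict measurable_component_singleton) auto
  qed
  also have "distr ?G ?G (\<lambda>v. \<lambda>i\<in>{..n}. v (inv \<pi> i)) = ?G"
    by (rule distr_PiM_reindex[where M = "\<lambda>_. F"])
       (use F permutes_inj_on[OF \<pi>'] permutes_in_image[OF \<pi>'] in auto)
  finally show ?thesis .
qed

text \<open>Entries beyond \<open>n\<close> hold the dummy value 0; both rules used for
  \<open>h\<close> read the entries up to \<open>n\<close> only. Keeping the whole vector matters,
  since the next weight depends on all earlier ones.\<close>

primrec weights :: "(nat \<Rightarrow> (nat \<Rightarrow> ereal) \<Rightarrow> (nat \<Rightarrow> ereal) \<Rightarrow> ereal) \<Rightarrow> (nat \<Rightarrow> nat \<Rightarrow> ereal) \<Rightarrow> nat \<Rightarrow> nat \<Rightarrow> ereal" where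
  "weights h \<eta> 0 = (\<lambda>_. 0)"
| "weights h \<eta> (Suc n) = (weights h \<eta> n)(Suc n := h n (weights h \<eta> n) (\<eta> n))"

lemma weights_edge_charge_eq_lpp_max:
  assumes "\<And>i j. i < j \<Longrightarrow> e (i, j) = \<eta> (j - 1) i" "i \<le> n"
  shows "weights edge_charge \<eta> n i = lpp_max e i"
  using assms(2)
proof (induction n arbitrary: i)
  case 0 then show ?case by (simp add: lpp_max_0)
next
  case (Suc n)
  show ?case
  proof (cases "i = Suc n")
    case True
    have "weights edge_charge \<eta> (Suc n) i = (SUP i\<in>{..n}. weights edge_charge \<eta> n i + \<eta> n i)"
      by (simp add: True edge_charge_def)
    also have "\<dots> = (SUP i\<in>{..n}. lpp_max e i + e (i, Suc n))"
      by (intro SUP_cong refl) (use assms(1) Suc.IH in auto)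
    finally show ?thesis by (simp add: True lpp_max_Suc)
  next
    case False
    then show ?thesis using Suc by simp
  qed
qed

lemma top_charge_eq_edge_charge:
  assumes "\<And>k. v k \<le> 1" "\<And>k. n < k \<Longrightarrow> a k = -\<infinity>"
  shows "top_charge a v = edge_charge n a v"
  unfolding top_charge_def edge_charge_def
proof (rule antisym)
  show "(SUP k. a k + v k) \<le> (SUP i\<in>{..n}. a i + v i)"
  proof (rule SUP_least)
    fix k show "a k + v k \<le> (SUP i\<in>{..n}. a i + v i)"
    proof (cases "k \<le> n")
      case True then show ?thesis by (intro SUP_upper) auto
    next
      case False
      have "v k \<noteq> \<infinity>" using assms(1)[of k] by auto
      then have bot: "a k + v k = -\<infinity>" using assms(2)[of k] False by simp
      show ?thesis unfolding bot by simp
    qed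
  qed
qed (auto intro: SUP_subset_mono)

text \<open>Sorting the weights turns ranks into indices of atoms, and a new weight is inserted into
  the sorted list exactly as a new atom into the configuration.\<close>

lemma weights_rank_charge:
  assumes "\<And>i k. \<eta> i k \<le> 1"
  shows "sorted_desc (weights rank_charge \<eta> n) (Suc n) = atoms_after single_atom \<eta> n"
    and "weights rank_charge \<eta> (Suc n) (Suc n) = top_charge (atoms_after single_atom \<eta> n) (\<eta> n)"
proof -
  have top: "top_charge (atoms_after single_atom \<eta> n) (\<eta> n) = weights rank_charge \<eta> (Suc n) (Suc n)"
    if "sorted_desc (weights rank_charge \<eta> n) (Suc n) = atoms_after single_atom \<eta> n" for n
  proof -
    have "top_charge (atoms_after single_atom \<eta> n) (\<eta> n) = edge_charge n (atoms_after single_atom \<eta> n) (\<eta> n)"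
      unfolding that[symmetric]
      by (rule top_charge_eq_edge_charge[OF assms]) (rule sorted_desc_eq_bot, simp)
    then show ?thesis by (simp add: rank_charge_def that del: sorted_desc.simps)
  qed
  have s: "sorted_desc (weights rank_charge \<eta> n) (Suc n) = atoms_after single_atom \<eta> n" for n
  proof (induction n)
    case 0
    show ?case by (rule ext) (auto simp: insert_desc_def single_atom_def split: nat.split)
  next
    case (Suc n)
    have "sorted_desc (weights rank_charge \<eta> (Suc n)) (Suc (Suc n)) =
       insert_desc (sorted_desc (weights rank_charge \<eta> (Suc n)) (Suc n)) (weights rank_charge \<eta> (Suc n) (Suc n))"
      by (rule sorted_desc.simps)
    also have "sorted_desc (weights rank_charge \<eta> (Suc n)) (Suc n) = sorted_desc (weights rank_charge \<eta> n) (Suc n)"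
      by (rule sorted_desc_cong) simp
    finally show ?case using Suc top[OF Suc] by simp
  qed
  show "sorted_desc (weights rank_charge \<eta> n) (Suc n) = atoms_after single_atom \<eta> n" by (rule s)
  show "weights rank_charge \<eta> (Suc n) (Suc n) = top_charge (atoms_after single_atom \<eta> n) (\<eta> n)"
    by (rule top[OF s, symmetric])
qed

lemma SUP_eq_sorted_desc_0: "(SUP i\<in>{..<n}. y i) = sorted_desc y n 0"
proof (induction n)
  case 0 show ?case by (simp add: bot_ereal_def)
next
  case (Suc n)
  then show ?case by (simp add: lessThan_Suc insert_desc_0 sup_ereal_def max.commute)
qed

text \<open>For each fixed \<open>y\<close> the two new coordinates have the same law, and Fubini
  integrates this over \<open>y\<close>. Equality of the joint laws, not merely of the new
  coordinate, is what lets an induction over the vertices continue.\<close>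

lemma distr_fun_upd_eq:
  fixes h h' :: "(nat \<Rightarrow> ereal) \<Rightarrow> (nat \<Rightarrow> ereal) \<Rightarrow> ereal"
  assumes L: "sets L = sets (PiM UNIV (\<lambda>_. borel))" and G: "sigma_finite_measure G"
    and h [measurable]: "(\<lambda>(y, v). h y v) \<in> borel_measurable (L \<Otimes>\<^sub>M G)"
    and h' [measurable]: "(\<lambda>(y, v). h' y v) \<in> borel_measurable (L \<Otimes>\<^sub>M G)"
    and eq: "\<And>y. distr G borel (h y) = distr G borel (h' y)"
  shows "distr (L \<Otimes>\<^sub>M G) (PiM UNIV (\<lambda>_. borel)) (\<lambda>(y, v). y(j := h y v))
       = distr (L \<Otimes>\<^sub>M G) (PiM UNIV (\<lambda>_. borel)) (\<lambda>(y, v). y(j := h' y v))"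
proof (rule measure_eqI)
  interpret G: sigma_finite_measure G by (rule G)
  let ?P = "PiM UNIV (\<lambda>_. borel) :: (nat \<Rightarrow> ereal) measure"
  have spL: "space L = UNIV" using sets_eq_imp_space_eq[OF L] by (simp add: space_PiM)
  have y [measurable]: "(\<lambda>x. fst x i) \<in> borel_measurable (L \<Otimes>\<^sub>M G)" for i
  proof -
    have "fst \<in> measurable (L \<Otimes>\<^sub>M G) ?P" using measurable_fst[of L G] L by (simp cong: measurable_cong_sets)
    then show ?thesis by (rule measurable_compose) (rule measurable_component_singleton, simp)
  qed
  have upd: "(\<lambda>(y, v). y(j := g y v)) \<in> measurable (L \<Otimes>\<^sub>M G) ?P"
    if [measurable]: "(\<lambda>(y, v). g y v) \<in> borel_measurable (L \<Otimes>\<^sub>M G)" for g :: "(nat \<Rightarrow> ereal) \<Rightarrow> (nat \<Rightarrow> ereal) \<Rightarrow> ereal"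
  proof (rule measurable_PiM_single')
    fix i
    have "(\<lambda>x. (case x of (y, v) \<Rightarrow> y(j := g y v)) i) = (\<lambda>x. if i = j then (case x of (y, v) \<Rightarrow> g y v) else fst x i)"
      by (auto simp: fun_eq_iff split: prod.split)
    then show "(\<lambda>x. (case x of (y, v) \<Rightarrow> y(j := g y v)) i) \<in> borel_measurable (L \<Otimes>\<^sub>M G)" by simp
  qed auto
  fix S assume "S \<in> sets (distr (L \<Otimes>\<^sub>M G) ?P (\<lambda>(y, v). y(j := h y v)))"
  then have S [measurable]: "S \<in> sets ?P" by simp
  have e: "emeasure (distr (L \<Otimes>\<^sub>M G) ?P (\<lambda>(y, v). y(j := g y v))) S
      = (\<integral>\<^sup>+y. emeasure (distr G borel (g y)) {x. y(j := x) \<in> S} \<partial>L)"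
    if g [measurable]: "(\<lambda>(y, v). g y v) \<in> borel_measurable (L \<Otimes>\<^sub>M G)" for g
  proof -
    have "emeasure (distr (L \<Otimes>\<^sub>M G) ?P (\<lambda>(y, v). y(j := g y v))) S
        = emeasure (L \<Otimes>\<^sub>M G) ((\<lambda>(y, v). y(j := g y v)) -` S \<inter> space (L \<Otimes>\<^sub>M G))"
      by (rule emeasure_distr[OF upd[OF g] S])
    also have "\<dots> = (\<integral>\<^sup>+y. emeasure G (Pair y -` ((\<lambda>(y, v). y(j := g y v)) -` S \<inter> space (L \<Otimes>\<^sub>M G))) \<partial>L)"
      by (rule G.emeasure_pair_measure_alt) (rule measurable_sets[OF upd[OF g] S])
    also have "\<dots> = (\<integral>\<^sup>+y. emeasure (distr G borel (g y)) {x. y(j := x) \<in> S} \<partial>L)"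
    proof (rule nn_integral_cong)
      fix y assume yL: "y \<in> space L"
      have gy: "g y \<in> borel_measurable G" using measurable_Pair2[OF g yL] by simp
      have "(\<lambda>x. y(j := x)) \<in> measurable borel ?P"
        by (rule measurable_PiM_single') (auto simp: fun_upd_def)
      from measurable_sets[OF this S] have T: "{x. y(j := x) \<in> S} \<in> sets borel"
        by (simp add: vimage_def)
      have "Pair y -` ((\<lambda>(y, v). y(j := g y v)) -` S \<inter> space (L \<Otimes>\<^sub>M G)) = g y -` {x. y(j := x) \<in> S} \<inter> space G"
        by (auto simp: space_pair_measure spL)
      then show "emeasure G (Pair y -` ((\<lambda>(y, v). y(j := g y v)) -` S \<inter> space (L \<Otimes>\<^sub>M G))) =
          emeasure (distr G borel (g y)) {x. y(j := x) \<in> S}"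
        by (simp add: emeasure_distr[OF gy T])
    qed
    finally show ?thesis .
  qed
  show "emeasure (distr (L \<Otimes>\<^sub>M G) ?P (\<lambda>(y, v). y(j := h y v))) S = emeasure (distr (L \<Otimes>\<^sub>M G) ?P (\<lambda>(y, v). y(j := h' y v))) S"
    unfolding e[OF h] e[OF h'] eq ..
qed simp

lemma measurable_charge:
  assumes "h \<in> {edge_charge, rank_charge}"
    and "\<And>i. (\<lambda>\<omega>. y \<omega> i) \<in> borel_measurable N"
    and "\<And>i. i \<le> n \<Longrightarrow> (\<lambda>\<omega>. v \<omega> i) \<in> borel_measurable N"
  shows "(\<lambda>\<omega>. h n (y \<omega>) (v \<omega>)) \<in> borel_measurable N"
  using assms(1) measurable_edge_charge[of y N n v, OF assms(2,3)] measurable_rank_charge[of y N n v, OF assms(2,3)]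
  by auto

lemma charge_cong:
  assumes "h \<in> {edge_charge, rank_charge}" "\<And>i. i \<le> n \<Longrightarrow> v i = v' i"
  shows "h n y v = h n y v'"
proof -
  have "edge_charge n y v = edge_charge n y v'" for y
    unfolding edge_charge_def using assms(2) by (intro SUP_cong) auto
  with assms(1) show ?thesis by (auto simp: rank_charge_def)
qed

lemma measurable_weights:
  assumes h: "h \<in> {edge_charge, rank_charge}"
    and u: "\<And>i k. i < n \<Longrightarrow> k \<le> i \<Longrightarrow> u i k \<in> borel_measurable N"
  shows "(\<lambda>\<omega>. weights h (\<lambda>i k. u i k \<omega>) n j) \<in> borel_measurable N"
  using u
proof (induction n arbitrary: j)
  case (Suc n)
  have "(\<lambda>\<omega>. h n (weights h (\<lambda>i k. u i k \<omega>) n) (\<lambda>k. u n k \<omega>)) \<in> borel_measurable N"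
    by (rule measurable_charge[OF h]) (use Suc in auto)
  then show ?case using Suc by (cases "j = Suc n") auto
qed simp

context charge_field
begin

definition weight :: "(nat \<Rightarrow> (nat \<Rightarrow> ereal) \<Rightarrow> (nat \<Rightarrow> ereal) \<Rightarrow> ereal) \<Rightarrow> nat \<Rightarrow> 'a \<Rightarrow> nat \<Rightarrow> ereal" where
  "weight h n \<omega> = weights h (\<lambda>i k. U (1 + int i) k \<omega>) n"

text \<open>The next row is independent of the weights so far, which involve only rows 1 to
  \<open>n\<close>. So the law of the longer vector is determined by the law of the shorter one and
  by \<open>F\<close>.\<close>

lemma distr_weight_Suc:
  assumes h: "h \<in> {edge_charge, rank_charge}"
  shows "distr M (PiM UNIV (\<lambda>_. borel)) (weight h (Suc n)) =
    distr (distr M (PiM UNIV (\<lambda>_. borel)) (weight h n) \<Otimes>\<^sub>M PiM {..n} (\<lambda>_. F)) (PiM UNIV (\<lambda>_. borel)) (\<lambda>(y, v). y(Suc n := h n y v))"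
proof -
  let ?P = "PiM UNIV (\<lambda>_. borel) :: (nat \<Rightarrow> ereal) measure"
  let ?Q = "PiM {..n} (\<lambda>_. borel) :: (nat \<Rightarrow> ereal) measure"
  let ?V = "\<lambda>\<omega>. \<lambda>k\<in>{..n}. U (1 + int n) k \<omega>"
  have V: "distr M ?Q ?V = PiM {..n} (\<lambda>_. F)"
    using distr_field[of "\<lambda>k. (1 + int n, k)" "{..n}"] by (simp add: inj_on_def)
  have wm: "weight h n \<in> measurable M ?P"
    unfolding weight_def
  proof (rule measurable_PiM_single')
    show "(\<lambda>\<omega>. weights h (\<lambda>i k. U (1 + int i) k \<omega>) n i) \<in> borel_measurable M" for i
      by (rule measurable_weights[OF h]) simp
  qed auto
  have iv: "indep_var ?P (weight h n) ?Q ?V"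
  proof -
    let ?A = "{1..int n} \<times> (UNIV :: nat set)" and ?B = "{1 + int n} \<times> {..n}"
    have "indep_var (PiM ?A (\<lambda>_. borel)) (\<lambda>\<omega>. restrict (\<lambda>p. (case p of (t, k) \<Rightarrow> U t k) \<omega>) ?A)
      (PiM ?B (\<lambda>_. borel)) (\<lambda>\<omega>. restrict (\<lambda>p. (case p of (t, k) \<Rightarrow> U t k) \<omega>) ?B)"
      by (rule indep_var_restrict[OF indep]) auto
    moreover have "(\<lambda>y. weights h (\<lambda>i k. y (1 + int i, k)) n) \<in> measurable (PiM ?A (\<lambda>_. borel)) ?P"
      by (rule measurable_PiM_single') (auto intro!: measurable_weights[OF h] measurable_component_singleton)
    moreover have "(\<lambda>y. \<lambda>k\<in>{..n}. y (1 + int n, k)) \<in> measurable (PiM ?B (\<lambda>_. borel)) ?Q"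
      by (intro measurable_restrict measurable_component_singleton) auto
    ultimately have "indep_var ?P ((\<lambda>y. weights h (\<lambda>i k. y (1 + int i, k)) n) \<circ> (\<lambda>\<omega>. restrict (\<lambda>p. (case p of (t, k) \<Rightarrow> U t k) \<omega>) ?A))
        ?Q ((\<lambda>y. \<lambda>k\<in>{..n}. y (1 + int n, k)) \<circ> (\<lambda>\<omega>. restrict (\<lambda>p. (case p of (t, k) \<Rightarrow> U t k) \<omega>) ?B))"
      by (rule indep_var_compose)
    moreover have "weights h (\<lambda>i k. restrict (\<lambda>p. (case p of (t, k) \<Rightarrow> U t k) \<omega>) ?A (1 + int i, k)) m = weights h (\<lambda>i k. U (1 + int i) k \<omega>) m"
      if "m \<le> n" for m \<omega>
      using that
    proof (induction m)
      case (Suc m) then show ?case by simp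
    qed simp
    ultimately show ?thesis by (simp add: comp_def weight_def[abs_def] restrict_def cong: if_cong)
  qed
  have joint: "distr M ?P (weight h n) \<Otimes>\<^sub>M PiM {..n} (\<lambda>_. F) = distr M (?P \<Otimes>\<^sub>M ?Q) (\<lambda>\<omega>. (weight h n \<omega>, ?V \<omega>))"
    using iv unfolding indep_var_distribution_eq V by simp
  have "weight h (Suc n) = (\<lambda>(y, v). y(Suc n := h n y v)) \<circ> (\<lambda>\<omega>. (weight h n \<omega>, ?V \<omega>))"
  proof
    fix \<omega>
    have "h n y (?V \<omega>) = h n y (\<lambda>k. U (1 + int n) k \<omega>)" for y by (rule charge_cong[OF h]) simp
    then show "weight h (Suc n) \<omega> = ((\<lambda>(y, v). y(Suc n := h n y v)) \<circ> (\<lambda>\<omega>. (weight h n \<omega>, ?V \<omega>))) \<omega>"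
      by (simp add: weight_def)
  qed
  then have "distr M ?P (weight h (Suc n)) = distr M ?P ((\<lambda>(y, v). y(Suc n := h n y v)) \<circ> (\<lambda>\<omega>. (weight h n \<omega>, ?V \<omega>)))" by simp
  also have "\<dots> = distr (distr M (?P \<Otimes>\<^sub>M ?Q) (\<lambda>\<omega>. (weight h n \<omega>, ?V \<omega>))) ?P (\<lambda>(y, v). y(Suc n := h n y v))"
  proof (rule distr_distr[symmetric])
    show "(\<lambda>\<omega>. (weight h n \<omega>, ?V \<omega>)) \<in> measurable M (?P \<Otimes>\<^sub>M ?Q)"
      by (intro measurable_Pair wm measurable_restrict) simp
    show "(\<lambda>(y, v). y(Suc n := h n y v)) \<in> measurable (?P \<Otimes>\<^sub>M ?Q) ?P"
    proof (rule measurable_PiM_single')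
      fix i
      have c1: "(\<lambda>x. fst x i) \<in> borel_measurable (?P \<Otimes>\<^sub>M ?Q)" for i
        by (rule measurable_compose[OF measurable_fst measurable_component_singleton]) simp
      have c2: "(\<lambda>x. snd x i) \<in> borel_measurable (?P \<Otimes>\<^sub>M ?Q)" if "i \<le> n" for i
        by (rule measurable_compose[OF measurable_snd measurable_component_singleton]) (use that in simp)
      have "(\<lambda>x. h n (fst x) (snd x)) \<in> borel_measurable (?P \<Otimes>\<^sub>M ?Q)" by (rule measurable_charge[OF h c1 c2])
      then show "(\<lambda>x. (case x of (y, v) \<Rightarrow> y(Suc n := h n y v)) i) \<in> borel_measurable (?P \<Otimes>\<^sub>M ?Q)"
        using c1 by (cases "i = Suc n") (simp_all add: case_prod_beta)
    qed auto
  qed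
  finally show ?thesis by (simp add: joint)
qed

lemma distr_weight:
  "distr M (PiM UNIV (\<lambda>_. borel)) (weight rank_charge n) = distr M (PiM UNIV (\<lambda>_. borel)) (weight edge_charge n)"
proof (induction n)
  case 0 show ?case by (simp add: weight_def)
next
  case (Suc n)
  let ?L = "distr M (PiM UNIV (\<lambda>_. borel)) (weight edge_charge n)" and ?G = "PiM {..n} (\<lambda>_. F)"
  have c1: "(\<lambda>x. fst x i) \<in> borel_measurable (?L \<Otimes>\<^sub>M ?G)" for i
  proof -
    have "fst \<in> measurable (?L \<Otimes>\<^sub>M ?G) (PiM UNIV (\<lambda>_. borel))"
      using measurable_fst[of ?L ?G] by (simp cong: measurable_cong_sets)
    then show ?thesis by (rule measurable_compose) (rule measurable_component_singleton, simp)
  qed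
  have c2: "(\<lambda>x. snd x i) \<in> borel_measurable (?L \<Otimes>\<^sub>M ?G)" if "i \<le> n" for i
  proof -
    have "(\<lambda>x. snd x i) \<in> measurable (?L \<Otimes>\<^sub>M ?G) F"
      by (rule measurable_compose[OF measurable_snd measurable_component_singleton]) (use that in simp)
    then show ?thesis using F_props(2) by (simp cong: measurable_cong_sets)
  qed
  have m: "(\<lambda>(y, v). h n y v) \<in> borel_measurable (?L \<Otimes>\<^sub>M ?G)" if "h \<in> {edge_charge, rank_charge}" for h
    unfolding case_prod_beta by (rule measurable_charge[OF that c1 c2])
  have "sigma_finite_measure ?G"
    by (intro prob_space_imp_sigma_finite prob_space_PiM F_props)
  then have "distr (?L \<Otimes>\<^sub>M ?G) (PiM UNIV (\<lambda>_. borel)) (\<lambda>(y, v). y(Suc n := rank_charge n y v)) =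
      distr (?L \<Otimes>\<^sub>M ?G) (PiM UNIV (\<lambda>_. borel)) (\<lambda>(y, v). y(Suc n := edge_charge n y v))"
    by (intro distr_fun_upd_eq distr_rank_charge F_props m) simp_all
  then show ?case
    by (simp add: distr_weight_Suc Suc)
qed

end

section \<open>Law of large numbers\<close>

text \<open>The ratio of consecutive cubes tends to 1, so monotonicity fills the gaps between them;
  \<open>m n\<close> is the integer cube root of \<open>n\<close>.\<close>

lemma tendsto_average_of_cubes:
  fixes g :: "nat \<Rightarrow> real"
  assumes mono: "mono g" and nonneg: "\<And>n. 0 \<le> g n"
    and lim: "(\<lambda>k. g (Suc k ^ 3) / real (Suc k ^ 3)) \<longlonglongrightarrow> c"
  shows "(\<lambda>n. g n / real n) \<longlonglongrightarrow> c"
proof -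
  define m where "m n = (LEAST k. n < Suc k ^ 3)" for n :: nat
  have m1: "n < Suc (m n) ^ 3" for n
    unfolding m_def
  proof (rule LeastI)
    show "n < Suc n ^ 3" by (rule less_le_trans[of _ "Suc n ^ 1"]) (simp, rule power_increasing, auto)
  qed
  have m2: "m n ^ 3 \<le> n" for n
  proof (cases "m n")
    case (Suc j)
    then have "j < m n" by simp
    then have "\<not> n < Suc j ^ 3" unfolding m_def by (rule not_less_Least)
    then show ?thesis by (simp only: Suc not_less)
  qed simp
  have mtop: "filterlim m at_top sequentially"
    unfolding filterlim_at_top eventually_sequentially
  proof (intro allI exI impI)
    fix K n :: nat assume n: "K ^ 3 \<le> n"
    show "K \<le> m n"
    proof (rule ccontr)
      assume "\<not> K \<le> m n"
      then have "Suc (m n) ^ 3 \<le> K ^ 3" by (intro power_mono) auto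
      with n m1[of n] show False by simp
    qed
  qed
  have lim': "(\<lambda>k. g (k ^ 3) / real (k ^ 3)) \<longlonglongrightarrow> c"
    by (rule LIMSEQ_imp_Suc) (rule lim)
  have r1: "(\<lambda>k. (real k / real (Suc k)) ^ 3) \<longlonglongrightarrow> 1 ^ 3"
    by (intro tendsto_power LIMSEQ_n_over_Suc_n)
  have r2: "(\<lambda>k. (real (Suc k) / real k) ^ 3) \<longlonglongrightarrow> 1 ^ 3"
    by (intro tendsto_power LIMSEQ_Suc_n_over_n)
  have lo: "(\<lambda>k. g (k ^ 3) / real (k ^ 3) * (real k / real (Suc k)) ^ 3) \<longlonglongrightarrow> c"
    using tendsto_mult[OF lim' r1] by simp
  have hi: "(\<lambda>k. g (Suc k ^ 3) / real (Suc k ^ 3) * (real (Suc k) / real k) ^ 3) \<longlonglongrightarrow> c"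
    using tendsto_mult[OF lim r2] by simp
  show ?thesis
  proof (rule tendsto_sandwich[OF _ _ filterlim_compose[OF lo mtop] filterlim_compose[OF hi mtop]])
    have ev: "\<forall>\<^sub>F n in sequentially. 1 \<le> m n" using mtop by (simp add: filterlim_at_top)
    from ev show "\<forall>\<^sub>F n in sequentially. g (m n ^ 3) / real (m n ^ 3) * (real (m n) / real (Suc (m n))) ^ 3 \<le> g n / real n"
    proof eventually_elim
      fix n assume k: "1 \<le> m n"
      then have "0 < m n ^ 3" by simp
      then have n: "1 \<le> n" using m2[of n] by linarith
      have "g (m n ^ 3) / real (m n ^ 3) * (real (m n) / real (Suc (m n))) ^ 3 = g (m n ^ 3) / real (Suc (m n) ^ 3)"
        using k by (simp add: power_divide)
      also have "\<dots> \<le> g n / real n"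
        using n nonneg monoD[OF mono m2[of n]] m1[of n] less_imp_le[OF m1[of n]]
        by (intro frac_le) (simp_all only: of_nat_le_iff of_nat_0_less_iff)
      finally show "g (m n ^ 3) / real (m n ^ 3) * (real (m n) / real (Suc (m n))) ^ 3 \<le> g n / real n" .
    qed
    from ev show "\<forall>\<^sub>F n in sequentially. g n / real n \<le> g (Suc (m n) ^ 3) / real (Suc (m n) ^ 3) * (real (Suc (m n)) / real (m n)) ^ 3"
    proof eventually_elim
      fix n assume k: "1 \<le> m n"
      have "g n / real n \<le> g (Suc (m n) ^ 3) / real (m n ^ 3)"
        using k nonneg monoD[OF mono less_imp_le[OF m1[of n]]] m2[of n]
        by (intro frac_le) (simp_all only: of_nat_le_iff of_nat_0_less_iff zero_less_power)
      also have "\<dots> = g (Suc (m n) ^ 3) / real (Suc (m n) ^ 3) * (real (Suc (m n)) / real (m n)) ^ 3"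
        by (simp add: power_divide del: of_nat_Suc)
      finally show "g n / real n \<le> g (Suc (m n) ^ 3) / real (Suc (m n) ^ 3) * (real (Suc (m n)) / real (m n)) ^ 3" .
    qed
  qed
qed

text \<open>The sum of all \<open>f k\<close> has finite expectation, so it is almost surely finite
  and its terms tend to 0. This does the work of Chebyshev and Borel-Cantelli along the
  cubes.\<close>

lemma AE_tendsto_0_of_summable_integral:
  fixes f :: "nat \<Rightarrow> 'a \<Rightarrow> real"
  assumes f: "\<And>k. integrable M (f k)" "\<And>k \<omega>. 0 \<le> f k \<omega>"
    and a: "\<And>k. integral\<^sup>L M (f k) \<le> a k" "summable a"
  shows "AE \<omega> in M. (\<lambda>k. f k \<omega>) \<longlonglongrightarrow> 0"
proof -
  have [measurable]: "f k \<in> borel_measurable M" for k using f(1) by auto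
  have i0: "0 \<le> integral\<^sup>L M (f k)" for k using f(2) by (intro Bochner_Integration.integral_nonneg) auto
  have "(\<integral>\<^sup>+\<omega>. (\<Sum>k. ennreal (f k \<omega>)) \<partial>M) = (\<Sum>k. \<integral>\<^sup>+\<omega>. ennreal (f k \<omega>) \<partial>M)"
    by (rule nn_integral_suminf) simp
  also have "\<dots> = (\<Sum>k. ennreal (integral\<^sup>L M (f k)))"
    using f by (intro suminf_cong nn_integral_eq_integral) auto
  also have "\<dots> \<noteq> top"
  proof (rule ennreal_suminf_neq_top[OF _ i0])
    show "summable (\<lambda>k. integral\<^sup>L M (f k))"
      by (rule summable_comparison_test'[OF a(2)]) (use i0 a(1) in simp)
  qed
  finally have "AE \<omega> in M. (\<Sum>k. ennreal (f k \<omega>)) \<noteq> \<infinity>"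
    by (intro nn_integral_noteq_infinite) (auto simp: infinity_ennreal_def)
  then show ?thesis
  proof eventually_elim
    fix \<omega> assume "(\<Sum>k. ennreal (f k \<omega>)) \<noteq> \<infinity>"
    then have "summable (\<lambda>k. f k \<omega>)"
      by (intro summable_suminf_not_top) (auto simp: f infinity_ennreal_def)
    then show "(\<lambda>k. f k \<omega>) \<longlonglongrightarrow> 0" by (rule summable_LIMSEQ_zero)
  qed
qed

text \<open>\<open>W\<close> is squeezed between \<open>g\<close> and, up to a shift by one,
  \<open>g\<close> minus an arbitrarily small proportion of \<open>n\<close>, one proportion for
  each \<open>j\<close>. The value -\<infinity> may occur in \<open>W\<close>, but \<open>lo\<close>
  rules it out for large indices.\<close>

lemma tendsto_lpp_average:
  fixes W :: "nat \<Rightarrow> ereal" and g :: "nat \<Rightarrow> real"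
  assumes lim: "(\<lambda>n. g n / real n) \<longlonglongrightarrow> c"
    and up: "\<And>n. W n \<le> ereal (g n)"
    and lo: "\<And>j. \<forall>\<^sub>F n in sequentially. ereal (g n) \<le> W (Suc n) + ereal (real (n div Suc j))"
  shows "(\<lambda>n. W n / ereal (real n)) \<longlonglongrightarrow> ereal c"
proof -
  have "(\<lambda>n. W (Suc n) / ereal (real (Suc n))) \<longlonglongrightarrow> ereal c"
  proof (rule order_tendstoI)
    fix a assume a: "a < ereal c"
    then obtain x where x: "a < ereal x" "x < c" by (metis ereal_dense2 less_ereal.simps(1))
    obtain j where j: "inverse (real (Suc j)) < c - x" using reals_Archimedean[of "c - x"] x by auto
    have "(\<lambda>n. g n / real n * (real n / real (Suc n))) \<longlonglongrightarrow> c * 1"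
      by (intro tendsto_mult lim LIMSEQ_n_over_Suc_n)
    then have "\<forall>\<^sub>F n in sequentially. x + inverse (real (Suc j)) < g n / real n * (real n / real (Suc n))"
      by (rule order_tendstoD) (use j in simp)
    then show "\<forall>\<^sub>F n in sequentially. a < W (Suc n) / ereal (real (Suc n))"
      using lo[of j] eventually_gt_at_top[of 0]
    proof eventually_elim
      fix n assume n: "x + inverse (real (Suc j)) < g n / real n * (real n / real (Suc n))" "0 < n"
        and w: "ereal (g n) \<le> W (Suc n) + ereal (real (n div Suc j))"
      have "real (n div Suc j) \<le> real n / real (Suc j)"
        by (rule of_nat_div_le_of_nat)
      also have "\<dots> \<le> real (Suc n) / real (Suc j)" by (intro divide_right_mono) auto
      finally have d: "real (n div Suc j) \<le> real (Suc n) * inverse (real (Suc j))" by (simp add: divide_inverse)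
      have "x * real (Suc n) < g n - real (n div Suc j)"
      proof -
        have "(x + inverse (real (Suc j))) * real (Suc n) < g n"
          using n by (simp add: pos_less_divide_eq del: of_nat_Suc)
        then show ?thesis using d by (simp add: algebra_simps)
      qed
      then have "ereal x < ereal ((g n - real (n div Suc j)) / real (Suc n))"
        by (simp add: pos_less_divide_eq del: of_nat_Suc)
      also have "\<dots> = ereal (g n - real (n div Suc j)) / ereal (real (Suc n))" by simp
      also have "\<dots> \<le> W (Suc n) / ereal (real (Suc n))"
      proof (rule ereal_divide_right_mono)
        show "ereal (g n - real (n div Suc j)) \<le> W (Suc n)"
          using w by (cases "W (Suc n)") auto
      qed simp
      finally show "a < W (Suc n) / ereal (real (Suc n))" using x(1) by simp
    qed
  next
    fix a assume a: "ereal c < a"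
    have "(\<lambda>n. ereal (g (Suc n) / real (Suc n))) \<longlonglongrightarrow> ereal c"
      by (intro tendsto_ereal LIMSEQ_Suc lim)
    then have "\<forall>\<^sub>F n in sequentially. ereal (g (Suc n) / real (Suc n)) < a" by (rule order_tendstoD) (rule a)
    then show "\<forall>\<^sub>F n in sequentially. W (Suc n) / ereal (real (Suc n)) < a"
    proof eventually_elim
      fix n assume "ereal (g (Suc n) / real (Suc n)) < a"
      moreover have "W (Suc n) / ereal (real (Suc n)) \<le> ereal (g (Suc n)) / ereal (real (Suc n))"
        by (rule ereal_divide_right_mono[OF up]) simp
      ultimately show "W (Suc n) / ereal (real (Suc n)) < a" by simp
    qed
  qed
  then show ?thesis by (rule LIMSEQ_imp_Suc)
qed

section \<open>The running maximum and the last passage constant\<close>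

context charge_field
begin

text \<open>Row \<open>j\<close> of the field carries the charges of the edges into vertex
  \<open>j\<close>, so each vertex comes with a fresh row.\<close>

definition edges :: "'a \<Rightarrow> nat \<times> nat \<Rightarrow> ereal" where
  "edges \<omega> = (\<lambda>p\<in>{(i, j). i < j}. case (case p of (i, j) \<Rightarrow> (int j, i)) of (t, k) \<Rightarrow> U t k \<omega>)"

definition lpp_front :: "nat \<Rightarrow> 'a \<Rightarrow> real" where
  "lpp_front n \<omega> = real_of_ereal (SUP i\<in>{..n}. weight edge_charge n \<omega> i)"

lemma distr_edges: "distr M (PiM {(i, j). i < j} (\<lambda>_. borel)) edges = lpp_space F"
  unfolding lpp_space_def edges_def[abs_def]
proof (rule distr_field)
  show "{(i, j). i < (j :: nat)} \<noteq> {}" by auto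
qed (auto simp: inj_on_def)

lemma weight_edge_charge: "i \<le> n \<Longrightarrow> weight edge_charge n \<omega> i = lpp_max (edges \<omega>) i"
  unfolding weight_def
proof (rule weights_edge_charge_eq_lpp_max)
  fix i j :: nat assume "i < j"
  then show "edges \<omega> (i, j) = U (1 + int (j - 1)) i \<omega>" by (simp add: edges_def of_nat_diff)
qed

lemma weight_measurable [measurable]:
  "h \<in> {edge_charge, rank_charge} \<Longrightarrow> weight h n \<in> measurable M (PiM UNIV (\<lambda>_. borel))"
  unfolding weight_def
proof (rule measurable_PiM_single')
  show "(\<lambda>\<omega>. weights h (\<lambda>i k. U (1 + int i) k \<omega>) n i) \<in> borel_measurable M"
    if "h \<in> {edge_charge, rank_charge}" for i
    by (rule measurable_weights[OF that]) simp
qed auto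

lemma expectation_weight_eq:
  fixes \<Phi> :: "(nat \<Rightarrow> ereal) \<Rightarrow> real"
  assumes [measurable]: "\<Phi> \<in> borel_measurable (PiM UNIV (\<lambda>_. borel))"
  shows "expectation (\<lambda>\<omega>. \<Phi> (weight edge_charge n \<omega>)) = expectation (\<lambda>\<omega>. \<Phi> (weight rank_charge n \<omega>))"
proof -
  have "expectation (\<lambda>\<omega>. \<Phi> (weight h n \<omega>)) = (\<integral>y. \<Phi> y \<partial>distr M (PiM UNIV (\<lambda>_. borel)) (weight h n))"
    if "h \<in> {edge_charge, rank_charge}" for h
    by (rule integral_distr[symmetric]) (use that weight_measurable in auto)
  then show ?thesis by (simp add: distr_weight)
qed

lemma prob_weight_eq:
  assumes S: "S \<in> sets (PiM UNIV (\<lambda>_. borel))"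
  shows "prob {\<omega>\<in>space M. weight edge_charge n \<omega> \<in> S} = prob {\<omega>\<in>space M. weight rank_charge n \<omega> \<in> S}"
proof -
  have "prob {\<omega>\<in>space M. weight h n \<omega> \<in> S} = measure (distr M (PiM UNIV (\<lambda>_. borel)) (weight h n)) S"
    if "h \<in> {edge_charge, rank_charge}" for h
    by (subst measure_distr) (use that S weight_measurable in \<open>auto intro!: arg_cong[of _ _ prob]\<close>)
  then show ?thesis by (simp add: distr_weight)
qed

lemma weight_rank_charge:
  shows "(SUP i\<in>{..n}. weight rank_charge n \<omega> i) = atoms_after single_atom (\<lambda>i k. U (1 + int i) k \<omega>) n 0"
    and "weight rank_charge (Suc n) \<omega> (Suc n) =
      top_charge (atoms_after single_atom (\<lambda>i k. U (1 + int i) k \<omega>) n) (\<lambda>k. U (1 + int n) k \<omega>)"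
  using weights_rank_charge[of "\<lambda>i k. U (1 + int i) k \<omega>" n, OF le_1]
    SUP_eq_sorted_desc_0[of "weight rank_charge n \<omega>" "Suc n"]
  by (simp_all only: weight_def lessThan_Suc_atMost)

text \<open>Only the law of the weight vector up to \<open>n\<close> enters, so weights by ranks may
  be used, and their maximum is the front of the atom system.\<close>

lemma second_moment_lpp_front:
  "expectation (\<lambda>\<omega>. (lpp_front n \<omega> / real n - c)\<^sup>2) = expectation (\<lambda>\<omega>. (front n \<omega> / real n - c)\<^sup>2)"
proof -
  let ?\<Phi> = "\<lambda>y. (real_of_ereal (SUP i\<in>{..n}. y i) / real n - c)\<^sup>2"
  have "(\<lambda>y. SUP i\<in>{..n}. y i) \<in> borel_measurable (PiM UNIV (\<lambda>_. borel :: ereal measure))"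
    by (rule borel_measurable_SUP) simp_all
  then have "?\<Phi> \<in> borel_measurable (PiM UNIV (\<lambda>_. borel))" by measurable
  from expectation_weight_eq[OF this, of n] show ?thesis
    by (simp add: lpp_front_def front_def weight_rank_charge)
qed

lemma lpp_max_bounds: "lpp_max (edges \<omega>) n \<le> ereal (real n)"
proof (induction n rule: less_induct)
  case (less n)
  show ?case
  proof (cases n)
    case (Suc m)
    have "lpp_max (edges \<omega>) i + edges \<omega> (i, Suc m) \<le> ereal (real n)" if "i \<le> m" for i
    proof -
      have "lpp_max (edges \<omega>) i + edges \<omega> (i, Suc m) \<le> ereal (real i) + 1"
        using that by (intro add_mono less) (auto simp: Suc edges_def le_1)
      also have "\<dots> \<le> ereal (real n)" using that by (simp add: Suc one_ereal_def)
      finally show ?thesis .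
    qed
    then show ?thesis unfolding Suc lpp_max_Suc by (intro SUP_least) (auto simp: Suc)
  qed (simp add: lpp_max_0)
qed

lemma lpp_front_eq: "ereal (lpp_front n \<omega>) = (SUP i\<in>{..n}. lpp_max (edges \<omega>) i)"
proof -
  have e: "(SUP i\<in>{..n}. weight edge_charge n \<omega> i) = (SUP i\<in>{..n}. lpp_max (edges \<omega>) i)"
    by (intro SUP_cong refl) (simp add: weight_edge_charge)
  have "0 \<le> (SUP i\<in>{..n}. lpp_max (edges \<omega>) i)"
    by (rule SUP_upper2[of 0]) (auto simp: lpp_max_0)
  moreover have "(SUP i\<in>{..n}. lpp_max (edges \<omega>) i) \<le> ereal (real n)"
    by (intro SUP_least order_trans[OF lpp_max_bounds]) auto
  ultimately show ?thesis unfolding lpp_front_def e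
    by (cases "SUP i\<in>{..n}. lpp_max (edges \<omega>) i") auto
qed

lemma lpp_front_nonneg: "0 \<le> lpp_front n \<omega>"
proof -
  have "0 \<le> ereal (lpp_front n \<omega>)" unfolding lpp_front_eq
    by (rule SUP_upper2[of 0]) (auto simp: lpp_max_0)
  then show ?thesis by simp
qed

lemma lpp_front_le: "lpp_front n \<omega> \<le> real n"
proof -
  have "ereal (lpp_front n \<omega>) \<le> ereal (real n)" unfolding lpp_front_eq
    by (intro SUP_least order_trans[OF lpp_max_bounds]) auto
  then show ?thesis by simp
qed

lemma mono_lpp_front: "mono (\<lambda>n. lpp_front n \<omega>)"
proof (rule monoI)
  fix m n :: nat assume "m \<le> n"
  then have "ereal (lpp_front m \<omega>) \<le> ereal (lpp_front n \<omega>)"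
    unfolding lpp_front_eq by (intro SUP_subset_mono) auto
  then show "lpp_front m \<omega> \<le> lpp_front n \<omega>" by simp
qed

lemma lpp_max_measurable:
  "(\<lambda>e. lpp_max e n) \<in> borel_measurable (PiM {(i, j). i < j} (\<lambda>_. borel))"
proof (induction n rule: less_induct)
  case (less n)
  show ?case
  proof (cases n)
    case 0 then show ?thesis by (simp add: lpp_max_0)
  next
    case (Suc m)
    show ?thesis unfolding Suc lpp_max_Suc
    proof (rule borel_measurable_SUP)
      fix i assume "i \<in> {..m}"
      then have [measurable]: "(\<lambda>e. lpp_max e i) \<in> borel_measurable (PiM {(i, j). i < j} (\<lambda>_. borel))"
        "(\<lambda>e. e (i, Suc m)) \<in> borel_measurable (PiM {(i, j). i < j} (\<lambda>_. borel :: ereal measure))"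
        by (auto intro!: less measurable_component_singleton simp: Suc)
      show "(\<lambda>e. lpp_max e i + e (i, Suc m)) \<in> borel_measurable (PiM {(i, j). i < j} (\<lambda>_. borel))"
        by measurable
    qed simp
  qed
qed

lemma edges_measurable: "edges \<in> measurable M (PiM {(i, j). i < j} (\<lambda>_. borel))"
  unfolding edges_def[abs_def] by (rule measurable_restrict) (auto split: prod.split)

lemma lpp_front_measurable [measurable]: "lpp_front n \<in> borel_measurable M"
proof -
  have "(\<lambda>\<omega>. SUP i\<in>{..n}. lpp_max (edges \<omega>) i) \<in> borel_measurable M"
    by (rule borel_measurable_SUP) (auto intro: measurable_compose[OF edges_measurable lpp_max_measurable])
  then have "(\<lambda>\<omega>. real_of_ereal (SUP i\<in>{..n}. lpp_max (edges \<omega>) i)) \<in> borel_measurable M" by measurable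
  then show ?thesis unfolding lpp_front_eq[symmetric] by simp
qed

lemma AE_lpp_front: "AE \<omega> in M. (\<lambda>n. lpp_front n \<omega> / real n) \<longlonglongrightarrow> c"
proof -
  obtain D where D: "\<And>k. expectation (\<lambda>\<omega>. (front (Suc k ^ 3) \<omega> / real (Suc k ^ 3) - c)\<^sup>2) \<le> D / (real k + 1)\<^sup>2"
    by (rule second_moment_front_cube) blast
  have "AE \<omega> in M. (\<lambda>k. (lpp_front (Suc k ^ 3) \<omega> / real (Suc k ^ 3) - c)\<^sup>2) \<longlonglongrightarrow> 0"
  proof (rule AE_tendsto_0_of_summable_integral)
    fix k
    show "integrable M (\<lambda>\<omega>. (lpp_front (Suc k ^ 3) \<omega> / real (Suc k ^ 3) - c)\<^sup>2)"
    proof (rule integrable_const_bound[where B = 1], intro AE_I2)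
      fix \<omega>
      have "0 \<le> lpp_front (Suc k ^ 3) \<omega> / real (Suc k ^ 3)" "lpp_front (Suc k ^ 3) \<omega> / real (Suc k ^ 3) \<le> 1"
        using lpp_front_nonneg[of "Suc k ^ 3" \<omega>] lpp_front_le[of "Suc k ^ 3" \<omega>]
        by (simp_all add: divide_le_eq_1 del: of_nat_power of_nat_Suc)
      then have "\<bar>lpp_front (Suc k ^ 3) \<omega> / real (Suc k ^ 3) - c\<bar> \<le> 1" using c_bounds by linarith
      then show "norm ((lpp_front (Suc k ^ 3) \<omega> / real (Suc k ^ 3) - c)\<^sup>2) \<le> 1"
        using power_mono[of "\<bar>lpp_front (Suc k ^ 3) \<omega> / real (Suc k ^ 3) - c\<bar>" 1 2] by simp
    qed measurable
    show "expectation (\<lambda>\<omega>. (lpp_front (Suc k ^ 3) \<omega> / real (Suc k ^ 3) - c)\<^sup>2) \<le> D / (real k + 1)\<^sup>2"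
      unfolding second_moment_lpp_front by (rule D)
  qed (auto intro: summable_over_square)
  then show ?thesis
  proof eventually_elim
    fix \<omega> assume "(\<lambda>k. (lpp_front (Suc k ^ 3) \<omega> / real (Suc k ^ 3) - c)\<^sup>2) \<longlonglongrightarrow> 0"
    then have "(\<lambda>k. sqrt ((lpp_front (Suc k ^ 3) \<omega> / real (Suc k ^ 3) - c)\<^sup>2)) \<longlonglongrightarrow> sqrt 0"
      by (rule tendsto_real_sqrt)
    then have "(\<lambda>k. lpp_front (Suc k ^ 3) \<omega> / real (Suc k ^ 3) - c) \<longlonglongrightarrow> 0"
      by (simp only: real_sqrt_abs real_sqrt_zero tendsto_rabs_zero_iff)
    then have "(\<lambda>k. lpp_front (Suc k ^ 3) \<omega> / real (Suc k ^ 3)) \<longlonglongrightarrow> c"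
      by (rule LIM_zero_cancel)
    then show "(\<lambda>n. lpp_front n \<omega> / real n) \<longlonglongrightarrow> c"
      by (rule tendsto_average_of_cubes[OF mono_lpp_front lpp_front_nonneg])
  qed
qed

text \<open>In the rank version a drop by more than \<open>K\<close> means a relative charge below
  \<open>-K\<close>, which a regeneration in the window of length \<open>K\<close> excludes.\<close>

lemma prob_lpp_max_drop:
  assumes "K \<le> n"
  shows "prob {\<omega>\<in>space M. lpp_max (edges \<omega>) (Suc n) + ereal (real K) < ereal (lpp_front n \<omega>)} \<le> prob (no_regen (1 + int n) K)"
proof -
  define S where "S = {y\<in>space (PiM UNIV (\<lambda>_. borel)). y (Suc n) + ereal (real K) < (SUP i\<in>{..n}. y i :: ereal)}"
  have [measurable]: "(\<lambda>y. SUP i\<in>{..n}. y i) \<in> borel_measurable (PiM UNIV (\<lambda>_. borel :: ereal measure))"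
    by (rule borel_measurable_SUP) simp_all
  have S: "S \<in> sets (PiM UNIV (\<lambda>_. borel))" unfolding S_def by measurable
  have "{\<omega>\<in>space M. lpp_max (edges \<omega>) (Suc n) + ereal (real K) < ereal (lpp_front n \<omega>)}
      = {\<omega>\<in>space M. weight edge_charge (Suc n) \<omega> \<in> S}"
    by (auto simp: S_def lpp_front_eq weight_edge_charge space_PiM cong: SUP_cong_simp)
  also have "prob \<dots> = prob {\<omega>\<in>space M. weight rank_charge (Suc n) \<omega> \<in> S}"
    by (rule prob_weight_eq[OF S])
  also have "\<dots> \<le> prob (no_regen (1 + int n) K)"
  proof (rule finite_measure_mono)
    show "{\<omega>\<in>space M. weight rank_charge (Suc n) \<omega> \<in> S} \<subseteq> no_regen (1 + int n) K"
    proof (intro subsetI, rule ccontr)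
      fix \<omega> assume w: "\<omega> \<in> {\<omega>\<in>space M. weight rank_charge (Suc n) \<omega> \<in> S}" and "\<omega> \<notin> no_regen (1 + int n) K"
      then have nb: "\<omega> \<in> space M - no_regen (1 + int n) K" by simp
      let ?a = "atoms_after single_atom (\<lambda>i k. U (1 + int i) k \<omega>) n"
      have "weight rank_charge (Suc n) \<omega> i = weight rank_charge n \<omega> i" if "i \<le> n" for i
        using that by (simp add: weight_def)
      then have "(SUP i\<in>{..n}. weight rank_charge (Suc n) \<omega> i) = ?a 0"
        unfolding weight_rank_charge(1)[symmetric] by (intro SUP_cong) auto
      with w have lt: "top_charge ?a (\<lambda>k. U (1 + int n) k \<omega>) + ereal (real K) < ?a 0"
        by (simp add: S_def weight_rank_charge)
      have "ereal (- real K) \<le> rel_charge single_atom (\<lambda>i k. U (1 + int i) k \<omega>) n"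
        using regen_coupling[OF nb proper_single_atom assms] by simp
      moreover have "proper ?a" by (intro proper_atoms_after proper_single_atom le_1)
      ultimately show False using lt unfolding rel_charge_def proper_def
        by (cases "?a 0"; cases "top_charge ?a (\<lambda>k. U (1 + int n) k \<omega>)") auto
    qed
  qed simp
  finally show ?thesis .
qed

lemma AE_lpp_max_drop:
  "AE \<omega> in M. \<forall>\<^sub>F n in sequentially. ereal (lpp_front n \<omega>) \<le> lpp_max (edges \<omega>) (Suc n) + ereal (real (n div Suc j))"
proof -
  obtain C where C: "0 \<le> C" "\<And>t K. prob (no_regen t K) \<le> C / (real K + 1)\<^sup>2" by (rule prob_no_regen) blast
  have [measurable]: "(\<lambda>\<omega>. lpp_max (edges \<omega>) n) \<in> borel_measurable M" for n
    by (rule measurable_compose[OF edges_measurable lpp_max_measurable])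
  let ?A = "\<lambda>n. {\<omega>\<in>space M. lpp_max (edges \<omega>) (Suc n) + ereal (real (n div Suc j)) < ereal (lpp_front n \<omega>)}"
  have "AE \<omega> in M. \<forall>\<^sub>F n in sequentially. \<omega> \<in> space M - ?A n"
  proof (rule borel_cantelli_AE1)
    \<comment> \<open>Since \<open>n div Suc j + 1\<close> is at least (n+1)/(j+1), the bound stays
      summable in \<open>n\<close> at the cost of the fixed factor (j+1)^2.\<close>
    have "prob (?A n) \<le> C * (real (Suc j))\<^sup>2 / (real n + 1)\<^sup>2" for n
    proof -
      have "n < Suc (n div Suc j) * Suc j"
        using dividend_less_div_times[of "Suc j" n] by simp
      then have "n + 1 \<le> Suc (n div Suc j) * Suc j" by simp
      then have "real (n + 1) \<le> real (Suc (n div Suc j) * Suc j)" by (rule of_nat_mono)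
      then have le: "real n + 1 \<le> (real (n div Suc j) + 1) * real (Suc j)"
        unfolding of_nat_mult by (simp add: add.commute)
      have "prob (?A n) \<le> prob (no_regen (1 + int n) (n div Suc j))" by (rule prob_lpp_max_drop) simp
      also have "\<dots> \<le> C / (real (n div Suc j) + 1)\<^sup>2" by (rule C)
      also have "\<dots> = C * (real (Suc j))\<^sup>2 / ((real (n div Suc j) + 1) * real (Suc j))\<^sup>2"
        by (simp add: power_mult_distrib)
      also have "\<dots> \<le> C * (real (Suc j))\<^sup>2 / (real n + 1)\<^sup>2"
        using C(1) le by (intro divide_left_mono power_mono mult_pos_pos) auto
      finally show ?thesis .
    qed
    then show "summable (\<lambda>n. prob (?A n))"
      by (intro summable_comparison_test'[OF summable_over_square]) simp
  qed (measurable, auto simp: less_top[symmetric])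
  then show ?thesis
    by eventually_elim (elim eventually_mono, auto simp: not_less)
qed

lemma AE_lpp_max_average:
  "AE \<omega> in M. (\<lambda>n. lpp_max (edges \<omega>) n / ereal (real n)) \<longlonglongrightarrow> ereal c"
proof -
  have "AE \<omega> in M. \<forall>j. \<forall>\<^sub>F n in sequentially. ereal (lpp_front n \<omega>) \<le> lpp_max (edges \<omega>) (Suc n) + ereal (real (n div Suc j))"
    by (subst AE_all_countable) (rule allI, rule AE_lpp_max_drop)
  with AE_lpp_front show ?thesis
  proof eventually_elim
    fix \<omega> assume l: "(\<lambda>n. lpp_front n \<omega> / real n) \<longlonglongrightarrow> c"
      and d: "\<forall>j. \<forall>\<^sub>F n in sequentially. ereal (lpp_front n \<omega>) \<le> lpp_max (edges \<omega>) (Suc n) + ereal (real (n div Suc j))"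
    show "(\<lambda>n. lpp_max (edges \<omega>) n / ereal (real n)) \<longlonglongrightarrow> ereal c"
    proof (rule tendsto_lpp_average[OF l])
      show "lpp_max (edges \<omega>) n \<le> ereal (lpp_front n \<omega>)" for n
        unfolding lpp_front_eq by (rule SUP_upper) simp
    qed (use d in blast)
  qed
qed

lemma lpp_constant_eq: "lpp_constant F = c"
proof (rule lpp_constant_eqI[OF F_props(1)])
  let ?I = "{(i, j). i < (j :: nat)}"
  \<comment> \<open>Written with \<open>liminf\<close> and \<open>limsup\<close>, convergence is a
    measurable event on the space of edge charges, as the transfer of the law along
    \<open>edges\<close> requires.\<close>
  have iff: "(\<lambda>n. lpp_max e n / ereal (real n)) \<longlonglongrightarrow> ereal c \<longleftrightarrow>
      liminf (\<lambda>n. lpp_max e n / ereal (real n)) = ereal c \<and> limsup (\<lambda>n. lpp_max e n / ereal (real n)) = ereal c" for e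
    by (rule tendsto_iff_Liminf_eq_Limsup) simp
  note lpp_max_measurable [measurable]
  have "{e\<in>space (PiM ?I (\<lambda>_. borel)). (\<lambda>n. lpp_max e n / ereal (real n)) \<longlonglongrightarrow> ereal c} \<in> sets (PiM ?I (\<lambda>_. borel))"
    unfolding iff by measurable
  then show "AE e in lpp_space F. (\<lambda>n. lpp_max e n / ereal (real n)) \<longlonglongrightarrow> ereal c"
    unfolding distr_edges[symmetric]
    by (subst AE_distr_iff[OF edges_measurable]) (auto intro: AE_lpp_max_average)
qed

end

theorem theorem1:
  fixes M :: "'a measure"
    and F :: "ereal measure"
    and l p :: real
    and w :: "int \<Rightarrow> nat \<Rightarrow> 'a \<Rightarrow> ereal"
    and \<nu>0 :: "ereal measure"
    and \<nu> :: "nat \<Rightarrow> 'a \<Rightarrow> ereal measure"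
  assumes "prob_space F" and "sets F = sets borel"
    and "\<And>\<epsilon>::real. \<epsilon> > 0 \<Longrightarrow> measure F {ereal (1 - \<epsilon>)..1} > 0"
    and "measure F {1<..} = 0"
    and "0 \<le> l" and "l < 1"
    and "p = measure F {ereal (1 - l)..1}" and "0 < p" and "p \<le> 1"
    and "prob_space M"
    and "prob_space.indep_vars M (\<lambda>_. borel) (\<lambda>(t, i). w t i) (UNIV \<times> {1..})"
    and "\<And>t i. i \<ge> 1 \<Longrightarrow> distr M borel (w t i) = F"
    and "\<nu>0 \<in> point_measures" and "\<nu>0 \<noteq> null_measure borel"
    and "\<And>\<omega>. \<omega> \<in> space M \<Longrightarrow> \<nu> 0 \<omega> = \<nu>0"
    and "\<And>t \<omega>. \<omega> \<in> space M \<Longrightarrow> \<nu> (t + 1) \<omega> = Psi (\<lambda>i. w (int (t + 1)) i \<omega>) (\<nu> t \<omega>)"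
  shows "\<exists>mbar :: int \<Rightarrow> 'a \<Rightarrow> ereal.
    stationary_process M mbar
    \<and> (\<forall>t. \<forall>\<omega>\<in>space M. mbar t \<omega> < \<infinity>)
    \<and> (AE \<omega> in M. \<forall>\<^sub>F t in sequentially.
          max_charge (recenter (\<nu> (t - 1) \<omega>)) (\<lambda>i. w (int t) i \<omega>) = mbar (int t) \<omega>)
    \<and> has_bochner_integral M (\<lambda>\<omega>. real_of_ereal (max (mbar 0 \<omega>) 0)) (lpp_constant F)"
proof -
  interpret prob_space M by fact
  interpret F: prob_space F by fact
  \<comment> \<open>Truncation at 1 alters the charges only on a null set and yields the bound at
    every point; \<open>Suc k\<close> passes from indices starting at 1 to indices starting at
    0.\<close>
  define U where "U t k \<omega> = min 1 (w t (Suc k) \<omega>)" for t :: int and k :: nat and \<omega>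
  have wm [measurable]: "w t (Suc k) \<in> borel_measurable M" for t k
    using assms(11) by (auto simp: indep_vars_def2)
  have F1: "AE x in F. x \<le> 1"
  proof (rule AE_I)
    show "emeasure F {1<..} = 0" using assms(4) by (simp add: F.emeasure_eq_measure)
  qed (auto simp: assms(2) not_le)
  interpret charge_field M F U
  proof
    show "U t k \<omega> \<le> 1" for t k \<omega> by (simp add: U_def)
    show "distr M borel (U t k) = F" for t k
    proof -
      have "distr M borel (U t k) = distr (distr M borel (w t (Suc k))) borel (\<lambda>x. min 1 x)"
        by (subst distr_distr) (auto simp: U_def[abs_def] comp_def)
      also have "\<dots> = distr F borel (\<lambda>x. min 1 x)" by (simp add: assms(12))
      also have "\<dots> = distr F F (\<lambda>x. x)"
      proof (rule distr_cong_AE)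
        show "AE x in F. min 1 x = x" using F1 by eventually_elim (simp add: min_absorb2)
      qed (auto simp: assms(2) cong: measurable_cong_sets)
      finally show ?thesis by simp
    qed
    have "indep_vars (\<lambda>_. borel) (\<lambda>p. (case (case p of (t, k) \<Rightarrow> (t, Suc k)) of (t, i) \<Rightarrow> w t i)) UNIV"
      by (rule indep_vars_reindex[OF assms(11)]) (auto simp: inj_on_def)
    from indep_vars_compose2[OF this, of "\<lambda>_ x. min 1 x" "\<lambda>_. borel"]
    show "indep_vars (\<lambda>_. borel) (\<lambda>(t, k). U t k) UNIV"
      by (simp add: U_def[abs_def] case_prod_beta')
    have "measure F {ereal (1 - 1/2)..1} > 0" by (rule assms(3)) simp
    also have "measure F {ereal (1 - 1/2)..1} \<le> measure F {ereal (1/2)..}"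
      by (intro F.finite_measure_mono) (auto simp: assms(2))
    finally show "measure F {ereal (1/2)..} > 0" .
  qed
  let ?a = "\<lambda>k. atom \<nu>0 (Suc k)"
  \<comment> \<open>One null set for all of the countably many charges: outside it the truncated
    field coincides with the given one.\<close>
  have w1: "AE \<omega> in M. \<forall>t k. w t (Suc k) \<omega> \<le> 1"
  proof (subst AE_all_countable, rule allI, subst AE_all_countable, rule allI)
    fix t k
    have "distr M borel (w t (Suc k)) = F" by (rule assms(12)) simp
    with F1 have "AE x in distr M borel (w t (Suc k)). x \<le> 1" by (simp only:)
    then show "AE \<omega> in M. w t (Suc k) \<omega> \<le> 1" by (rule AE_distrD[OF wm])
  qed
  have "AE \<omega> in M. \<forall>\<^sub>F t in sequentially.
          max_charge (recenter (\<nu> (t - 1) \<omega>)) (\<lambda>i. w (int t) i \<omega>) = mbar (int t) \<omega>"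
    using w1 AE_eventually_mbar[OF proper_atom[OF assms(13,14)]] AE_space
  proof eventually_elim
    fix \<omega> assume w: "\<forall>t k. w t (Suc k) \<omega> \<le> 1" and sp: "\<omega> \<in> space M"
      and ev: "\<forall>\<^sub>F n in sequentially. rel_charge ?a (\<lambda>i k. U (1 + int i) k \<omega>) n = mbar (int (Suc n)) \<omega>"
    have "max_charge (recenter (\<nu> n \<omega>)) (\<lambda>i. w (int (Suc n)) i \<omega>) = rel_charge ?a (\<lambda>i k. U (1 + int i) k \<omega>) n" for n
    proof (rule max_charge_recenter_iterate[where \<nu> = "\<lambda>t. \<nu> t \<omega>" and w = "\<lambda>t i. w (int (Suc t)) i \<omega>"])
      show "\<nu> 0 \<omega> = \<nu>0" using assms(15) sp by simp
      show "\<nu> (Suc t) \<omega> = Psi (\<lambda>i. w (int (Suc t)) i \<omega>) (\<nu> t \<omega>)" for t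
        using assms(16)[OF sp, of t] by simp
      show "w (int (Suc t)) (Suc k) \<omega> = U (1 + int t) k \<omega>" for t k
        using w by (simp add: U_def min_absorb2)
    qed (use assms(13,14) le_1 in auto)
    \<comment> \<open>The claim is shown at \<open>t = Suc n\<close>, where \<open>t - 1\<close> is
      a genuine predecessor, and then shifted back.\<close>
    with ev have "\<forall>\<^sub>F n in sequentially.
       max_charge (recenter (\<nu> (Suc n - 1) \<omega>)) (\<lambda>i. w (int (Suc n)) i \<omega>) = mbar (int (Suc n)) \<omega>" by simp
    then show "\<forall>\<^sub>F t in sequentially. max_charge (recenter (\<nu> (t - 1) \<omega>)) (\<lambda>i. w (int t) i \<omega>) = mbar (int t) \<omega>"
      by (rule eventually_sequentially_Suc[THEN iffD1])
  qed
  moreover have "\<forall>t. \<forall>\<omega>\<in>space M. mbar t \<omega> < \<infinity>"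
    by (intro allI ballI le_less_trans[OF mbar_le]) simp
  moreover have "has_bochner_integral M (\<lambda>\<omega>. real_of_ereal (max (mbar 0 \<omega>) 0)) (lpp_constant F)"
    unfolding lpp_constant_eq c_def pos_part_def[symmetric]
    by (intro has_bochner_integral_integrable integrable_pos_part) (auto simp: mbar_le)
  ultimately show ?thesis using stationary_mbar by blast
qed

end
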